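(* Let $\omega:\mathbb T\to\mathbb R$ be a non-constant real-valued function with $\omega\in L^1(\mathbb T)$ and $\operatorname{ess\,inf}\omega>-\infty$, let $T=T(\omega)$ be the self-adjoint Toeplitz operator with symbol $\omega$ and $E(\lambda)=E((-\infty,\lambda))$ its spectral family. For $z\in\mathbb D$ and a.e. $\lambda\in\mathbb R$ define $$\xi(z;\lambda)=\exp\Big(-\frac12\int_{\mathbb T}\ln|\omega(\zeta)-\lambda|\,H(z\overline\zeta)\,d\mathbf m(\zeta)\Big),\qquad A(z;\lambda)=\frac{\pi}{2}\int_{\Gamma(\lambda)}H(z\overline\zeta)\,d\mathbf m(\zeta),$$ where $\Gamma(\lambda)=\{\zeta\in\mathbb T:\omega(\zeta)<\lambda\}$. Then for all $u,v\in\mathbb D$ and a.e. $\lambda\in\mathbb R$, $$\frac{d}{d\lambda}\big(E(\lambda)K_u,K_v\big)=\frac1\pi(1-\overline u v)^{-1}\,\overline{\xi(u;\lambda)}\,\xi(v;\lambda)\,\sin\Big(\overline{A(u;\lambda)}+A(v;\lambda)\Big).$$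
   Context: $\mathbb D$ is the open unit disk, $\mathbb T$ the unit circle with normalized Lebesgue measure $d\mathbf m(\zeta)=(2\pi i\zeta)^{-1}d\zeta$. $\mathbb H^2\subset L^2(\mathbb T)$ is the Hardy space with inner product $(f,g)=\int_{\mathbb T}f\overline g\,d\mathbf m$. $H(z)=\frac{1+z}{1-z}$ and, for $u\in\mathbb D$, $K_u(z)=(1-\overline u z)^{-1}$. For a.e. $\lambda\in\mathbb R$ one has $\ln|\omega(\cdot)-\lambda|\in L^1(\mathbb T)$, so that $\xi(z;\lambda)$ is well defined. Definition of $T(\omega)$: let $\gamma_1=\operatorname{ess\,inf}\omega$ and for $\lambda<\gamma_1$ let $F_\lambda(z)=\exp\big(\frac12\int_{\mathbb T}\ln(\omega(\zeta)-\lambda)H(z\overline\zeta)\,d\mathbf m(\zeta)\big)$, $z\in\mathbb D$; this is an outer function in $\mathbb H^2$ with $|F_\lambda(\zeta)|^2=\omega(\zeta)-\lambda$ a.e. on $\mathbb T$. The form $T[f,g]=\int_{\mathbb T}\omega f\overline g\,d\mathbf m$ on the domain $D[T]=\{f\in\mathbb H^2: F_\lambda f\in\mathbb H^2\}$ (independent of $\lambda<\gamma_1$) is densely defined, closed and bounded below by $\gamma_1$; $T=T(\omega)$ is the associated self-adjoint operator in $\mathbb H^2$, i.e. $(Tf,g)=T[f,g]$ for $f\in D(T)$, $g\in D[T]$. (If $\omega$ is bounded, $Tf=\mathbb P(\omega f)$ with $\mathbb P$ the orthogonal projection of $L^2(\mathbb T)$ onto $\mathbb H^2$.) $E(X)$,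 $X\subset\mathbb R$ Borel, is the spectral measure of $T$. *)

theory Defs
  imports "HOL-Probability.Essential_Supremum"
begin

text \<open>Normalized Lebesgue measure \<open>d\<zeta> / (2 \<pi> \<i> \<zeta>) = dt / (2 \<pi>)\<close>, \<open>\<zeta> = cis t\<close>, on the unit circle.\<close>

definition circle :: "complex measure" where
  "circle = distr (uniform_measure lborel {0..<2 * pi}) (restrict_space borel (sphere 0 1)) cis"


section \<open>The Hardy space\<close>

text \<open>Elements of \<open>L\<^sup>2\<close> and \<open>H\<^sup>2\<close> are represented by functions on the
  unit circle; equality of elements is equality almost everywhere.\<close>

definition L2 :: "(complex \<Rightarrow> complex) set" where
  "L2 = {f \<in> borel_measurable circle. integrable circle (\<lambda>\<zeta>. (norm (f \<zeta>))\<^sup>2)}"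

definition ip :: "(complex \<Rightarrow> complex) \<Rightarrow> (complex \<Rightarrow> complex) \<Rightarrow> complex" where
  "ip f g = (LINT \<zeta>|circle. f \<zeta> * cnj (g \<zeta>))"

text \<open>For \<open>n \<ge> 1\<close> the integral below is the Fourier coefficient of \<open>f\<close> of index \<open>- n\<close>.\<close>

definition H2 :: "(complex \<Rightarrow> complex) set" where
  "H2 = {f \<in> L2. \<forall>n\<ge>1. (LINT \<zeta>|circle. f \<zeta> * \<zeta> ^ n) = 0}"

definition Hker :: "complex \<Rightarrow> complex" where
  "Hker z = (1 + z) / (1 - z)"

definition Kker :: "complex \<Rightarrow> complex \<Rightarrow> complex" where
  "Kker u z = inverse (1 - cnj u * z)"


section \<open>The Toeplitz operator of a semibounded symbol\<close>

definition essinf :: "'a measure \<Rightarrow> ('a \<Rightarrow> real) \<Rightarrow> ereal" where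
  "essinf M f = - esssup M (\<lambda>x. ereal (- f x))"

text \<open>The outer function with \<open>\<bar>outer \<omega> l\<bar>\<^sup>2 = \<omega> - l\<close> almost everywhere on the circle, for \<open>l\<close> below the
  essential infimum of \<open>\<omega>\<close>; its values on the circle are the radial limits.\<close>

definition outer :: "(complex \<Rightarrow> real) \<Rightarrow> real \<Rightarrow> complex \<Rightarrow> complex" where
  "outer \<omega> l z =
     exp (1 / 2 * (LINT \<zeta>|circle. complex_of_real (ln (\<omega> \<zeta> - l)) * Hker (z * cnj \<zeta>)))"

definition boundary_value :: "(complex \<Rightarrow> complex) \<Rightarrow> complex \<Rightarrow> complex" where
  "boundary_value F \<zeta> = Lim (at_left 1) (\<lambda>r. F (complex_of_real r * \<zeta>))"

text \<open>The condition defining the form domain does not depend on the choice of \<open>l\<close> below the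
  essential infimum of \<open>\<omega>\<close>; it is imposed for every such \<open>l\<close>.\<close>

definition form_domain :: "(complex \<Rightarrow> real) \<Rightarrow> (complex \<Rightarrow> complex) set" where
  "form_domain \<omega> = {f \<in> H2. \<forall>l. ereal l < essinf circle \<omega> \<longrightarrow>
      (\<lambda>\<zeta>. boundary_value (outer \<omega> l) \<zeta> * f \<zeta>) \<in> H2}"

definition toeplitz_form ::
  "(complex \<Rightarrow> real) \<Rightarrow> (complex \<Rightarrow> complex) \<Rightarrow> (complex \<Rightarrow> complex) \<Rightarrow> complex" where
  "toeplitz_form \<omega> f g = (LINT \<zeta>|circle. complex_of_real (\<omega> \<zeta>) * f \<zeta> * cnj (g \<zeta>))"

text \<open>Unbounded operators in \<open>H\<^sup>2\<close> are given by their graphs.  The following is the operator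
  associated with the form: \<open>f\<close> is in its domain, with value \<open>h\<close>, if and only if \<open>f\<close> is in the
  form domain and \<open>toeplitz_form \<omega> f g = ip h g\<close> for all \<open>g\<close> in the form domain.\<close>

definition toeplitz ::
  "(complex \<Rightarrow> real) \<Rightarrow> ((complex \<Rightarrow> complex) \<times> (complex \<Rightarrow> complex)) set" where
  "toeplitz \<omega> = {(f, h). f \<in> form_domain \<omega> \<and> h \<in> H2 \<and>
      (\<forall>g\<in>form_domain \<omega>. ip h g = toeplitz_form \<omega> f g)}"


section \<open>Spectral measures\<close>

text \<open>Linearity of each \<open>E X\<close>, and compatibility with equality almost everywhere, follow from
  the symmetry condition.\<close>

definition projection_valued_measure ::
  "(real set \<Rightarrow> (complex \<Rightarrow> complex) \<Rightarrow> (complex \<Rightarrow> complex)) \<Rightarrow> bool" where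
  "projection_valued_measure E \<longleftrightarrow>
     (\<forall>X\<in>sets borel. \<forall>f\<in>H2. E X f \<in> H2) \<and>
     (\<forall>X\<in>sets borel. \<forall>f\<in>H2. \<forall>g\<in>H2. ip (E X f) g = ip f (E X g)) \<and>
     (\<forall>X\<in>sets borel. \<forall>Y\<in>sets borel. \<forall>f\<in>H2.
        AE \<zeta> in circle. E (X \<inter> Y) f \<zeta> = E X (E Y f) \<zeta>) \<and>
     (\<forall>f\<in>H2. AE \<zeta> in circle. E UNIV f \<zeta> = f \<zeta>) \<and>
     (\<forall>X :: nat \<Rightarrow> real set. range X \<subseteq> sets borel \<longrightarrow> disjoint_family X \<longrightarrow>
        (\<forall>f\<in>H2. \<forall>g\<in>H2. (\<lambda>i. ip (E (X i) f) g) sums ip (E (\<Union>i. X i) f) g))"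

definition scalar_measure ::
  "(real set \<Rightarrow> (complex \<Rightarrow> complex) \<Rightarrow> (complex \<Rightarrow> complex)) \<Rightarrow> (complex \<Rightarrow> complex) \<Rightarrow> real measure"
  where
  "scalar_measure E f = measure_of UNIV (sets borel) (\<lambda>X. ennreal (Re (ip (E X f) f)))"

text \<open>Integration of a real function against the complex measure \<open>X \<mapsto> ip (E X f) g\<close>, which is
  expressed through positive measures by polarization.\<close>

definition spectral_integral ::
  "(real set \<Rightarrow> (complex \<Rightarrow> complex) \<Rightarrow> (complex \<Rightarrow> complex)) \<Rightarrow> (real \<Rightarrow> real) \<Rightarrow>
    (complex \<Rightarrow> complex) \<Rightarrow> (complex \<Rightarrow> complex) \<Rightarrow> complex" where
  "spectral_integral E \<phi> f g =
     1 / 4 * (\<Sum>k<4. \<i> ^ k * complex_of_real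
       (LINT t|scalar_measure E (\<lambda>\<zeta>. f \<zeta> + \<i> ^ k * g \<zeta>). \<phi> t))"

text \<open>\<open>E\<close> is the spectral measure of the operator with graph \<open>A\<close>, that is, \<open>A\<close> is the
  integral of \<open>t\<close> with respect to \<open>E\<close>.\<close>

definition spectral_measure_of ::
  "((complex \<Rightarrow> complex) \<times> (complex \<Rightarrow> complex)) set \<Rightarrow>
    (real set \<Rightarrow> (complex \<Rightarrow> complex) \<Rightarrow> (complex \<Rightarrow> complex)) \<Rightarrow> bool" where
  "spectral_measure_of A E \<longleftrightarrow>
     projection_valued_measure E \<and>
     Domain A = {f \<in> H2. integrable (scalar_measure E f) (\<lambda>t. t\<^sup>2)} \<and>
     (\<forall>(f, h)\<in>A. \<forall>g\<in>Domain A. ip h g = spectral_integral E (\<lambda>t. t) f g)"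


section \<open>The functions in the spectral density\<close>

definition xi :: "(complex \<Rightarrow> real) \<Rightarrow> complex \<Rightarrow> real \<Rightarrow> complex" where
  "xi \<omega> z l =
     exp (- (1 / 2) * (LINT \<zeta>|circle. complex_of_real (ln \<bar>\<omega> \<zeta> - l\<bar>) * Hker (z * cnj \<zeta>)))"

definition Gam :: "(complex \<Rightarrow> real) \<Rightarrow> real \<Rightarrow> complex set" where
  "Gam \<omega> l = {\<zeta> \<in> sphere 0 1. \<omega> \<zeta> < l}"

definition Afun :: "(complex \<Rightarrow> real) \<Rightarrow> complex \<Rightarrow> real \<Rightarrow> complex" where
  "Afun \<omega> z l = complex_of_real (pi / 2) * (LINT \<zeta>:Gam \<omega> l|circle. Hker (z * cnj \<zeta>))"

end

theory Submission
  imports Defs "HOL-Complex_Analysis.Complex_Analysis" "HOL-Probability.Probability_Measure"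
    "HOL-Real_Asymp.Real_Asymp"
begin

text \<open>For real \<open>l\<close> below the essential infimum \<open>\<gamma>\<close> of \<open>\<omega>\<close> the outer function \<open>F\<close> with
  \<open>\<bar>F\<bar>\<^sup>2 = \<omega> - l\<close> gives \<open>(T - l)\<^sup>-\<^sup>1 K\<^sub>u = (cnj (F u))\<^sup>-\<^sup>1 F\<^sup>-\<^sup>1 K\<^sub>u\<close>, and hence
  \<open>((T - l)\<^sup>-\<^sup>1 K\<^sub>u, K\<^sub>v) = (1 - cnj u v)\<^sup>-\<^sup>1 exp (- 1/2 \<integral> ln (\<omega> - l) (cnj (H (u cnj \<zeta>)) + H (v cnj \<zeta>)) dm)\<close>.
  By the spectral theorem the left-hand side is the Stieltjes transform of \<open>X \<mapsto> (E X K\<^sub>u, K\<^sub>v)\<close>.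
  Both sides extend analytically to the complement of the ray \<open>[\<gamma>, \<infinity>)\<close>, so they agree there.  At a point
  where the distribution function of a finite measure is differentiable (almost every point, by
  Lebesgue), Fatou's theorem recovers the derivative from the imaginary part of the Stieltjes
  transform at \<open>l + i 0\<close>; there \<open>ln (\<omega> - l)\<close> becomes \<open>ln \<bar>\<omega> - l\<bar>\<close>, with an additional \<open>- i \<pi>\<close> on
  \<open>\<Gamma>(l)\<close>.  Complex measures are avoided by working with the positive measures of \<open>K\<^sub>u + c K\<^sub>v\<close>
  for \<open>c\<^sup>4 = 1\<close> and polarizing.\<close>

section \<open>Differentiation of measures on the line\<close>

text \<open>The resolvent formula rests on two facts about F: \<open>toeplitz_form\<close> minus l
  times \<open>ip\<close> is (F f, F g), and the adjoint of multiplication by 1/F sends K_u to the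
  conjugate of (1/F)(u) times K_u. F need not be bounded and its boundary values are radial limits,
  so radial limits are proved for bounded analytic functions and transferred to F through 1/F. One
  kernel theorem, \<open>Fatou_kernel\<close>, serves both the Poisson kernel on the circle and the
  Cauchy kernel on the line. The spectral measure is characterised only by the domain of T and by (T
  f, g) as the integral of t, for f and g in that domain. The Stieltjes transform is extracted by
  testing with vectors E X K for bounded X: this turns (T - l) f = K into an identity of measures on
  X, which is divided by t - l before X exhausts [\<gamma>, \<infinity>). Polarizing the imaginary
  parts of the boundary value R yields (R(u, v) - cnj (R(v, u))) / (2 i), the jump across the real
  axis. Exchanging u and v and conjugating reverses the sign in the factor exp (i a), a = cnj A(u) +
  A(v), and the difference is the sine.\<close>

lemma set_lebesgue_integral_lessThan_diff:
  fixes f :: "real \<Rightarrow> real"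
  assumes f: "integrable lborel f" and "a \<le> b"
  shows "(LINT s:{..<b}|lborel. f s) - (LINT s:{..<a}|lborel. f s) = integral {a..b} f"
proof -
  have si: "set_integrable lborel A f" if "A \<in> sets lborel" for A
    using f that unfolding set_integrable_def by (intro integrable_mult_indicator)
  have "{..<b} = {..<a} \<union> {a..<b}" using \<open>a \<le> b\<close> by auto
  then have "(LINT s:{..<b}|lborel. f s) = (LINT s:{..<a}|lborel. f s) + (LINT s:{a..<b}|lborel. f s)"
    using si by (simp only:, intro set_integral_Un) auto
  moreover have "(LINT s:{a..<b}|lborel. f s) = (LINT s:{a..b}|lborel. f s)"
  proof (rule set_integral_cong_set)
    show "AE x in lborel. (x \<in> {a..b}) = (x \<in> {a..<b})"
      using AE_lborel_singleton[of b] by eventually_elim auto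
    show "set_borel_measurable lborel {a..<b} f" "set_borel_measurable lborel {a..b} f"
      using si[of "{a..<b}"] si[of "{a..b}"] unfolding set_borel_measurable_def set_integrable_def
      by (auto dest: borel_measurable_integrable)
  qed
  moreover have "(LINT s:{a..b}|lborel. f s) = integral {a..b} f"
    using si by (intro set_borel_integral_eq_integral(2)) auto
  ultimately show ?thesis by simp
qed

lemma negligible_AE_lborel: "negligible N \<Longrightarrow> AE x in lborel. x \<notin> N"
  by (metis AE_completion_iff AE_not_in negligible_iff_null_sets)

text \<open>\<open>integrable_ccontinuous_explicit\<close> averages over cubes with lower corner
  \<open>x\<close>, which on the line are the intervals [x, x + h]. It therefore controls the
  difference quotients from the right only.\<close>

lemma AE_right_derivative_indefinite_integral:
  fixes f :: "real \<Rightarrow> real"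
  assumes "integrable lborel f"
  shows "AE x in lborel. ((\<lambda>h. integral {x..x+h} f / h) \<longlongrightarrow> f x) (at_right 0)"
proof -
  have "f integrable_on cbox a b" for a b
    using integrable_on_lborel[OF assms] integrable_on_subcbox by blast
  then obtain N where N: "negligible N"
    and d: "\<And>x e. \<lbrakk>x \<notin> N; 0 < e\<rbrakk> \<Longrightarrow> \<exists>d>0. \<forall>h. 0 < h \<and> h < d \<longrightarrow>
                         norm(integral (cbox x (x + h *\<^sub>R One)) f /\<^sub>R h ^ DIM(real) - f x) < e"
    using integrable_ccontinuous_explicit[of f] by metis
  show ?thesis using negligible_AE_lborel[OF N]
  proof eventually_elim
    case (elim x)
    show ?case
    proof (rule tendstoI)
      fix e :: real assume "e > 0"
      from d[OF elim this] obtain d where "d > 0"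
        and "\<forall>h. 0 < h \<and> h < d \<longrightarrow> norm(integral (cbox x (x + h *\<^sub>R One)) f /\<^sub>R h ^ DIM(real) - f x) < e"
        by blast
      then show "\<forall>\<^sub>F h in at_right 0. dist (integral {x..x + h} f / h) (f x) < e"
        unfolding eventually_at_right_field
        by (intro exI[of _ d]) (auto simp: dist_norm field_simps)
    qed
  qed
qed

lemma AE_lborel_uminus:
  assumes "AE x in lborel. P (x::real)" shows "AE x in lborel. P (- x)"
proof -
  have "AE x in distr lborel borel uminus. P x"
    unfolding lborel_distr_uminus by (rule assms)
  from AE_distrD[OF _ this] show ?thesis by simp
qed

text \<open>The left difference quotient at x is a right difference quotient at - x for the
  reflected function, and reflection preserves Lebesgue null sets.\<close>

lemma AE_derivative_indefinite_integral:
  fixes f :: "real \<Rightarrow> real"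
  assumes f: "integrable lborel f"
  shows "AE x in lborel. ((\<lambda>t. LINT s:{..<t}|lborel. f s) has_real_derivative f x) (at x)"
proof -
  have f': "integrable lborel (\<lambda>x. f (- x))"
    using lborel_integrable_real_affine[OF f, of "-1" 0] by simp
  have refl: "integral {- x..- x + h} (\<lambda>x. f (- x)) = integral {x - h..x} f" for x h
    using Henstock_Kurzweil_Integration.integral_reflect_real[of x "x - h" f] by (simp add: add.commute)
  show ?thesis
    using AE_right_derivative_indefinite_integral[OF f]
      AE_lborel_uminus[OF AE_right_derivative_indefinite_integral[OF f']]
  proof eventually_elim
    case (elim x)
    define F where "F t = (LINT s:{..<t}|lborel. f s)" for t
    have r: "((\<lambda>h. (F (x + h) - F x) / h) \<longlongrightarrow> f x) (at_right 0)"
    proof (rule Lim_transform_eventually[OF elim(1)])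
      show "\<forall>\<^sub>F h in at_right 0. integral {x..x + h} f / h = (F (x + h) - F x) / h"
        using eventually_at_right_less[of 0]
        by eventually_elim (simp add: F_def set_lebesgue_integral_lessThan_diff[OF f])
    qed
    have l: "((\<lambda>h. (F (x + h) - F x) / h) \<longlongrightarrow> f x) (at_left 0)"
    proof -
      have "((\<lambda>h. (F (x + - h) - F x) / - h) \<longlongrightarrow> f x) (at_right 0)"
      proof (rule Lim_transform_eventually[OF elim(2)[simplified refl minus_minus]])
        show "\<forall>\<^sub>F h in at_right 0. integral {x - h..x} f / h = (F (x + - h) - F x) / - h"
          using eventually_at_right_less[of 0]
        proof eventually_elim
          case (elim h)
          then have "F x - F (x - h) = integral {x - h..x} f"
            unfolding F_def using set_lebesgue_integral_lessThan_diff[OF f, of "x - h" x] by simp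
          then show ?case using elim by (simp add: field_simps)
        qed
      qed
      then show ?thesis
        by (subst filterlim_at_left_to_right) simp
    qed
    show ?case
      using filterlim_split_at[OF l r] unfolding DERIV_def F_def by simp
  qed
qed

text \<open>A Vitali covering argument. The points off \<open>N\<close> at which the upper density
  of \<open>\<nu>\<close> exceeds a fixed \<open>q\<close> are covered, up to a null set, by
  disjoint balls that avoid a compact part of \<open>N\<close> carrying almost all of
  \<open>\<nu>\<close>. The length of each ball is at most \<open>2 / q\<close> times its
  \<open>\<nu>\<close>-mass, and the mass available to these balls is arbitrarily small.\<close>

lemma AE_derivative_singular_measure:
  assumes fm: "finite_measure \<nu>" and sets: "sets \<nu> = sets (borel :: real measure)"
    and N: "N \<in> null_sets lborel" and sing: "emeasure \<nu> (- N) = 0"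
  shows "AE x in lborel. ((\<lambda>t. measure \<nu> {..<t}) has_real_derivative 0) (at x)"
proof -
  interpret finite_measure \<nu> by fact
  have [measurable_cong]: "sets \<nu> = sets borel" by (rule sets)
  have sp: "space \<nu> = UNIV" using sets_eq_imp_space_eq[OF sets] by simp
  have Nb: "N \<in> sets borel" using N by auto
  \<comment> \<open>A point outside \<open>N\<close> and outside all \<open>S (1 / Suc n)\<close>
    has symmetric density zero, so it suffices that each \<open>S q\<close> is negligible.\<close>
  define S where "S q = {x. x \<notin> N \<and> \<not> (\<exists>\<delta>>0. \<forall>h. 0 < h \<and> h < \<delta> \<longrightarrow> measure \<nu> (cball x h) \<le> q * h)}"
    for q :: real
  have neg: "negligible (S q)" if q: "q > 0" for q
    unfolding negligible_outer_le
  proof (intro allI impI)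
    fix e :: real assume e: "e > 0"
    \<comment> \<open>Inner regularity. As \<open>K\<close> is closed, a point off \<open>N\<close>
      has small balls disjoint from it. The constant is chosen so that
      \<open>2 / q * (q * e / 2) = e\<close> at the end of the estimate.\<close>
    have "\<exists>K. compact K \<and> K \<subseteq> N \<and> measure \<nu> (- K) \<le> q * e / 2"
    proof -
      have eq: "emeasure \<nu> N = (SUP K \<in> {K. K \<subseteq> N \<and> compact K}. emeasure \<nu> K)"
        by (rule inner_regular) (use sets Nb emeasure_finite in auto)
      have UNIV: "emeasure \<nu> UNIV = emeasure \<nu> N"
      proof -
        have "emeasure \<nu> UNIV = emeasure \<nu> (N \<union> - N)" by simp
        also have "\<dots> = emeasure \<nu> N + emeasure \<nu> (- N)"
          using Nb by (intro plus_emeasure[symmetric]) (auto simp: sets)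
        finally show ?thesis using sing by simp
      qed
      show ?thesis
      proof (cases "emeasure \<nu> N = 0")
        case True
        then have "measure \<nu> (- {}) \<le> q * e / 2"
          using UNIV q e by (simp add: measure_def)
        then show ?thesis by (intro exI[of _ "{}"]) auto
      next
        case False
        let ?c = "q * e / 2"
        have c: "?c > 0" using q e by simp
        have "emeasure \<nu> N - ennreal ?c < emeasure \<nu> N"
          using False c by (intro ennreal_between) (auto simp: less_top[symmetric] zero_less_iff_neq_zero)
        then obtain K where K: "K \<subseteq> N" "compact K" "emeasure \<nu> N - ennreal ?c < emeasure \<nu> K"
          by (subst (asm) (2) eq) (auto simp: less_SUP_iff)
        have Kb: "K \<in> sets \<nu>" using K(2) sets by (simp add: borel_compact)
        have "ennreal (measure \<nu> N - ?c) < ennreal (measure \<nu> K)"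
          using K(3) c by (simp add: emeasure_eq_measure ennreal_minus)
        then have "measure \<nu> N - ?c < measure \<nu> K"
          by (metis ennreal_leI not_le)
        then have "measure \<nu> UNIV \<le> measure \<nu> K + ?c"
          using UNIV by (simp add: measure_def)
        moreover have "measure \<nu> (- K) = measure \<nu> UNIV - measure \<nu> K"
          using finite_measure_compl[OF Kb] sp by (simp add: Compl_eq_Diff_UNIV)
        ultimately show ?thesis using K by (intro exI[of _ K]) auto
      qed
    qed
    then obtain K where K: "compact K" "K \<subseteq> N" "measure \<nu> (- K) \<le> q * e / 2" by blast
    define I where "I = {p :: real \<times> real. 0 < snd p \<and> cball (fst p) (snd p) \<inter> K = {} \<and>
      measure \<nu> (cball (fst p) (snd p)) > q * snd p}"
    have Vit: "\<exists>i. i \<in> I \<and> x \<in> cball (fst i) (snd i) \<and> snd i < d" if x: "x \<in> S q" and d: "0 < d" for x d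
    proof -
      have "x \<in> - K" using x K unfolding S_def by auto
      moreover have "open (- K)" using K compact_imp_closed by auto
      ultimately obtain r where r: "r > 0" "cball x r \<subseteq> - K"
        using open_contains_cball by blast
      obtain h where "0 < h" "h < min r d" "measure \<nu> (cball x h) > q * h"
        using x r d unfolding S_def by (auto simp: not_le) (metis min_less_iff_conj)
      then show ?thesis using r
        by (intro exI[of _ "(x, h)"]) (force simp: I_def)
    qed
    have Ipos: "0 < snd i" if "i \<in> I" for i using that unfolding I_def by simp
    obtain C where C: "countable C" "C \<subseteq> I"
       "pairwise (\<lambda>i j. disjnt (cball (fst i) (snd i)) (cball (fst j) (snd j))) C"
       "negligible (S q - (\<Union>i \<in> C. cball (fst i) (snd i)))"
      by (rule Vitali_covering_theorem_cballs[of I snd "S q" fst, OF Ipos Vit])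
    define U where "U = (\<Union>i \<in> C. cball (fst i) (snd i))"
    have Ub: "U \<in> sets borel" unfolding U_def using C(1) by (intro sets.countable_UN') auto
    have disj: "disjoint_family_on (\<lambda>i. cball (fst i) (snd i)) C"
      using C(3) by (auto simp: disjoint_family_on_def pairwise_def disjnt_def)
    have "emeasure lborel U = (\<integral>\<^sup>+i. emeasure lborel (cball (fst i) (snd i)) \<partial>count_space C)"
      unfolding U_def using C(1) disj by (intro emeasure_UN_countable) auto
    also have "\<dots> \<le> (\<integral>\<^sup>+i. ennreal (2 / q) * emeasure \<nu> (cball (fst i) (snd i)) \<partial>count_space C)"
    proof (rule nn_integral_mono)
      fix i assume "i \<in> space (count_space C)"
      then have i: "i \<in> I" using C by auto
      then have "emeasure lborel (cball (fst i) (snd i)) = ennreal (2 * snd i)"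
        by (simp add: I_def cball_eq_atLeastAtMost)
      also have "\<dots> \<le> ennreal (2 / q * measure \<nu> (cball (fst i) (snd i)))"
        using i q by (intro ennreal_leI) (auto simp: I_def field_simps)
      finally show "emeasure lborel (cball (fst i) (snd i)) \<le> ennreal (2 / q) * emeasure \<nu> (cball (fst i) (snd i))"
        using q by (simp add: emeasure_eq_measure ennreal_mult[symmetric])
    qed
    also have "\<dots> = ennreal (2 / q) * (\<integral>\<^sup>+i. emeasure \<nu> (cball (fst i) (snd i)) \<partial>count_space C)"
      by (rule nn_integral_cmult) auto
    also have "(\<integral>\<^sup>+i. emeasure \<nu> (cball (fst i) (snd i)) \<partial>count_space C) = emeasure \<nu> U"
      unfolding U_def using C(1) disj sets by (intro emeasure_UN_countable[symmetric]) auto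
    also have "emeasure \<nu> U \<le> emeasure \<nu> (- K)"
      using C(2) borel_comp[OF borel_compact[OF K(1)]]
      by (intro emeasure_mono) (auto simp: U_def I_def sets)
    also have "\<dots> \<le> ennreal (q * e / 2)"
      using K(3) by (simp add: emeasure_eq_measure ennreal_leI)
    finally have "emeasure lborel U \<le> ennreal (2 / q) * ennreal (q * e / 2)"
      by (simp add: mult_left_mono)
    also have "\<dots> = ennreal e" using q e by (subst ennreal_mult[symmetric]) auto
    finally have Ue: "emeasure lborel U \<le> ennreal e" .
    then have Um: "U \<in> lmeasurable"
      using Ub by (intro fmeasurableI) (auto simp: order.strict_trans1)
    let ?T = "U \<union> (S q - U)"
    have nS: "negligible (S q - U)" using C(4) unfolding U_def .
    have "measure lebesgue ?T \<le> measure lebesgue U"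
      using measure_Un_le[of U lebesgue "S q - U"] fmeasurableD[OF Um]
        fmeasurableD[OF negligible_imp_measurable[OF nS]] negligible_imp_measure0[OF nS] by linarith
    moreover have "measure lebesgue U \<le> e"
      using Ue e Ub by (simp add: measure_def enn2real_leI)
    moreover have "?T \<in> lmeasurable"
      using fmeasurable.Un[OF Um negligible_imp_measurable[OF nS]] .
    ultimately show "\<exists>T. S q \<subseteq> T \<and> T \<in> lmeasurable \<and> measure lebesgue T \<le> e"
      by (intro exI[of _ ?T]) auto
  qed
  have "AE x in lborel. x \<notin> N" using N by (rule AE_not_in)
  moreover have "AE x in lborel. \<forall>n. x \<notin> S (1 / real (Suc n))"
    unfolding AE_all_countable
  proof
    show "AE x in lborel. x \<notin> S (1 / real (Suc n))" for n
      by (intro negligible_AE_lborel neg) simp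
  qed
  ultimately show ?thesis
  proof eventually_elim
    case (elim x)
    show ?case unfolding has_field_derivative_iff
    proof (rule tendsto_norm_zero_cancel)
      show "((\<lambda>y. norm ((measure \<nu> {..<y} - measure \<nu> {..<x}) / (y - x))) \<longlongrightarrow> 0) (at x)"
      proof (rule tendstoI)
        fix e :: real assume e: "e > 0"
        then obtain n where n: "1 / real (Suc n) < e" using nat_approx_posE by blast
        from elim obtain \<delta> where \<delta>: "\<delta> > 0"
            "\<And>h. 0 < h \<and> h < \<delta> \<Longrightarrow> measure \<nu> (cball x h) \<le> 1 / real (Suc n) * h"
          unfolding S_def by blast
        show "\<forall>\<^sub>F y in at x. dist (norm ((measure \<nu> {..<y} - measure \<nu> {..<x}) / (y - x))) 0 < e"
          unfolding eventually_at
        proof (intro exI[of _ \<delta>] conjI ballI impI)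
          fix y assume y: "y \<noteq> x \<and> dist y x < \<delta>"
          let ?h = "\<bar>y - x\<bar>"
          have *: "measure \<nu> {..<b} - measure \<nu> {..<a} = measure \<nu> {a..<b}" if "a \<le> b" for a b :: real
          proof -
            have "{..<b} - {..<a} = {a..<b}" using that by auto
            then show ?thesis
              using finite_measure_Diff[of "{..<b}" "{..<a}"] that sets by simp
          qed
          have "\<bar>measure \<nu> {..<y} - measure \<nu> {..<x}\<bar> = measure \<nu> {min x y..<max x y}"
          proof (cases "x \<le> y")
            case True
            then show ?thesis using *[of x y] by (simp add: min_def max_def)
          next
            case False
            then show ?thesis using *[of y x] by (simp add: min_def max_def abs_minus_commute)
          qed
          also have "\<dots> \<le> measure \<nu> (cball x ?h)"
            by (intro finite_measure_mono) (auto simp: sets cball_eq_atLeastAtMost)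
          also have "\<dots> \<le> 1 / real (Suc n) * ?h"
            using \<delta>(2)[of ?h] y by (auto simp: dist_real_def)
          finally have "\<bar>measure \<nu> {..<y} - measure \<nu> {..<x}\<bar> / ?h \<le> 1 / real (Suc n)"
            using y by (simp add: field_simps)
          then show "dist (norm ((measure \<nu> {..<y} - measure \<nu> {..<x}) / (y - x))) 0 < e"
            using n by (simp add: dist_real_def)
        qed (rule \<delta>)
      qed
    qed
  qed
qed

text \<open>The singular part is carried by a Lebesgue null set of maximal \<open>\<mu>\<close>-measure.\<close>

lemma Lebesgue_decomposition:
  fixes \<mu> :: "real measure"
  assumes fm: "finite_measure \<mu>" and sets: "sets \<mu> = sets borel"
  obtains f :: "real \<Rightarrow> real" and N where "integrable lborel f" "\<And>x. 0 \<le> f x" "N \<in> null_sets lborel"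
    "\<And>X. X \<in> sets borel \<Longrightarrow> measure \<mu> X = (LINT x:X|lborel. f x) + measure \<mu> (X \<inter> N)"
proof -
  interpret finite_measure \<mu> by fact
  have [measurable_cong]: "sets \<mu> = sets borel" by (rule sets)
  have sp: "space \<mu> = UNIV" using sets_eq_imp_space_eq[OF sets] by simp
  define s where "s = Sup (measure \<mu> ` null_sets lborel)"
  have bdd: "bdd_above (measure \<mu> ` null_sets lborel)"
    by (rule bdd_aboveI[of _ "measure \<mu> UNIV"]) (auto intro!: finite_measure_mono simp: sets)
  have "\<exists>N\<in>null_sets lborel. s - 1 / real (Suc n) < measure \<mu> N" for n
  proof -
    have "s - 1 / real (Suc n) < Sup (measure \<mu> ` null_sets lborel)" unfolding s_def by simp
    then show ?thesis using less_cSupD[of "measure \<mu> ` null_sets lborel"] null_sets.empty_sets by blast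
  qed
  then obtain Nn where Nn: "\<And>n. Nn n \<in> null_sets lborel" "\<And>n. s - 1 / real (Suc n) < measure \<mu> (Nn n)"
    by metis
  define N where "N = (\<Union>n. Nn n)"
  have N: "N \<in> null_sets lborel" unfolding N_def using Nn by blast
  then have Nb: "N \<in> sets borel" by auto
  have sN: "s \<le> measure \<mu> N"
  proof (rule field_le_epsilon)
    fix e :: real assume "e > 0"
    then obtain n where n: "1 / real (Suc n) < e" using nat_approx_posE by blast
    have "measure \<mu> (Nn n) \<le> measure \<mu> N"
      using Nb by (intro finite_measure_mono) (auto simp: N_def sets)
    then show "s \<le> measure \<mu> N + e" using Nn(2)[of n] n by linarith
  qed
  \<comment> \<open>A null set charged by \<open>\<mu>\<close> outside \<open>N\<close> could be
    added to \<open>N\<close> and would push the measure above the supremum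
    \<open>s\<close>.\<close>
  have ac: "measure \<mu> (X - N) = 0" if X: "X \<in> null_sets lborel" for X
  proof -
    have "measure \<mu> (N \<union> (X - N)) = measure \<mu> N + measure \<mu> (X - N)"
      using X Nb by (intro finite_measure_Union) (auto simp: sets)
    moreover have "measure \<mu> (N \<union> (X - N)) \<le> s"
      unfolding s_def using X N bdd by (intro cSup_upper imageI null_sets.Un null_set_Diff) auto
    ultimately show ?thesis using sN measure_nonneg[of \<mu> "X - N"] by linarith
  qed
  define \<rho> where "\<rho> = density \<mu> (indicator (- N))"
  have e\<rho>: "emeasure \<rho> X = emeasure \<mu> (X - N)" if "X \<in> sets borel" for X :: "real set"
  proof -
    have "emeasure \<rho> X = (\<integral>\<^sup>+x. indicator (- N) x * indicator X x \<partial>\<mu>)"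
      unfolding \<rho>_def using that Nb by (intro emeasure_density) (auto simp: sets)
    also have "\<dots> = (\<integral>\<^sup>+x. indicator (X - N) x \<partial>\<mu>)"
      by (intro nn_integral_cong) (auto split: split_indicator)
    finally show ?thesis using that Nb by (simp add: sets)
  qed
  have "absolutely_continuous lborel \<rho>"
    unfolding absolutely_continuous_def
  proof
    fix X :: "real set" assume X: "X \<in> null_sets lborel"
    then have "emeasure \<rho> X = 0" using ac[OF X] e\<rho>[of X] by (auto simp: emeasure_eq_measure)
    then show "X \<in> null_sets \<rho>" using X by (auto simp: null_sets_def \<rho>_def sets)
  qed
  then obtain g where g: "g \<in> borel_measurable lborel" "density lborel g = \<rho>"
    using sigma_finite_measure.Radon_Nikodym[OF lborel.sigma_finite_measure_axioms, of \<rho>] by (auto simp: \<rho>_def sets)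
  have gX: "(\<integral>\<^sup>+x. g x * indicator X x \<partial>lborel) = emeasure \<mu> (X - N)" if "X \<in> sets borel" for X :: "real set"
    using e\<rho>[OF that] emeasure_density[of g lborel X] g that by simp
  have "(\<integral>\<^sup>+x. g x \<partial>lborel) \<noteq> \<infinity>" using gX[of UNIV] emeasure_finite by simp
  then have gfin: "AE x in lborel. g x \<noteq> \<infinity>" using g(1) by (intro nn_integral_PInf_AE) auto
  define f where "f x = enn2real (g x)" for x
  have fm: "f \<in> borel_measurable lborel" unfolding f_def using g(1) by simp
  have f0: "0 \<le> f x" for x unfolding f_def by simp
  have fX: "(\<integral>\<^sup>+x. ennreal (indicator X x * f x) \<partial>lborel) = emeasure \<mu> (X - N)" if "X \<in> sets borel" for X :: "real set"
  proof -
    have "(\<integral>\<^sup>+x. ennreal (indicator X x * f x) \<partial>lborel) = (\<integral>\<^sup>+x. g x * indicator X x \<partial>lborel)"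
      using gfin by (intro nn_integral_cong_AE, eventually_elim)
        (auto simp: f_def less_top split: split_indicator)
    then show ?thesis using gX[OF that] by simp
  qed
  show ?thesis
  proof (rule that[of f N])
    show "integrable lborel f"
      using fm fX[of UNIV] emeasure_finite[of "- N"]
      by (intro integrableI_bounded) (auto simp: f_def Compl_eq_Diff_UNIV[symmetric] less_top[symmetric])
    show "measure \<mu> X = (LINT x:X|lborel. f x) + measure \<mu> (X \<inter> N)" if X: "X \<in> sets borel" for X :: "real set"
    proof -
      have "(LINT x:X|lborel. f x) = enn2real (\<integral>\<^sup>+x. ennreal (indicator X x * f x) \<partial>lborel)"
        unfolding set_lebesgue_integral_def real_scaleR_def using X fm f0
        by (intro integral_eq_nn_integral borel_measurable_times borel_measurable_indicator) auto
      also have "\<dots> = measure \<mu> (X - N)" using fX[OF X] by (simp add: measure_def)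
      finally have 1: "(LINT x:X|lborel. f x) = measure \<mu> (X - N)" .
      have "measure \<mu> ((X - N) \<union> (X \<inter> N)) = measure \<mu> (X - N) + measure \<mu> (X \<inter> N)"
        using X Nb by (intro finite_measure_Union) (auto simp: sets)
      moreover have "(X - N) \<union> (X \<inter> N) = X" by auto
      ultimately show ?thesis using 1 by simp
    qed
  qed (use N in \<open>auto simp: f_def\<close>)
qed

lemma AE_derivative_finite_measure:
  fixes \<mu> :: "real measure"
  assumes fm: "finite_measure \<mu>" and sets: "sets \<mu> = sets borel"
  shows "AE x in lborel. \<exists>d. ((\<lambda>t. measure \<mu> {..<t}) has_real_derivative d) (at x)"
proof -
  interpret finite_measure \<mu> by fact
  have [measurable_cong]: "sets \<mu> = sets borel" by (rule sets)
  obtain f N where f: "integrable lborel f" and N: "N \<in> null_sets lborel"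
    and fN: "\<And>X. X \<in> sets borel \<Longrightarrow> measure \<mu> X = (LINT x:X|lborel. f x) + measure \<mu> (X \<inter> N)"
    using Lebesgue_decomposition[OF fm sets] by metis
  have Nb: "N \<in> sets borel" using N by auto
  define \<nu> where "\<nu> = density \<mu> (indicator N)"
  have e\<nu>: "emeasure \<nu> X = emeasure \<mu> (X \<inter> N)" if "X \<in> sets borel" for X :: "real set"
  proof -
    have "emeasure \<nu> X = (\<integral>\<^sup>+x. indicator N x * indicator X x \<partial>\<mu>)"
      unfolding \<nu>_def using that Nb by (intro emeasure_density) (auto simp: sets)
    also have "\<dots> = (\<integral>\<^sup>+x. indicator (X \<inter> N) x \<partial>\<mu>)"
      by (intro nn_integral_cong) (auto split: split_indicator)
    finally show ?thesis using that Nb by (simp add: sets)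
  qed
  have s\<nu>: "sets \<nu> = sets borel" by (simp add: \<nu>_def sets)
  have "finite_measure \<nu>"
    using e\<nu>[of UNIV] emeasure_finite sets_eq_imp_space_eq[OF s\<nu>] by (intro finite_measureI) auto
  then have "AE x in lborel. ((\<lambda>t. measure \<nu> {..<t}) has_real_derivative 0) (at x)"
    using AE_derivative_singular_measure[OF _ s\<nu> N] e\<nu>[of "- N"] Nb by auto
  with AE_derivative_indefinite_integral[OF f] show ?thesis
  proof eventually_elim
    case (elim x)
    have "(\<lambda>t. measure \<mu> {..<t}) = (\<lambda>t. (LINT s:{..<t}|lborel. f s) + measure \<nu> {..<t})"
      using fN e\<nu> by (auto simp: measure_def)
    then show ?case using DERIV_add[OF elim] by auto
  qed
qed


section \<open>Fatou's theorem for unimodal kernels\<close>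

text \<open>Evenness and monotonicity make the set closed under passing to smaller \<bar>s\<bar>, so
  it is an interval centred at 0. It is open by continuity, hence its supremum is not attained.
  Monotonicity is assumed only on [0, b), which is why the set is cut off at \<delta>.\<close>

lemma superlevel_set_unimodal:
  fixes k :: "real \<Rightarrow> real"
  assumes cont: "continuous_on UNIV k" and even: "\<And>s. k (- s) = k s"
    and dec: "\<And>s t. 0 \<le> s \<Longrightarrow> s \<le> t \<Longrightarrow> t < b \<Longrightarrow> k t \<le> k s" and \<delta>: "0 < \<delta>" "\<delta> \<le> b"
  obtains \<rho> where "0 \<le> \<rho>" "\<rho> \<le> \<delta>" "{s. \<bar>s\<bar> < \<delta> \<and> y < k s} = {-\<rho><..<\<rho>}"
proof -
  let ?A = "{s. \<bar>s\<bar> < \<delta> \<and> y < k s}"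
  have op: "open ?A"
    by (intro open_Collect_conj open_Collect_less continuous_intros cont)
  show ?thesis
  proof (cases "?A = {}")
    case True
    then show ?thesis using \<delta> by (intro that[of 0]) auto
  next
    case False
    have ev: "k \<bar>s\<bar> = k s" for s using even[of s] by (simp add: abs_if)
    have down: "s \<in> ?A" if "a \<in> ?A" "\<bar>s\<bar> \<le> \<bar>a\<bar>" for s a
      using dec[of "\<bar>s\<bar>" "\<bar>a\<bar>"] that \<delta> ev[of s] ev[of a] by auto
    have bdd: "bdd_above ?A" by (rule bdd_aboveI[of _ \<delta>]) auto
    define \<rho> where "\<rho> = Sup ?A"
    have "\<rho> \<le> \<delta>" unfolding \<rho>_def using False by (intro cSup_least) auto
    moreover obtain a where a: "a \<in> ?A" using False by blast
    then have "\<bar>a\<bar> \<in> ?A" using down[of a "\<bar>a\<bar>"] by auto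
    then have "\<bar>a\<bar> \<le> \<rho>" unfolding \<rho>_def by (rule cSup_upper[OF _ bdd])
    then have "0 \<le> \<rho>" by linarith
    moreover have "?A = {-\<rho><..<\<rho>}"
    proof (rule set_eqI)
      fix s
      show "s \<in> ?A \<longleftrightarrow> s \<in> {-\<rho><..<\<rho>}"
      proof
        assume "s \<in> ?A"
        then have "\<bar>s\<bar> \<in> ?A" using down[of s "\<bar>s\<bar>"] by auto
        then obtain e where e: "e > 0" "ball \<bar>s\<bar> e \<subseteq> ?A" using op by (meson open_contains_ball)
        have "\<bar>s\<bar> + e / 2 \<in> ball \<bar>s\<bar> e" using e(1) by (simp add: dist_real_def)
        then have "\<bar>s\<bar> + e / 2 \<in> ?A" using e(2) by blast
        then have "\<bar>s\<bar> + e / 2 \<le> \<rho>" unfolding \<rho>_def by (rule cSup_upper[OF _ bdd])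
        then show "s \<in> {-\<rho><..<\<rho>}" using e by auto
      next
        assume "s \<in> {-\<rho><..<\<rho>}"
        then have "\<bar>s\<bar> < Sup ?A" unfolding \<rho>_def by auto
        then obtain a where "a \<in> ?A" "\<bar>s\<bar> < a" using less_cSupD[OF False] by blast
        then show "s \<in> ?A" using down[of a s] by auto
      qed
    qed
    ultimately show ?thesis by (intro that[of \<rho>])
  qed
qed

text \<open>Tonelli's theorem for the region under the graph of \<open>f\<close> over
  \<open>A\<close>, with \<open>f x\<close> read as the length of \<open>{0..<f x}\<close>. No
  structure on the measure beyond sigma-finiteness enters, so the formula applies to Lebesgue
  measure and to an arbitrary finite measure alike.\<close>

lemma nn_integral_layer_cake:
  fixes f :: "'a \<Rightarrow> real"
  assumes "sigma_finite_measure M" and f[measurable]: "f \<in> borel_measurable M" and nn: "\<And>x. 0 \<le> f x"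
    and A[measurable]: "A \<in> sets M"
  shows "(\<integral>\<^sup>+x. ennreal (f x) * indicator A x \<partial>M) =
    (\<integral>\<^sup>+y. indicator {0..} y * emeasure M {x\<in>space M. x \<in> A \<and> y < f x} \<partial>lborel)"
proof -
  interpret sigma_finite_measure M by fact
  interpret pair_sigma_finite M lborel ..
  have "(\<integral>\<^sup>+x. ennreal (f x) * indicator A x \<partial>M) =
    (\<integral>\<^sup>+x. (\<integral>\<^sup>+y. indicator {z. fst z \<in> A \<and> 0 \<le> snd z \<and> snd z < f (fst z)} (x, y) \<partial>lborel) \<partial>M)"
  proof (rule nn_integral_cong)
    fix x
    have "(\<integral>\<^sup>+y. indicator {z. fst z \<in> A \<and> 0 \<le> snd z \<and> snd z < f (fst z)} (x, y) \<partial>lborel)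
      = (\<integral>\<^sup>+y. indicator A x * indicator {0..<f x} y \<partial>lborel)"
      by (intro nn_integral_cong) (auto split: split_indicator)
    also have "\<dots> = ennreal (f x) * indicator A x"
      using nn[of x] by (subst nn_integral_cmult) (auto simp: mult.commute)
    finally show "ennreal (f x) * indicator A x =
      (\<integral>\<^sup>+y. indicator {z. fst z \<in> A \<and> 0 \<le> snd z \<and> snd z < f (fst z)} (x, y) \<partial>lborel)" by simp
  qed
  also have "\<dots> = (\<integral>\<^sup>+x. (\<integral>\<^sup>+y. indicator {z\<in>space (M \<Otimes>\<^sub>M lborel). fst z \<in> A \<and> 0 \<le> snd z \<and> snd z < f (fst z)} (x, y) \<partial>lborel) \<partial>M)"
    by (intro nn_integral_cong) (auto simp: space_pair_measure split: split_indicator)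
  also have "\<dots> = (\<integral>\<^sup>+y. (\<integral>\<^sup>+x. indicator {z\<in>space (M \<Otimes>\<^sub>M lborel). fst z \<in> A \<and> 0 \<le> snd z \<and> snd z < f (fst z)} (x, y) \<partial>M) \<partial>lborel)"
    by (subst Fubini) (auto intro!: borel_measurable_indicator)
  also have "\<dots> = (\<integral>\<^sup>+y. indicator {0..} y * emeasure M {x\<in>space M. x \<in> A \<and> y < f x} \<partial>lborel)"
  proof (rule nn_integral_cong)
    fix y :: real
    have "(\<integral>\<^sup>+x. indicator {z\<in>space (M \<Otimes>\<^sub>M lborel). fst z \<in> A \<and> 0 \<le> snd z \<and> snd z < f (fst z)} (x, y) \<partial>M)
      = (\<integral>\<^sup>+x. indicator {0..} y * indicator {x\<in>space M. x \<in> A \<and> y < f x} x \<partial>M)"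
      by (intro nn_integral_cong) (auto simp: space_pair_measure split: split_indicator)
    also have "\<dots> = indicator {0..} y * emeasure M {x\<in>space M. x \<in> A \<and> y < f x}"
      by (subst nn_integral_cmult) auto
    finally show "(\<integral>\<^sup>+x. indicator {z\<in>space (M \<Otimes>\<^sub>M lborel). fst z \<in> A \<and> 0 \<le> snd z \<and> snd z < f (fst z)} (x, y) \<partial>M)
      = indicator {0..} y * emeasure M {x\<in>space M. x \<in> A \<and> y < f x}" .
  qed
  finally show ?thesis .
qed

text \<open>By the layer-cake formula the integral of the kernel is compared with its mass on superlevel sets
  only, and these are intervals centred at \<open>\<theta>\<close>.\<close>

lemma Fatou_kernel:
  fixes \<nu> :: "real measure" and k :: "'i \<Rightarrow> real \<Rightarrow> real"
  assumes fm: "finite_measure \<nu>" and sets: "sets \<nu> = sets borel"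
    and der: "((\<lambda>t. measure \<nu> {..<t}) has_real_derivative d) (at \<theta>)"
    and b: "b > 0"
    and ker: "\<forall>\<^sub>F i in F. continuous_on UNIV (k i) \<and> (\<forall>s. 0 \<le> k i s \<and> k i (- s) = k i s) \<and>
      (\<forall>s t. 0 \<le> s \<and> s \<le> t \<and> t < b \<longrightarrow> k i t \<le> k i s)"
    and mass: "\<And>\<delta>. 0 < \<delta> \<Longrightarrow> \<delta> < b \<Longrightarrow> ((\<lambda>i. LINT s:{-\<delta><..<\<delta>}|lborel. k i s) \<longlongrightarrow> 1) F"
    and tail: "\<And>\<delta> e. 0 < \<delta> \<Longrightarrow> \<delta> < b \<Longrightarrow> 0 < e \<Longrightarrow>
      \<forall>\<^sub>F i in F. AE t in \<nu>. \<delta> \<le> \<bar>t - \<theta>\<bar> \<longrightarrow> k i (t - \<theta>) \<le> e"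
  shows "((\<lambda>i. LINT t|\<nu>. k i (t - \<theta>)) \<longlongrightarrow> d) F"
proof -
  interpret finite_measure \<nu> by fact
  have [measurable_cong]: "sets \<nu> = sets borel" by (rule sets)
  have sp: "space \<nu> = UNIV" using sets_eq_imp_space_eq[OF sets] by simp
  define M where "M = measure \<nu> UNIV"
  define D where "D t = measure \<nu> {..<t}" for t
  have D_diff: "measure \<nu> {x..<y} = D y - D x" if "x \<le> y" for x y
  proof -
    have "{..<y} - {..<x} = {x..<y}" using that by auto
    then show ?thesis
      using finite_measure_Diff[of "{..<y}" "{..<x}"] that sets by (simp add: D_def)
  qed
  \<comment> \<open>Differentiability of the distribution function at \<theta> compares the mass of
    short intervals centred at \<theta> with \<open>d\<close> times their length; nothing else about
    the measure near \<theta> is used.\<close>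
  have symm: "\<exists>\<delta>0>0. \<forall>\<rho>. 0 < \<rho> \<and> \<rho> < \<delta>0 \<longrightarrow>
      (d - \<eta>) * (2 * \<rho>) \<le> measure \<nu> {\<theta>-\<rho><..<\<theta>+\<rho>} \<and> measure \<nu> {\<theta>-\<rho><..<\<theta>+\<rho>} \<le> (d + \<eta>) * (2 * \<rho>)"
    if \<eta>: "\<eta> > 0" for \<eta>
  proof -
    from der[unfolded has_field_derivative_def has_derivative_at_alt] \<eta>
    obtain \<delta>0 where \<delta>0: "\<delta>0 > 0"
      "\<And>y. \<bar>y - \<theta>\<bar> < \<delta>0 \<Longrightarrow> \<bar>D y - D \<theta> - d * (y - \<theta>)\<bar> \<le> \<eta> * \<bar>y - \<theta>\<bar>"
      unfolding D_def real_norm_def by blast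
    show ?thesis
    proof (intro exI[of _ \<delta>0] conjI allI impI)
      fix \<rho> assume \<rho>: "0 < \<rho> \<and> \<rho> < \<delta>0"
      have up: "D (\<theta> + \<rho>) \<le> D \<theta> + (d + \<eta>) * \<rho>" "D (\<theta> + \<rho>) \<ge> D \<theta> + (d - \<eta>) * \<rho>"
        using \<delta>0(2)[of "\<theta> + \<rho>"] \<rho> by (auto simp: algebra_simps)
      have lo: "D (\<theta> - r) \<ge> D \<theta> - (d + \<eta>) * r" "D (\<theta> - r) \<le> D \<theta> - (d - \<eta>) * r" if "0 < r" "r \<le> \<rho>" for r
        using \<delta>0(2)[of "\<theta> - r"] \<rho> that by (auto simp: algebra_simps)
      have "measure \<nu> {\<theta>-\<rho><..<\<theta>+\<rho>} \<le> measure \<nu> {\<theta>-\<rho>..<\<theta>+\<rho>}"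
        by (intro finite_measure_mono) (auto simp: sets)
      also have "\<dots> \<le> (d + \<eta>) * (2 * \<rho>)"
        using D_diff[of "\<theta> - \<rho>" "\<theta> + \<rho>"] up(1) lo(1)[of \<rho>] \<rho> by (simp add: algebra_simps)
      finally show "measure \<nu> {\<theta>-\<rho><..<\<theta>+\<rho>} \<le> (d + \<eta>) * (2 * \<rho>)" .
      \<comment> \<open>\<open>D\<close> gives the mass of half-open intervals. For the lower bound
        on the open interval the left end is approached from inside, through
        \<open>{\<theta>-r..<\<theta>+\<rho>}\<close> with r increasing to \<rho>, so that a
        possible atom at \<theta> - \<rho> does no harm.\<close>
      have "((\<lambda>r. (d - \<eta>) * (\<rho> + r)) \<longlongrightarrow> (d - \<eta>) * (\<rho> + \<rho>)) (at_left \<rho>)"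
        by (intro tendsto_intros)
      moreover have "\<forall>\<^sub>F r in at_left \<rho>. (d - \<eta>) * (\<rho> + r) \<le> measure \<nu> {\<theta>-\<rho><..<\<theta>+\<rho>}"
        unfolding eventually_at_left_field
      proof (intro exI[of _ 0] conjI allI impI)
        fix r assume r: "0 < r" "r < \<rho>"
        have "(d - \<eta>) * (\<rho> + r) \<le> measure \<nu> {\<theta>-r..<\<theta>+\<rho>}"
          using D_diff[of "\<theta> - r" "\<theta> + \<rho>"] up(2) lo(2)[of r] r \<rho> by (simp add: algebra_simps)
        also have "\<dots> \<le> measure \<nu> {\<theta>-\<rho><..<\<theta>+\<rho>}"
          using r by (intro finite_measure_mono) (auto simp: sets)
        finally show "(d - \<eta>) * (\<rho> + r) \<le> measure \<nu> {\<theta>-\<rho><..<\<theta>+\<rho>}" .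
      qed (use \<rho> in auto)
      ultimately have "(d - \<eta>) * (\<rho> + \<rho>) \<le> measure \<nu> {\<theta>-\<rho><..<\<theta>+\<rho>}"
        by (rule tendsto_upperbound) simp
      then show "(d - \<eta>) * (2 * \<rho>) \<le> measure \<nu> {\<theta>-\<rho><..<\<theta>+\<rho>}" by simp
    qed (use \<delta>0 in auto)
  qed
  have bounds: "(d - \<eta>) * L \<le> (LINT t|\<nu>. \<kappa> (t - \<theta>)) \<and> (LINT t|\<nu>. \<kappa> (t - \<theta>)) \<le> (d + \<eta>) * L + e * M"
    if \<eta>: "\<eta> > 0" and \<delta>: "0 < \<delta>" "\<delta> < b"
      and s\<delta>: "\<And>\<rho>. 0 < \<rho> \<Longrightarrow> \<rho> \<le> \<delta> \<Longrightarrow>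
        (d - \<eta>) * (2 * \<rho>) \<le> measure \<nu> {\<theta>-\<rho><..<\<theta>+\<rho>} \<and> measure \<nu> {\<theta>-\<rho><..<\<theta>+\<rho>} \<le> (d + \<eta>) * (2 * \<rho>)"
      and cont: "continuous_on UNIV \<kappa>" and nn: "\<And>s. 0 \<le> \<kappa> s" and even: "\<And>s. \<kappa> (- s) = \<kappa> s"
      and dec: "\<And>s t. 0 \<le> s \<Longrightarrow> s \<le> t \<Longrightarrow> t < b \<Longrightarrow> \<kappa> t \<le> \<kappa> s"
      and e: "0 < e" and tl: "AE t in \<nu>. \<delta> \<le> \<bar>t - \<theta>\<bar> \<longrightarrow> \<kappa> (t - \<theta>) \<le> e"
      and L: "L = (LINT s:{-\<delta><..<\<delta>}|lborel. \<kappa> s)"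
    for \<eta> \<delta> \<kappa> e L
  proof -
    have [measurable]: "\<kappa> \<in> borel_measurable borel" using cont by (rule borel_measurable_continuous_onI)
    have near: "\<kappa> s \<le> \<kappa> 0" if "\<bar>s\<bar> < \<delta>" for s
    proof -
      have "\<kappa> \<bar>s\<bar> = \<kappa> s" using even[of s] by (simp add: abs_if)
      then show ?thesis using dec[of 0 "\<bar>s\<bar>"] that \<delta> by simp
    qed
    have "0 \<le> (d + \<eta>) * (2 * \<delta>)" using s\<delta>[of \<delta>] \<delta> by (smt (verit) measure_nonneg)
    then have d\<eta>: "0 \<le> d + \<eta>" using \<delta> by (simp add: zero_le_mult_iff)
    let ?A = "{\<theta>-\<delta><..<\<theta>+\<delta>}"
    define S where "S = (LINT t:?A|\<nu>. \<kappa> (t - \<theta>))"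
    have int: "integrable \<nu> (\<lambda>t. \<kappa> (t - \<theta>))"
    proof (rule integrable_const_bound)
      show "AE t in \<nu>. norm (\<kappa> (t - \<theta>)) \<le> max e (\<kappa> 0)"
        using tl
      proof eventually_elim
        case (elim t)
        then have "\<kappa> (t - \<theta>) \<le> max e (\<kappa> 0)"
          using near[of "t - \<theta>"] by (cases "\<delta> \<le> \<bar>t - \<theta>\<bar>") (simp_all add: le_max_iff_disj)
        then show ?case using nn[of "t - \<theta>"] by simp
      qed
    qed measurable
    have intA: "set_integrable \<nu> X (\<lambda>t. \<kappa> (t - \<theta>))" if "X \<in> sets borel" for X :: "real set"
      unfolding set_integrable_def using that by (intro integrable_mult_indicator int) (simp add: sets)
    have "set_integrable lborel {-\<delta>..\<delta>} \<kappa>"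
      unfolding set_integrable_def
      by (rule borel_integrable_compact[OF compact_Icc continuous_on_subset[OF cont subset_UNIV]])
    then have intL: "set_integrable lborel {-\<delta><..<\<delta>} \<kappa>"
      by (rule set_integrable_subset) auto
    have Lnn: "ennreal L = (\<integral>\<^sup>+s. ennreal (\<kappa> s) * indicator {-\<delta><..<\<delta>} s \<partial>lborel)"
      unfolding L set_lebesgue_integral_def using intL nn
      by (subst nn_integral_eq_integral[symmetric])
        (auto simp: set_integrable_def intro!: nn_integral_cong split: split_indicator)
    have Snn: "ennreal S = (\<integral>\<^sup>+t. ennreal (\<kappa> (t - \<theta>)) * indicator ?A t \<partial>\<nu>)"
      unfolding S_def set_lebesgue_integral_def using intA[of ?A] nn
      by (subst nn_integral_eq_integral[symmetric])
        (auto simp: set_integrable_def intro!: nn_integral_cong split: split_indicator)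
    have L0: "0 \<le> L" and S0: "0 \<le> S"
      unfolding L S_def set_lebesgue_integral_def using nn by (auto intro!: integral_nonneg_AE)
    define \<alpha> where "\<alpha> y = emeasure lborel {x\<in>space lborel. x \<in> {-\<delta><..<\<delta>} \<and> y < \<kappa> x}" for y
    define \<beta> where "\<beta> y = emeasure \<nu> {x\<in>space \<nu>. x \<in> ?A \<and> y < \<kappa> (x - \<theta>)}" for y
    have lc1: "ennreal L = (\<integral>\<^sup>+y. indicator {0..} y * \<alpha> y \<partial>lborel)"
      unfolding Lnn \<alpha>_def
      by (rule nn_integral_layer_cake) (auto simp: nn intro: lborel.sigma_finite_measure_axioms)
    have lc2: "ennreal S = (\<integral>\<^sup>+y. indicator {0..} y * \<beta> y \<partial>lborel)"
      unfolding Snn \<beta>_def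
      by (rule nn_integral_layer_cake) (auto simp: nn intro: sigma_finite_measure_axioms)
    \<comment> \<open>Level by level the two superlevel sets are the same interval, once at 0 and
      once at \<theta>. If d - \<eta> is negative, \<open>ennreal (d - \<eta>)\<close> is 0 and the
      lower comparison is trivially true.\<close>
    have comp: "ennreal (d - \<eta>) * \<alpha> y \<le> \<beta> y \<and> \<beta> y \<le> ennreal (d + \<eta>) * \<alpha> y" for y
    proof -
      obtain \<rho> where \<rho>: "0 \<le> \<rho>" "\<rho> \<le> \<delta>" "{s. \<bar>s\<bar> < \<delta> \<and> y < \<kappa> s} = {-\<rho><..<\<rho>}"
        by (rule superlevel_set_unimodal[OF cont even dec \<delta>(1) less_imp_le[OF \<delta>(2)], where y = y])
      have 1: "{x\<in>space lborel. x \<in> {-\<delta><..<\<delta>} \<and> y < \<kappa> x} = {-\<rho><..<\<rho>}"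
        unfolding \<rho>(3)[symmetric] by auto
      have mem: "x - \<theta> \<in> {s. \<bar>s\<bar> < \<delta> \<and> y < \<kappa> s} \<longleftrightarrow> x - \<theta> \<in> {-\<rho><..<\<rho>}" for x
        unfolding \<rho>(3) ..
      have 2: "{x\<in>space \<nu>. x \<in> ?A \<and> y < \<kappa> (x - \<theta>)} = {\<theta>-\<rho><..<\<theta>+\<rho>}"
      proof (rule set_eqI)
        fix x
        show "x \<in> {x\<in>space \<nu>. x \<in> ?A \<and> y < \<kappa> (x - \<theta>)} \<longleftrightarrow> x \<in> {\<theta>-\<rho><..<\<theta>+\<rho>}"
          using mem[of x] by (auto simp: sp abs_less_iff)
      qed
      have l1: "\<alpha> y = ennreal (2 * \<rho>)" unfolding \<alpha>_def 1 using \<rho>(1) by simp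
      have n1: "\<beta> y = ennreal (measure \<nu> {\<theta>-\<rho><..<\<theta>+\<rho>})" unfolding \<beta>_def 2 by (rule emeasure_eq_measure)
      show ?thesis
      proof (cases "\<rho> = 0")
        case True
        then show ?thesis unfolding l1 n1 by simp
      next
        case False
        then have s: "(d - \<eta>) * (2 * \<rho>) \<le> measure \<nu> {\<theta>-\<rho><..<\<theta>+\<rho>}"
          "measure \<nu> {\<theta>-\<rho><..<\<theta>+\<rho>} \<le> (d + \<eta>) * (2 * \<rho>)" using s\<delta>[of \<rho>] \<rho> by auto
        have "ennreal (d - \<eta>) * ennreal (2 * \<rho>) = ennreal ((d - \<eta>) * (2 * \<rho>))"
          using \<rho>(1) by (intro ennreal_mult''[symmetric]) simp
        moreover have "ennreal (d + \<eta>) * ennreal (2 * \<rho>) = ennreal ((d + \<eta>) * (2 * \<rho>))"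
          using \<rho>(1) by (intro ennreal_mult''[symmetric]) simp
        ultimately show ?thesis unfolding l1 n1 using s by (simp add: ennreal_leI)
      qed
    qed
    have meas: "(\<lambda>y. indicator {0..} y * \<alpha> y) \<in> borel_measurable lborel"
      unfolding \<alpha>_def by measurable
    have "ennreal (d - \<eta>) * ennreal L \<le> ennreal S"
      unfolding lc1 lc2 using comp
      by (subst nn_integral_cmult[OF meas, symmetric]) (auto intro!: nn_integral_mono split: split_indicator)
    moreover have "ennreal (d - \<eta>) * ennreal L = ennreal ((d - \<eta>) * L)"
      using L0 by (intro ennreal_mult''[symmetric])
    ultimately have low: "(d - \<eta>) * L \<le> S" using S0 by (simp add: ennreal_le_iff)
    have "ennreal S \<le> ennreal (d + \<eta>) * ennreal L"
      unfolding lc1 lc2 using comp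
      by (subst nn_integral_cmult[OF meas, symmetric]) (auto intro!: nn_integral_mono split: split_indicator)
    also have "ennreal (d + \<eta>) * ennreal L = ennreal ((d + \<eta>) * L)"
      using L0 by (intro ennreal_mult''[symmetric])
    finally have upp: "S \<le> (d + \<eta>) * L" using L0 d\<eta> by (simp add: ennreal_le_iff)
    have "(LINT t|\<nu>. \<kappa> (t - \<theta>)) = (LINT t:?A \<union> - ?A|\<nu>. \<kappa> (t - \<theta>))"
      by (simp add: set_lebesgue_integral_def)
    also have "\<dots> = S + (LINT t:- ?A|\<nu>. \<kappa> (t - \<theta>))"
      unfolding S_def by (intro set_integral_Un intA) auto
    finally have split: "(LINT t|\<nu>. \<kappa> (t - \<theta>)) = S + (LINT t:- ?A|\<nu>. \<kappa> (t - \<theta>))" .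
    have "0 \<le> (LINT t:- ?A|\<nu>. \<kappa> (t - \<theta>))"
      unfolding set_lebesgue_integral_def using nn by (auto intro!: integral_nonneg_AE)
    moreover have "(LINT t:- ?A|\<nu>. \<kappa> (t - \<theta>)) \<le> (LINT t|\<nu>. e)"
      unfolding set_lebesgue_integral_def
    proof (rule integral_mono_AE)
      show "integrable \<nu> (\<lambda>t. indicat_real (- ?A) t *\<^sub>R \<kappa> (t - \<theta>))"
        using intA[of "- ?A"] unfolding set_integrable_def by auto
      show "AE t in \<nu>. indicat_real (- ?A) t *\<^sub>R \<kappa> (t - \<theta>) \<le> e"
        using tl by eventually_elim (use e in \<open>auto split: split_indicator\<close>)
    qed simp
    ultimately show ?thesis using split low upp by (simp add: M_def sp mult.commute)
  qed
  have M0: "0 \<le> M" unfolding M_def by simp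
  show ?thesis
  proof (rule tendstoI)
    fix \<epsilon> :: real assume \<epsilon>: "\<epsilon> > 0"
    \<comment> \<open>Three errors of at most \<epsilon>/4 each: \<bar>d\<bar> times \<bar>L -
      1\<bar>, \<eta> L with L < 2, and the tail, which is at most e times the total mass
      \<open>M\<close>. The summands 1 in the denominators cover d = 0 and M = 0.\<close>
    define \<eta> where "\<eta> = \<epsilon> / 8"
    define e where "e = \<epsilon> / (4 * (M + 1))"
    have \<eta>: "\<eta> > 0" and e: "e > 0" unfolding \<eta>_def e_def using \<epsilon> M0 by auto
    have eM: "e * M \<le> \<epsilon> / 4" unfolding e_def using \<epsilon> M0 by (simp add: field_simps)
    obtain \<delta>0 where \<delta>0: "\<delta>0 > 0" "\<And>\<rho>. 0 < \<rho> \<Longrightarrow> \<rho> < \<delta>0 \<Longrightarrow>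
      (d - \<eta>) * (2 * \<rho>) \<le> measure \<nu> {\<theta>-\<rho><..<\<theta>+\<rho>} \<and> measure \<nu> {\<theta>-\<rho><..<\<theta>+\<rho>} \<le> (d + \<eta>) * (2 * \<rho>)"
      using symm[OF \<eta>] by blast
    define \<delta> where "\<delta> = min \<delta>0 b / 2"
    have \<delta>: "0 < \<delta>" "\<delta> < b" "\<delta> < \<delta>0" unfolding \<delta>_def using \<delta>0 b by auto
    have "\<forall>\<^sub>F i in F. dist (LINT s:{-\<delta><..<\<delta>}|lborel. k i s) 1 < min 1 (\<epsilon> / (4 * (\<bar>d\<bar> + 1)))"
      using \<epsilon> by (intro tendstoD[OF mass[OF \<delta>(1,2)]]) auto
    with ker tail[OF \<delta>(1,2) e]
    show "\<forall>\<^sub>F i in F. dist (LINT t|\<nu>. k i (t - \<theta>)) d < \<epsilon>"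
    proof eventually_elim
      case (elim i)
      define L where "L = (LINT s:{-\<delta><..<\<delta>}|lborel. k i s)"
      have L: "\<bar>L - 1\<bar> < 1" "\<bar>L - 1\<bar> < \<epsilon> / (4 * (\<bar>d\<bar> + 1))" using elim(3) by (auto simp: L_def dist_real_def)
      have "\<bar>d\<bar> * \<bar>L - 1\<bar> \<le> \<bar>d\<bar> * (\<epsilon> / (4 * (\<bar>d\<bar> + 1)))"
        using L by (intro mult_left_mono) auto
      also have "\<dots> \<le> \<epsilon> / 4" using \<epsilon> by (simp add: field_simps)
      finally have dL: "\<bar>d * L - d\<bar> \<le> \<epsilon> / 4" by (simp add: abs_mult[symmetric] algebra_simps)
      have "\<eta> * L \<le> \<eta> * 2" using L \<eta> by (intro mult_left_mono) auto
      then have \<eta>L: "\<eta> * L \<le> \<epsilon> / 4" unfolding \<eta>_def by simp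
      have "(d - \<eta>) * L \<le> (LINT t|\<nu>. k i (t - \<theta>)) \<and> (LINT t|\<nu>. k i (t - \<theta>)) \<le> (d + \<eta>) * L + e * M"
        by (rule bounds[OF \<eta> \<delta>(1,2) _ _ _ _ _ e elim(2) L_def]) (use elim(1) \<delta>0(2) \<delta>(3) in auto)
      then have "d * L - \<eta> * L \<le> (LINT t|\<nu>. k i (t - \<theta>))" "(LINT t|\<nu>. k i (t - \<theta>)) \<le> d * L + \<eta> * L + e * M"
        by (simp_all add: algebra_simps)
      then show ?case using dL \<eta>L eM \<epsilon> unfolding dist_real_def by linarith
    qed
  qed
qed

section \<open>Integration on the circle\<close>

lemma measurable_cis_circle: "cis \<in> borel \<rightarrow>\<^sub>M restrict_space borel (sphere 0 1)"
  by (intro measurable_restrict_space2) (auto intro!: borel_measurable_continuous_onI continuous_intros)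

lemma sets_circle: "sets circle = sets (restrict_space borel (sphere 0 1))"
  by (simp add: circle_def)

lemma space_circle [simp]: "space circle = sphere 0 1"
  by (simp add: circle_def space_restrict_space)

lemma measurable_circleI:
  assumes "f \<in> borel_measurable borel" shows "f \<in> borel_measurable circle"
  using measurable_restrict_space1[OF assms] measurable_cong_sets[OF sets_circle refl] by blast

lemma continuous_measurable_circle:
  assumes "continuous_on (sphere 0 1) f" shows "f \<in> borel_measurable circle"
  using borel_measurable_continuous_on_restrict[OF assms] measurable_cong_sets[OF sets_circle refl]
  by blast

lemma uniform_measure_circle_eq:
  "uniform_measure lborel {0..<2 * pi} = density lborel (\<lambda>t. ennreal (indicator {0..<2 * pi} t / (2 * pi)))"
proof -
  have "indicator {0..<2 * pi} t / ennreal (2 * pi) = ennreal (indicator {0..<2 * pi} t / (2 * pi))" for t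
    by (auto split: split_indicator simp: divide_ennreal[symmetric] ennreal_1[symmetric] simp del: ennreal_1)
  then show ?thesis unfolding uniform_measure_def by simp
qed

lemma measurable_cis_uniform:
  "cis \<in> uniform_measure lborel {0..<2 * pi} \<rightarrow>\<^sub>M restrict_space borel (sphere 0 1)"
  using measurable_cis_circle by (simp add: measurable_cong_sets[OF sets_uniform_measure refl])

lemma prob_space_circle: "prob_space circle"
  unfolding circle_def
  by (intro prob_space.prob_space_distr prob_space_uniform_measure measurable_cis_uniform) auto

interpretation circle: prob_space circle by (rule prob_space_circle)

lemma measurable_circle_cis:
  assumes "f \<in> borel_measurable circle" shows "(\<lambda>t. f (cis t)) \<in> borel_measurable borel"
  using measurable_compose[OF measurable_cis_circle, of f borel] assms
    measurable_cong_sets[OF sets_circle refl, of borel] by blast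

lemma circle_integrable_iff:
  fixes f :: "complex \<Rightarrow> 'b::{banach, second_countable_topology}"
  assumes f: "f \<in> borel_measurable circle"
  shows "integrable circle f \<longleftrightarrow> set_integrable lborel {0..<2 * pi} (\<lambda>t. f (cis t))"
proof -
  have f': "f \<in> borel_measurable (restrict_space borel (sphere 0 1))"
    using f measurable_cong_sets[OF sets_circle refl, of borel] by blast
  have m: "(\<lambda>t. f (cis t)) \<in> borel_measurable lborel" using measurable_circle_cis[OF f] by simp
  have "integrable circle f \<longleftrightarrow>
    integrable (density lborel (\<lambda>t. ennreal (indicator {0..<2 * pi} t / (2 * pi)))) (\<lambda>t. f (cis t))"
    unfolding circle_def using measurable_cis_uniform f'
    by (subst integrable_distr_eq) (auto simp: uniform_measure_circle_eq)
  also have "\<dots> \<longleftrightarrow> integrable lborel (\<lambda>t. (indicator {0..<2 * pi} t / (2 * pi)) *\<^sub>R f (cis t))"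
    using m by (intro integrable_density) (auto simp: zero_le_divide_iff)
  also have "\<dots> \<longleftrightarrow> integrable lborel (\<lambda>t. (1 / (2 * pi)) *\<^sub>R (indicator {0..<2 * pi} t *\<^sub>R f (cis t)))"
    by simp
  also have "\<dots> \<longleftrightarrow> integrable lborel (\<lambda>t. indicator {0..<2 * pi} t *\<^sub>R f (cis t))"
  proof
    assume "integrable lborel (\<lambda>t. (1 / (2 * pi)) *\<^sub>R (indicator {0..<2 * pi} t *\<^sub>R f (cis t)))"
    then have "integrable lborel (\<lambda>t. (2 * pi) *\<^sub>R ((1 / (2 * pi)) *\<^sub>R (indicator {0..<2 * pi} t *\<^sub>R f (cis t))))"
      by (rule integrable_scaleR_right)
    then show "integrable lborel (\<lambda>t. indicator {0..<2 * pi} t *\<^sub>R f (cis t))" by simp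
  qed (rule integrable_scaleR_right)
  finally show ?thesis by (simp add: set_integrable_def)
qed

lemma circle_integral_eq:
  fixes f :: "complex \<Rightarrow> 'b::{banach, second_countable_topology}"
  assumes f: "f \<in> borel_measurable circle"
  shows "(LINT \<zeta>|circle. f \<zeta>) = (1 / (2 * pi)) *\<^sub>R (LINT t:{0..<2 * pi}|lborel. f (cis t))"
proof -
  have f': "f \<in> borel_measurable (restrict_space borel (sphere 0 1))"
    using f measurable_cong_sets[OF sets_circle refl, of borel] by blast
  have m: "(\<lambda>t. f (cis t)) \<in> borel_measurable lborel" using measurable_circle_cis[OF f] by simp
  have "(LINT \<zeta>|circle. f \<zeta>) =
    (LINT t|density lborel (\<lambda>t. ennreal (indicator {0..<2 * pi} t / (2 * pi))). f (cis t))"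
    unfolding circle_def using measurable_cis_uniform f'
    by (subst integral_distr) (auto simp: uniform_measure_circle_eq)
  also have "\<dots> = (LINT t|lborel. (indicator {0..<2 * pi} t / (2 * pi)) *\<^sub>R f (cis t))"
    using m by (intro integral_density) (auto simp: zero_le_divide_iff)
  also have "\<dots> = (LINT t|lborel. (1 / (2 * pi)) *\<^sub>R (indicator {0..<2 * pi} t *\<^sub>R f (cis t)))"
    by simp
  also have "\<dots> = (1 / (2 * pi)) *\<^sub>R (LINT t:{0..<2 * pi}|lborel. f (cis t))"
    unfolding set_lebesgue_integral_def by (rule integral_scaleR_right)
  finally show ?thesis .
qed

lemma circle_cis_cases:
  assumes "\<zeta> \<in> sphere 0 1"
  obtains t where "0 \<le> t" "t < 2 * pi" "\<zeta> = cis t"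
  using Arg2pi[of \<zeta>] assms by (auto simp: cis_conv_exp is_Arg_def)

lemma cos_neq_1: "0 < t \<Longrightarrow> t < 2 * pi \<Longrightarrow> cos t \<noteq> 1"
proof
  assume t: "0 < t" "t < 2 * pi" and "cos t = 1"
  then obtain x :: int where x: "t = x * 2 * pi" using cos_one_2pi_int[of t] by auto
  have "0 < real_of_int x" using t(1) unfolding x by (simp add: zero_less_mult_iff)
  moreover have "real_of_int x * (2 * pi) < 1 * (2 * pi)" using t(2) unfolding x by simp
  then have "real_of_int x < 1" by (rule mult_right_less_imp_less) simp
  ultimately have "0 < x" "x < 1" by simp_all
  then show False by linarith
qed

text \<open>The inverse \<open>a\<close> of \<^term>\<open>cis\<close> below is what transports null sets, whose images under \<^term>\<open>cis\<close>
  need not obviously be measurable.\<close>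

lemma AE_circleI:
  assumes "AE t in lborel. 0 < t \<and> t < 2 * pi \<longrightarrow> P (cis t)"
  shows "AE \<zeta> in circle. P \<zeta>"
proof -
  obtain N where N: "{t. \<not> (0 < t \<and> t < 2 * pi \<longrightarrow> P (cis t))} \<subseteq> N" "N \<in> null_sets lborel"
    using assms by (auto simp: eventually_ae_filter)
  \<comment> \<open>The sign moves the cut of \<open>Ln\<close> to the positive real axis, which
    meets the circle only in 1. Setting the function to 0 on the cut makes it Borel measurable on
    the whole plane.\<close>
  define a where "a \<zeta> = Im (indicat_real (- \<real>\<^sub>\<le>\<^sub>0) (- \<zeta>) *\<^sub>R Ln (- \<zeta>)) + pi" for \<zeta>
  have acis: "a (cis t) = t" if "0 < t" "t < 2 * pi" for t
  proof -
    have e: "- cis t = exp (\<i> * (t - pi))"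
      by (simp add: cis_conv_exp exp_diff right_diff_distrib exp_pi_i' )
    have "Ln (- cis t) = \<i> * (t - pi)"
      unfolding e using that by (intro Ln_exp) auto
    moreover have "- cis t \<notin> \<real>\<^sub>\<le>\<^sub>0"
    proof
      assume "- cis t \<in> \<real>\<^sub>\<le>\<^sub>0"
      then have "Re (- cis t) \<le> 0" "Im (- cis t) = 0" by (auto simp: complex_nonpos_Reals_iff)
      then have c: "0 \<le> cos t" "sin t = 0" by auto
      then have "cos t = 1" by (metis abs_of_nonneg sin_zero_abs_cos_one)
      then show False using cos_neq_1[OF that] by simp
    qed
    ultimately show ?thesis unfolding a_def by simp
  qed
  have "(\<lambda>x. indicat_real (- \<real>\<^sub>\<le>\<^sub>0) x *\<^sub>R Ln x) \<in> borel_measurable borel"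
    by (intro borel_measurable_continuous_on_indicator continuous_intros) (auto simp: open_Compl)
  from measurable_compose[OF _ this, of uminus]
  have am: "a \<in> borel_measurable borel" unfolding a_def by measurable
  define Z where "Z = {\<zeta> \<in> space circle. a \<zeta> \<in> N \<or> \<zeta> = 1}"
  have am': "a \<in> borel_measurable circle" using am by (rule measurable_circleI)
  have Zs: "Z \<in> sets circle"
  proof -
    have "a -` N \<inter> space circle \<in> sets circle" using am' N(2) by (intro measurable_sets[of a circle borel]) auto
    moreover have "{1} \<inter> space circle \<in> sets circle"
      by (auto simp: sets_circle sets_restrict_space)
    moreover have "Z = (a -` N \<inter> space circle) \<union> ({1} \<inter> space circle)" unfolding Z_def by auto
    ultimately show ?thesis by (metis sets.Un)
  qed
  have "emeasure circle Z = emeasure (uniform_measure lborel {0..<2 * pi}) (cis -` Z \<inter> space (uniform_measure lborel {0..<2 * pi}))"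
    unfolding circle_def using Zs measurable_cis_uniform by (subst emeasure_distr) (auto simp: sets_circle)
  also have "\<dots> = emeasure lborel ({0..<2 * pi} \<inter> cis -` Z) / emeasure lborel {0..<2 * pi}"
    using measurable_sets[OF measurable_cis_circle, of Z] Zs by (subst emeasure_uniform_measure) (auto simp: sets_circle)
  also have "emeasure lborel ({0..<2 * pi} \<inter> cis -` Z) = 0"
  proof -
    have "{0..<2 * pi} \<inter> cis -` Z \<subseteq> insert 0 N"
    proof
      fix t assume t: "t \<in> {0..<2 * pi} \<inter> cis -` Z"
      show "t \<in> insert 0 N"
      proof (cases "t = 0")
        case False
        then have t': "0 < t" "t < 2 * pi" using t by auto
        have "cis t \<noteq> 1"
        proof
          assume "cis t = 1"
          then have "cos t = 1" by (metis cis.sel(1) one_complex.sel(1))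
          then show False using cos_neq_1[OF t'] by simp
        qed
        then show ?thesis using t acis[OF t'] by (auto simp: Z_def)
      qed simp
    qed
    moreover have "insert 0 N \<in> null_sets lborel"
      using null_sets.Un[of "{0}" lborel N] N(2) by (auto simp: null_sets_def)
    moreover have "{0..<2 * pi} \<inter> cis -` Z \<in> sets lborel"
      using measurable_sets[OF measurable_cis_circle, of Z] Zs by (auto simp: sets_circle)
    ultimately show ?thesis using null_sets_subset by blast
  qed
  finally have Z0: "Z \<in> null_sets circle" using Zs by (auto simp: null_sets_def)
  show ?thesis
  proof (rule AE_I'[OF Z0])
    show "{\<zeta> \<in> space circle. \<not> P \<zeta>} \<subseteq> Z"
    proof
      fix \<zeta> assume z: "\<zeta> \<in> {\<zeta> \<in> space circle. \<not> P \<zeta>}"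
      then obtain t where t: "0 \<le> t" "t < 2 * pi" "\<zeta> = cis t" using circle_cis_cases[of \<zeta>] by auto
      show "\<zeta> \<in> Z"
      proof (cases "t = 0")
        case True
        then show ?thesis using z t by (auto simp: Z_def)
      next
        case False
        then show ?thesis using z t acis[of t] N(1) by (auto simp: Z_def)
      qed
    qed
  qed
qed


section \<open>Radial limits of Poisson integrals\<close>

definition poisson_kernel :: "real \<Rightarrow> real \<Rightarrow> real" where
  "poisson_kernel r s = (1 - r\<^sup>2) / (1 - 2 * r * cos s + r\<^sup>2)"

lemma poisson_denominator_pos:
  fixes r s :: real
  shows "0 < r \<Longrightarrow> r < 1 \<Longrightarrow> 0 < 1 - 2 * r * cos s + r\<^sup>2"
proof -
  assume r: "0 < r" "r < 1"
  have "0 < (1 - r)\<^sup>2" using r by (intro zero_less_power) simp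
  also have "\<dots> \<le> (1 - r)\<^sup>2 + 2 * r * (1 - cos s)" using r by simp
  finally show ?thesis by (simp add: power2_eq_square algebra_simps)
qed

lemma Re_Hker: "Re (Hker w) = (1 - (norm w)\<^sup>2) / (norm (1 - w))\<^sup>2"
proof -
  have "Hker w = (1 + w) * cnj (1 - w) / (complex_of_real ((norm (1 - w))\<^sup>2))"
    unfolding Hker_def by (subst complex_div_cnj) simp
  then have "Re (Hker w) = Re ((1 + w) * cnj (1 - w)) / (norm (1 - w))\<^sup>2"
    by (simp only: Re_divide_of_real)
  also have "Re ((1 + w) * cnj (1 - w)) = 1 - (norm w)\<^sup>2"
    by (simp add: cmod_power2) (simp add: algebra_simps power2_eq_square)
  finally show ?thesis .
qed

lemma Re_Hker_cis:
  "Re (Hker (complex_of_real r * cis \<theta> * cnj (cis t))) = poisson_kernel r (t - \<theta>)"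
proof -
  have w: "complex_of_real r * cis \<theta> * cnj (cis t) = r * cis (\<theta> - t)"
    by (simp add: cis_cnj cis_mult)
  have "(norm (complex_of_real r * cis (\<theta> - t)))\<^sup>2 = r\<^sup>2" by (simp add: norm_mult)
  moreover have "(norm (1 - complex_of_real r * cis (\<theta> - t)))\<^sup>2 = 1 - 2 * r * cos (t - \<theta>) + r\<^sup>2"
  proof -
    have "(norm (1 - complex_of_real r * cis (\<theta> - t)))\<^sup>2 = 
      (1 - r * cos (\<theta> - t))\<^sup>2 + (r * sin (\<theta> - t))\<^sup>2"
      by (simp add: cmod_power2)
    also have "\<dots> = 1 - 2 * r * cos (\<theta> - t) + r\<^sup>2 * ((sin (\<theta> - t))\<^sup>2 + (cos (\<theta> - t))\<^sup>2)"
      unfolding power_mult_distrib by algebra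
    also have "(sin (\<theta> - t))\<^sup>2 + (cos (\<theta> - t))\<^sup>2 = 1" by (rule sin_cos_squared_add)
    also have "cos (\<theta> - t) = cos (t - \<theta>)" by (metis cos_minus minus_diff_eq)
    finally show ?thesis by simp
  qed
  ultimately show ?thesis unfolding w Re_Hker poisson_kernel_def by simp
qed

text \<open>The half-angle substitution. With C the square of cos (s/2), the denominator 1 - 2 r cos
  s + r^2 equals C (1 - r)^2 + (1 - C) (1 + r)^2, which is what differentiating the arctangent
  produces after multiplication by (1 - r)^2.\<close>

lemma poisson_kernel_antiderivative:
  assumes r: "0 < r" "r < 1" and s: "\<bar>s\<bar> < pi"
  shows "((\<lambda>s. 2 * arctan ((1 + r) / (1 - r) * tan (s / 2))) has_real_derivative poisson_kernel r s) (at s)"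
proof -
  define c where "c = (1 + r) / (1 - r)"
  have cos: "cos (s / 2) > 0" using s by (intro cos_gt_zero_pi) auto
  define C where "C = (cos (s / 2))\<^sup>2"
  have C: "C > 0" and S: "(sin (s / 2))\<^sup>2 = 1 - C" unfolding C_def using cos by (auto simp: sin_squared_eq)
  have "((\<lambda>s. 2 * arctan (c * tan (s / 2))) has_real_derivative
      2 * (inverse (1 + (c * tan (s / 2))\<^sup>2) * (c * (inverse ((cos (s / 2))\<^sup>2) * (1 / 2))))) (at s)"
    using cos by (auto intro!: derivative_eq_intros)
  moreover have "2 * (inverse (1 + (c * tan (s / 2))\<^sup>2) * (c * (inverse ((cos (s / 2))\<^sup>2) * (1 / 2)))) = poisson_kernel r s"
  proof -
    define Y where "Y = C + c\<^sup>2 * (1 - C)"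
    have "c > 0" unfolding c_def using r by simp
    moreover have "0 \<le> 1 - C" unfolding S[symmetric] by simp
    ultimately have Y: "Y > 0" unfolding Y_def using C by (simp add: add_pos_nonneg)
    have "(c * tan (s / 2))\<^sup>2 = c\<^sup>2 * (1 - C) / C"
      by (simp add: tan_def power_mult_distrib power_divide S C_def[symmetric])
    then have 1: "1 + (c * tan (s / 2))\<^sup>2 = Y / C" using C by (simp add: Y_def field_simps)
    then have "2 * (inverse (1 + (c * tan (s / 2))\<^sup>2) * (c * (inverse ((cos (s / 2))\<^sup>2) * (1 / 2)))) = c / Y"
      unfolding 1 using C Y by (simp add: C_def[symmetric] field_simps)
    also have "\<dots> = (c * (1 - r)\<^sup>2) / (Y * (1 - r)\<^sup>2)" using r by simp
    also have "c * (1 - r)\<^sup>2 = 1 - r\<^sup>2"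
      unfolding c_def using r by (simp add: power2_eq_square field_simps)
    also have "Y * (1 - r)\<^sup>2 = 1 - 2 * r * cos s + r\<^sup>2"
    proof -
      have "cos s = 2 * C - 1"
        using cos_double_cos[of "s / 2"] by (simp add: C_def)
      moreover have "c\<^sup>2 * (1 - r)\<^sup>2 = (1 + r)\<^sup>2" unfolding c_def using r by (simp add: power_divide)
      then have "Y * (1 - r)\<^sup>2 = C * (1 - r)\<^sup>2 + (1 + r)\<^sup>2 * (1 - C)"
        unfolding Y_def by algebra
      ultimately show ?thesis by algebra
    qed
    finally show ?thesis unfolding poisson_kernel_def .
  qed
  ultimately show ?thesis unfolding c_def by simp
qed

text \<open>The mass of a fixed interval is 2/\<pi> times the arctangent of tan (\<delta>/2) (1 +
  r)/(1 - r), and the last factor tends to infinity.\<close>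

lemma poisson_kernel_mass:
  assumes \<delta>: "0 < \<delta>" "\<delta> < pi"
  shows "((\<lambda>r. LINT s:{-\<delta><..<\<delta>}|lborel. poisson_kernel r s / (2 * pi)) \<longlongrightarrow> 1) (at_left 1)"
proof -
  have ev: "\<forall>\<^sub>F r in at_left (1::real). 0 < r \<and> r < 1"
    unfolding eventually_at_left_field by (intro exI[of _ 0]) auto
  have eq: "(LINT s:{-\<delta><..<\<delta>}|lborel. poisson_kernel r s / (2 * pi)) =
      2 * arctan ((1 + r) / (1 - r) * tan (\<delta> / 2)) / pi" if r: "0 < r" "r < 1" for r
  proof -
    let ?F = "\<lambda>s. 2 * arctan ((1 + r) / (1 - r) * tan (s / 2)) / (2 * pi)"
    have "(LBINT s=ereal (-\<delta>)..ereal \<delta>. poisson_kernel r s / (2 * pi)) = ?F \<delta> - ?F (- \<delta>)"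
    proof (rule interval_integral_FTC_finite)
      show "continuous_on {min (- \<delta>) \<delta>..max (- \<delta>) \<delta>} (\<lambda>s. poisson_kernel r s / (2 * pi))"
        unfolding poisson_kernel_def using poisson_denominator_pos[OF r]
        by (auto intro!: continuous_intros simp: less_imp_neq[symmetric])
      fix s assume "min (- \<delta>) \<delta> \<le> s" "s \<le> max (- \<delta>) \<delta>"
      then have "\<bar>s\<bar> < pi" using \<delta> by auto
      from DERIV_cdivide[OF poisson_kernel_antiderivative[OF r this], of "2 * pi"]
      show "(?F has_vector_derivative poisson_kernel r s / (2 * pi)) (at s within {min (- \<delta>) \<delta>..max (- \<delta>) \<delta>})"
        by (metis has_field_derivative_at_within has_real_derivative_iff_has_vector_derivative)
    qed
    moreover have "?F (- \<delta>) = - ?F \<delta>" by (simp add: arctan_minus)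
    moreover have "(LBINT s=ereal (-\<delta>)..ereal \<delta>. poisson_kernel r s / (2 * pi)) = (LINT s:{-\<delta><..<\<delta>}|lborel. poisson_kernel r s / (2 * pi))"
      using \<delta> by (subst interval_lebesgue_integral_le_eq) (auto simp only: einterval_eq ereal_less_eq)
    ultimately show ?thesis by (simp add: field_simps)
  qed
  have tan: "tan (\<delta> / 2) > 0" using \<delta> by (intro tan_gt_zero) auto
  have "filterlim (\<lambda>r. (1 + r) / (1 - r)) at_top (at_left (1::real))" by real_asymp
  then have "filterlim (\<lambda>r. (1 + r) / (1 - r) * tan (\<delta> / 2)) at_top (at_left (1::real))"
    using tan by (intro filterlim_at_top_mult_tendsto_pos[of _ "tan (\<delta> / 2)"]) auto
  then have "((\<lambda>r. 2 * arctan ((1 + r) / (1 - r) * tan (\<delta> / 2)) / pi) \<longlongrightarrow> 2 * (pi / 2) / pi) (at_left 1)"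
    by (intro tendsto_intros filterlim_compose[OF tendsto_arctan_at_top]) auto
  then have "((\<lambda>r. 2 * arctan ((1 + r) / (1 - r) * tan (\<delta> / 2)) / pi) \<longlongrightarrow> 1) (at_left 1)" by simp
  then show ?thesis
    by (rule Lim_transform_eventually) (use ev eq in \<open>auto elim!: eventually_mono\<close>)
qed

lemma poisson_kernel_antimono:
  assumes r: "0 < r" "r < 1" and c: "cos t \<le> cos s"
  shows "poisson_kernel r t \<le> poisson_kernel r s"
proof -
  have "1 - 2 * r * cos s + r\<^sup>2 \<le> 1 - 2 * r * cos t + r\<^sup>2"
    using mult_left_mono[OF c, of "2 * r"] r by simp
  moreover have "0 \<le> 1 - r\<^sup>2" using r by (simp add: power_le_one)
  ultimately show ?thesis
    unfolding poisson_kernel_def using poisson_denominator_pos[OF r] by (intro divide_left_mono mult_pos_pos)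
qed

text \<open>\<open>Fatou_kernel\<close> for the measure with density \<open>g (cis t)\<close> on [0,
  2\<pi>). By Lebesgue's differentiation theorem its distribution function has derivative
  \<open>g (cis \<theta>)\<close> at almost every interior \<theta>. Nonnegativity of
  \<open>g\<close> is what turns it into a measure.\<close>

lemma poisson_integral_radial_limit_nonneg:
  fixes g :: "complex \<Rightarrow> real"
  assumes g: "integrable circle g" and nn: "\<And>\<zeta>. 0 \<le> g \<zeta>"
  shows "AE \<zeta> in circle. ((\<lambda>r. LINT \<eta>|circle. g \<eta> * Re (Hker (complex_of_real r * \<zeta> * cnj \<eta>))) \<longlongrightarrow> g \<zeta>) (at_left 1)"
proof (rule AE_circleI)
  define G where "G t = indicator {0..<2 * pi} t * g (cis t)" for t
  have gm: "g \<in> borel_measurable circle" using g by auto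
  have Gi: "integrable lborel G"
    using g unfolding circle_integrable_iff[OF gm] set_integrable_def G_def by simp
  have Gnn: "0 \<le> G t" for t unfolding G_def using nn by simp
  define \<nu> where "\<nu> = density lborel (\<lambda>t. ennreal (G t))"
  have Gm: "G \<in> borel_measurable borel" using borel_measurable_integrable[OF Gi] by simp
  have s\<nu>: "sets \<nu> = sets borel" unfolding \<nu>_def by simp
  have e\<nu>: "measure \<nu> X = (LINT s:X|lborel. G s)" if X: "X \<in> sets borel" for X
  proof -
    have "emeasure \<nu> X = (\<integral>\<^sup>+s. ennreal (indicator X s * G s) \<partial>lborel)"
      unfolding \<nu>_def using Gm X
      by (subst emeasure_density) (auto intro!: nn_integral_cong split: split_indicator)
    moreover have "integrable lborel (\<lambda>s. indicator X s * G s)"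
      using integrable_mult_indicator[OF _ Gi, of X] X by simp
    ultimately show ?thesis
      using nn_integral_eq_integral[of lborel "\<lambda>s. indicator X s * G s"] Gnn
      by (simp add: measure_def set_lebesgue_integral_def)
  qed
  have fm: "finite_measure \<nu>"
    unfolding \<nu>_def using Gi Gnn by (intro finite_measureI) (simp add: emeasure_density Gm nn_integral_eq_integral)
  show "AE t in lborel. 0 < t \<and> t < 2 * pi \<longrightarrow>
    ((\<lambda>r. LINT \<eta>|circle. g \<eta> * Re (Hker (complex_of_real r * cis t * cnj \<eta>))) \<longlongrightarrow> g (cis t)) (at_left 1)"
    using AE_derivative_indefinite_integral[OF Gi]
  proof eventually_elim
    case (elim \<theta>)
    show ?case
    proof
      assume \<theta>: "0 < \<theta> \<and> \<theta> < 2 * pi"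
      have ev: "\<forall>\<^sub>F r in at_left (1::real). 0 < r \<and> r < 1"
        unfolding eventually_at_left_field by (intro exI[of _ 0]) auto
      have "((\<lambda>r. LINT t|\<nu>. poisson_kernel r (t - \<theta>) / (2 * pi)) \<longlongrightarrow> G \<theta>) (at_left 1)"
      proof (rule Fatou_kernel[OF fm s\<nu>])
        show "((\<lambda>t. measure \<nu> {..<t}) has_real_derivative G \<theta>) (at \<theta>)"
          using elim e\<nu> by simp
        \<comment> \<open>This radius is at most \<pi>, so the kernel decreases on [0, b). It is
          also a lower bound for 2\<pi> - \<bar>t - \<theta>\<bar> when t is in [0, 2\<pi>), so that
          the tail estimate survives for points that are near \<theta> the other way round the
          circle.\<close>
        show b: "0 < min \<theta> (2 * pi - \<theta>)" using \<theta> by simp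
        show "\<forall>\<^sub>F r in at_left 1. continuous_on UNIV (\<lambda>s. poisson_kernel r s / (2 * pi)) \<and>
          (\<forall>s. 0 \<le> poisson_kernel r s / (2 * pi) \<and> poisson_kernel r (- s) / (2 * pi) = poisson_kernel r s / (2 * pi)) \<and>
          (\<forall>s t. 0 \<le> s \<and> s \<le> t \<and> t < min \<theta> (2 * pi - \<theta>) \<longrightarrow> poisson_kernel r t / (2 * pi) \<le> poisson_kernel r s / (2 * pi))"
          using ev
        proof (eventually_elim, intro conjI allI impI)
          fix r s :: real assume r: "0 < r \<and> r < 1"
          show "continuous_on UNIV (\<lambda>s. poisson_kernel r s / (2 * pi))"
            unfolding poisson_kernel_def using poisson_denominator_pos[of r] r
            by (auto intro!: continuous_intros simp: less_imp_neq[symmetric])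
          have "r\<^sup>2 \<le> 1" using r by (simp add: power_le_one)
          then show "0 \<le> poisson_kernel r s / (2 * pi)"
            unfolding poisson_kernel_def using poisson_denominator_pos[of r s] r by simp
          show "poisson_kernel r (- s) / (2 * pi) = poisson_kernel r s / (2 * pi)"
            unfolding poisson_kernel_def by simp
        next
          fix r s t :: real assume r: "0 < r \<and> r < 1" and st: "0 \<le> s \<and> s \<le> t \<and> t < min \<theta> (2 * pi - \<theta>)"
          have "cos t \<le> cos s" using st \<theta> by (intro cos_monotone_0_pi_le) auto
          then show "poisson_kernel r t / (2 * pi) \<le> poisson_kernel r s / (2 * pi)"
            using poisson_kernel_antimono[of r t s] r by (simp add: divide_right_mono)
        qed
        fix \<delta> :: real assume \<delta>: "0 < \<delta>" "\<delta> < min \<theta> (2 * pi - \<theta>)"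
        then have \<delta>pi: "\<delta> < pi" by auto
        show "((\<lambda>r. LINT s:{-\<delta><..<\<delta>}|lborel. poisson_kernel r s / (2 * pi)) \<longlongrightarrow> 1) (at_left 1)"
          by (rule poisson_kernel_mass[OF \<delta>(1) \<delta>pi])
        fix e :: real assume e: "0 < e"
        have "cos \<delta> < 1" using cos_monotone_0_pi[of 0 \<delta>] \<delta> \<delta>pi by simp
        then have "((\<lambda>r. (1 - r\<^sup>2) / (1 - 2 * r * cos \<delta> + r\<^sup>2) / (2 * pi)) \<longlongrightarrow> (1 - 1\<^sup>2) / (1 - 2 * 1 * cos \<delta> + 1\<^sup>2) / (2 * pi)) (at_left (1::real))"
          by (intro tendsto_intros) auto
        then have "\<forall>\<^sub>F r in at_left 1. poisson_kernel r \<delta> / (2 * pi) < e"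
          unfolding poisson_kernel_def using e by (intro order_tendstoD(2)) auto
        with ev show "\<forall>\<^sub>F r in at_left 1. AE t in \<nu>. \<delta> \<le> \<bar>t - \<theta>\<bar> \<longrightarrow> poisson_kernel r (t - \<theta>) / (2 * pi) \<le> e"
        proof eventually_elim
          case (elim r)
          have far: "poisson_kernel r (t - \<theta>) / (2 * pi) \<le> e" if t: "0 \<le> t" "t < 2 * pi" "\<delta> \<le> \<bar>t - \<theta>\<bar>" for t
          proof -
            have "cos (t - \<theta>) \<le> cos \<delta>"
            proof (cases "\<bar>t - \<theta>\<bar> \<le> pi")
              case True
              then have "cos \<bar>t - \<theta>\<bar> \<le> cos \<delta>" using t \<delta> by (intro cos_monotone_0_pi_le) auto
              then show ?thesis by simp
            next
              case False
              have "cos (2 * pi - \<bar>t - \<theta>\<bar>) \<le> cos \<delta>"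
                using False t \<delta> \<theta> by (intro cos_monotone_0_pi_le) auto
              moreover have "cos (2 * pi - \<bar>t - \<theta>\<bar>) = cos (t - \<theta>)"
                using cos_periodic[of "- \<bar>t - \<theta>\<bar>"] by (simp add: add.commute)
              ultimately show ?thesis by simp
            qed
            then have "poisson_kernel r (t - \<theta>) / (2 * pi) \<le> poisson_kernel r \<delta> / (2 * pi)"
              using poisson_kernel_antimono[of r "t - \<theta>" \<delta>] elim by (intro divide_right_mono) auto
            then show ?thesis using elim by simp
          qed
          show ?case unfolding \<nu>_def
          proof (subst AE_density)
            show "AE t in lborel. 0 < ennreal (G t) \<longrightarrow> \<delta> \<le> \<bar>t - \<theta>\<bar> \<longrightarrow> poisson_kernel r (t - \<theta>) / (2 * pi) \<le> e"
              using far by (intro AE_I2) (auto simp: G_def split: split_indicator)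
          qed (use Gm in simp)
        qed
      qed
      moreover have "G \<theta> = g (cis \<theta>)" using \<theta> unfolding G_def by simp
      moreover have "\<forall>\<^sub>F r in at_left (1::real). (LINT t|\<nu>. poisson_kernel r (t - \<theta>) / (2 * pi)) =
          (LINT \<eta>|circle. g \<eta> * Re (Hker (complex_of_real r * cis \<theta> * cnj \<eta>)))"
        using ev
      proof eventually_elim
        case (elim r)
        have pm: "(\<lambda>s. poisson_kernel r (s - \<theta>)) \<in> borel_measurable borel"
          unfolding poisson_kernel_def using poisson_denominator_pos[of r] elim
          by (intro borel_measurable_continuous_onI continuous_intros) (auto simp: less_imp_neq[symmetric])
        have m: "(\<lambda>\<eta>. g \<eta> * Re (Hker (complex_of_real r * cis \<theta> * cnj \<eta>))) \<in> borel_measurable circle"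
        proof (intro borel_measurable_times gm continuous_measurable_circle)
          have "complex_of_real r * cis \<theta> * cnj \<eta> \<noteq> 1" if "norm \<eta> = 1" for \<eta>
          proof
            assume "complex_of_real r * cis \<theta> * cnj \<eta> = 1"
            then have "norm (complex_of_real r * cis \<theta> * cnj \<eta>) = 1" by simp
            then show False using elim that by (simp add: norm_mult)
          qed
          then show "continuous_on (sphere 0 1) (\<lambda>\<eta>. Re (Hker (complex_of_real r * cis \<theta> * cnj \<eta>)))"
            unfolding Hker_def by (intro continuous_intros) auto
        qed
        have "(LINT t|\<nu>. poisson_kernel r (t - \<theta>) / (2 * pi)) = (LINT t|lborel. G t *\<^sub>R (poisson_kernel r (t - \<theta>) / (2 * pi)))"
          unfolding \<nu>_def using pm Gm Gnn by (intro integral_density) auto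
        also have "\<dots> = (LINT t|lborel. (1 / (2 * pi)) *\<^sub>R (indicator {0..<2 * pi} t *\<^sub>R (g (cis t) * poisson_kernel r (t - \<theta>))))"
          unfolding G_def by (simp add: mult_ac)
        also have "\<dots> = (1 / (2 * pi)) *\<^sub>R (LINT t:{0..<2 * pi}|lborel. g (cis t) * poisson_kernel r (t - \<theta>))"
          unfolding set_lebesgue_integral_def by (rule integral_scaleR_right)
        also have "\<dots> = (LINT \<eta>|circle. g \<eta> * Re (Hker (complex_of_real r * cis \<theta> * cnj \<eta>)))"
          unfolding circle_integral_eq[OF m] Re_Hker_cis ..
        finally show ?case .
      qed
      ultimately show "((\<lambda>r. LINT \<eta>|circle. g \<eta> * Re (Hker (complex_of_real r * cis \<theta> * cnj \<eta>))) \<longlongrightarrow> g (cis \<theta>)) (at_left 1)"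
        by (auto intro: Lim_transform_eventually)
    qed
  qed
qed

section \<open>Integrability against the Herglotz kernel, and radial limits for signed and complex
  functions\<close>

lemma norm_Hker_le:
  assumes "norm w < 1" shows "norm (Hker w) \<le> 2 / (1 - norm w)"
proof -
  have "norm (1 + w) \<le> 2" using norm_triangle_ineq[of 1 w] assms by simp
  moreover have "1 - norm w \<le> norm (1 - w)" using norm_triangle_ineq2[of 1 w] by simp
  ultimately show ?thesis unfolding Hker_def norm_divide using assms by (intro frac_le) auto
qed

lemma norm_mult_cnj_circle: "norm \<zeta> = 1 \<Longrightarrow> norm (z * cnj \<zeta>) = norm z"
  by (simp add: norm_mult)

lemma continuous_on_Hker_circle:
  assumes "norm z < 1" shows "continuous_on (sphere 0 1) (\<lambda>\<zeta>. Hker (z * cnj \<zeta>))"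
proof -
  have "z * cnj \<zeta> \<noteq> 1" if "norm \<zeta> = 1" for \<zeta>
    using norm_mult_cnj_circle[OF that, of z] assms by auto
  then show ?thesis unfolding Hker_def by (intro continuous_intros) auto
qed

lemma circle_integrable_mult_bounded:
  fixes f g :: "complex \<Rightarrow> 'a::{real_normed_algebra, banach, second_countable_topology}"
  assumes f: "integrable circle f" and g: "g \<in> borel_measurable circle"
    and b: "AE \<zeta> in circle. norm (g \<zeta>) \<le> B"
  shows "integrable circle (\<lambda>\<zeta>. f \<zeta> * g \<zeta>)"
proof (rule Bochner_Integration.integrable_bound[of circle "\<lambda>\<zeta>. B * norm (f \<zeta>)"])
  show "integrable circle (\<lambda>\<zeta>. B * norm (f \<zeta>))" using f by auto
  show "(\<lambda>\<zeta>. f \<zeta> * g \<zeta>) \<in> borel_measurable circle" using f g by auto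
  show "AE \<zeta> in circle. norm (f \<zeta> * g \<zeta>) \<le> norm (B * norm (f \<zeta>))"
    using b
  proof eventually_elim
    case (elim \<zeta>)
    have "norm (f \<zeta> * g \<zeta>) \<le> norm (f \<zeta>) * norm (g \<zeta>)" by (rule norm_mult_ineq)
    also have "\<dots> \<le> norm (f \<zeta>) * B" using elim by (intro mult_left_mono) auto
    also have "\<dots> \<le> norm (B * norm (f \<zeta>))" by (simp add: mult.commute)
    finally show ?case .
  qed
qed

lemma circle_integrable_mult_Hker:
  assumes f: "integrable circle (f :: complex \<Rightarrow> complex)" and z: "norm z < 1"
  shows "integrable circle (\<lambda>\<zeta>. f \<zeta> * Hker (z * cnj \<zeta>))"
proof (rule circle_integrable_mult_bounded[OF f])
  show "(\<lambda>\<zeta>. Hker (z * cnj \<zeta>)) \<in> borel_measurable circle"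
    by (intro continuous_measurable_circle continuous_on_Hker_circle z)
  show "AE \<zeta> in circle. norm (Hker (z * cnj \<zeta>)) \<le> 2 / (1 - norm z)"
  proof (rule AE_I2)
    fix \<zeta> assume "\<zeta> \<in> space circle"
    then have "norm (z * cnj \<zeta>) = norm z" using norm_mult_cnj_circle by simp
    then show "norm (Hker (z * cnj \<zeta>)) \<le> 2 / (1 - norm z)"
      using norm_Hker_le[of "z * cnj \<zeta>"] z by simp
  qed
qed

lemma circle_integrable_mult_of_real_Re_Hker:
  assumes f: "integrable circle (f :: complex \<Rightarrow> complex)" and z: "norm z < 1"
  shows "integrable circle (\<lambda>\<zeta>. f \<zeta> * complex_of_real (Re (Hker (z * cnj \<zeta>))))"
proof (rule circle_integrable_mult_bounded[OF f])
  show "(\<lambda>\<zeta>. complex_of_real (Re (Hker (z * cnj \<zeta>)))) \<in> borel_measurable circle"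
    by (intro continuous_measurable_circle continuous_intros continuous_on_Hker_circle z)
  show "AE \<zeta> in circle. norm (complex_of_real (Re (Hker (z * cnj \<zeta>)))) \<le> 2 / (1 - norm z)"
  proof (rule AE_I2)
    fix \<zeta> assume "\<zeta> \<in> space circle"
    then have n: "norm (z * cnj \<zeta>) = norm z" using norm_mult_cnj_circle by simp
    have "norm (complex_of_real (Re (Hker (z * cnj \<zeta>)))) \<le> norm (Hker (z * cnj \<zeta>))"
      unfolding norm_of_real by (rule abs_Re_le_cmod)
    also have "\<dots> \<le> 2 / (1 - norm z)" using norm_Hker_le[of "z * cnj \<zeta>"] z unfolding n by simp
    finally show "norm (complex_of_real (Re (Hker (z * cnj \<zeta>)))) \<le> 2 / (1 - norm z)" .
  qed
qed

lemma circle_integrable_mult_Re_Hker: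
  assumes f: "integrable circle (f :: complex \<Rightarrow> real)" and z: "norm z < 1"
  shows "integrable circle (\<lambda>\<zeta>. f \<zeta> * Re (Hker (z * cnj \<zeta>)))"
proof -
  have "integrable circle (\<lambda>\<zeta>. complex_of_real (f \<zeta>))" using f by simp
  from integrable_Re[OF circle_integrable_mult_Hker[OF this z]] show ?thesis by simp
qed

lemma poisson_integral_radial_limit_real:
  fixes g :: "complex \<Rightarrow> real"
  assumes g: "integrable circle g"
  shows "AE \<zeta> in circle. ((\<lambda>r. LINT \<eta>|circle. g \<eta> * Re (Hker (complex_of_real r * \<zeta> * cnj \<eta>))) \<longlongrightarrow> g \<zeta>) (at_left 1)"
proof -
  have p: "integrable circle (\<lambda>\<zeta>. max (g \<zeta>) 0)" and m: "integrable circle (\<lambda>\<zeta>. max (- g \<zeta>) 0)"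
    using g by auto
  have ev: "\<forall>\<^sub>F r in at_left (1::real). 0 < r \<and> r < 1"
    unfolding eventually_at_left_field by (intro exI[of _ 0]) auto
  have "AE \<zeta> in circle. \<zeta> \<in> space circle" by (rule AE_space)
  with poisson_integral_radial_limit_nonneg[OF p max.cobounded2]
    poisson_integral_radial_limit_nonneg[OF m max.cobounded2]
  show ?thesis
  proof eventually_elim
    case (elim \<zeta>)
    have "((\<lambda>r. (LINT \<eta>|circle. max (g \<eta>) 0 * Re (Hker (complex_of_real r * \<zeta> * cnj \<eta>))) -
       (LINT \<eta>|circle. max (- g \<eta>) 0 * Re (Hker (complex_of_real r * \<zeta> * cnj \<eta>)))) \<longlongrightarrow> max (g \<zeta>) 0 - max (- g \<zeta>) 0) (at_left 1)"
      by (rule tendsto_diff[OF elim(1,2)])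
    moreover have "max (g \<zeta>) 0 - max (- g \<zeta>) 0 = g \<zeta>" by (auto simp: max_def)
    ultimately have lim: "((\<lambda>r. (LINT \<eta>|circle. max (g \<eta>) 0 * Re (Hker (complex_of_real r * \<zeta> * cnj \<eta>))) -
       (LINT \<eta>|circle. max (- g \<eta>) 0 * Re (Hker (complex_of_real r * \<zeta> * cnj \<eta>)))) \<longlongrightarrow> g \<zeta>) (at_left 1)" by simp
    show ?case
    proof (rule Lim_transform_eventually[OF lim], rule eventually_mono[OF ev])
      fix r :: real assume r: "0 < r \<and> r < 1"
      then have z: "norm (complex_of_real r * \<zeta>) < 1" using elim(3) by (simp add: norm_mult)
      show "(LINT \<eta>|circle. max (g \<eta>) 0 * Re (Hker (complex_of_real r * \<zeta> * cnj \<eta>))) -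
       (LINT \<eta>|circle. max (- g \<eta>) 0 * Re (Hker (complex_of_real r * \<zeta> * cnj \<eta>))) =
        (LINT \<eta>|circle. g \<eta> * Re (Hker (complex_of_real r * \<zeta> * cnj \<eta>)))"
        unfolding Bochner_Integration.integral_diff[OF circle_integrable_mult_Re_Hker[OF p z]
            circle_integrable_mult_Re_Hker[OF m z], symmetric]
        by (intro Bochner_Integration.integral_cong) (auto simp: max_def)
    qed
  qed
qed

lemma poisson_integral_radial_limit:
  fixes g :: "complex \<Rightarrow> complex"
  assumes g: "integrable circle g"
  shows "AE \<zeta> in circle. ((\<lambda>r. LINT \<eta>|circle. g \<eta> * complex_of_real (Re (Hker (complex_of_real r * \<zeta> * cnj \<eta>)))) \<longlongrightarrow> g \<zeta>) (at_left 1)"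
proof -
  have ev: "\<forall>\<^sub>F r in at_left (1::real). 0 < r \<and> r < 1"
    unfolding eventually_at_left_field by (intro exI[of _ 0]) auto
  have "AE \<zeta> in circle. \<zeta> \<in> space circle" by (rule AE_space)
  with poisson_integral_radial_limit_real[OF integrable_Re[OF g]] poisson_integral_radial_limit_real[OF integrable_Im[OF g]]
  show ?thesis
  proof eventually_elim
    case (elim \<zeta>)
    let ?k = "\<lambda>r \<eta>. Re (Hker (complex_of_real r * \<zeta> * cnj \<eta>))"
    have lim: "((\<lambda>r. Complex (LINT \<eta>|circle. Re (g \<eta>) * ?k r \<eta>) (LINT \<eta>|circle. Im (g \<eta>) * ?k r \<eta>)) \<longlongrightarrow> Complex (Re (g \<zeta>)) (Im (g \<zeta>))) (at_left 1)"
      by (rule tendsto_Complex[OF elim(1,2)])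
    show ?case
    proof (rule Lim_transform_eventually[OF lim[simplified complex_surj]], rule eventually_mono[OF ev])
      fix r :: real assume r: "0 < r \<and> r < 1"
      then have z: "norm (complex_of_real r * \<zeta>) < 1" using elim(3) by (simp add: norm_mult)
      have "integrable circle (\<lambda>\<eta>. g \<eta> * complex_of_real (?k r \<eta>))"
        by (rule circle_integrable_mult_of_real_Re_Hker[OF g z])
      then show "Complex (LINT \<eta>|circle. Re (g \<eta>) * ?k r \<eta>) (LINT \<eta>|circle. Im (g \<eta>) * ?k r \<eta>) =
        (LINT \<eta>|circle. g \<eta> * complex_of_real (?k r \<eta>))"
        by (intro complex_eqI) (simp_all flip: Bochner_Integration.integral_Re Bochner_Integration.integral_Im)
    qed
  qed
qed


section \<open>Fourier series on the circle\<close>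

lemma circle_integrable_mult_power:
  fixes f g :: "complex \<Rightarrow> complex"
  assumes f: "integrable circle f" and g: "g \<in> borel_measurable circle" "\<And>\<zeta>. norm \<zeta> = 1 \<Longrightarrow> norm (g \<zeta>) \<le> 1"
  shows "integrable circle (\<lambda>\<zeta>. f \<zeta> * g \<zeta> ^ n)"
  using g by (intro circle_integrable_mult_bounded[OF f, where B = 1] AE_I2) (auto simp: norm_power power_le_one)

text \<open>Termwise integration of a power series in \<open>g\<close>; the partial sums are
  dominated by \<bar>f\<bar> times the sum of the norms of \<open>a\<close>. It is applied with
  \<open>g\<close> the identity for Fourier coefficients of negative index and with \<open>g\<close>
  the conjugation for those of nonnegative index.\<close>

lemma circle_series_sums:
  fixes f g :: "complex \<Rightarrow> complex"
  assumes f: "integrable circle f" and g: "g \<in> borel_measurable circle" "\<And>\<zeta>. norm \<zeta> = 1 \<Longrightarrow> norm (g \<zeta>) \<le> 1"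
    and a: "summable (\<lambda>n. norm (a n))"
  shows "(\<lambda>n. a n * (LINT \<zeta>|circle. f \<zeta> * g \<zeta> ^ n)) sums (LINT \<zeta>|circle. f \<zeta> * (\<Sum>n. a n * g \<zeta> ^ n))"
proof -
  let ?h = "\<lambda>n \<zeta>. a n * (f \<zeta> * g \<zeta> ^ n)"
  have int: "integrable circle (?h n)" for n
    by (intro integrable_mult_right circle_integrable_mult_power f g)
  have bd: "norm (?h n \<zeta>) \<le> norm (a n) * norm (f \<zeta>)" if "norm \<zeta> = 1" for n \<zeta>
  proof -
    have "norm (g \<zeta>) ^ n \<le> 1" using g(2)[OF that] by (simp add: power_le_one)
    from mult_left_mono[OF this, of "norm (a n) * norm (f \<zeta>)"]
    show ?thesis by (simp add: norm_mult norm_power mult_ac)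
  qed
  have sm: "summable (\<lambda>n. norm (?h n \<zeta>))" if "norm \<zeta> = 1" for \<zeta>
    using bd[OF that] by (intro summable_comparison_test'[OF summable_mult2[OF a]]) simp
  have "(\<lambda>n. integral\<^sup>L circle (?h n)) sums (LINT \<zeta>|circle. (\<Sum>n. ?h n \<zeta>))"
  proof (rule sums_integral[OF int])
    show "AE \<zeta> in circle. summable (\<lambda>n. norm (?h n \<zeta>))" using sm by (intro AE_I2) simp
    show "summable (\<lambda>n. LINT \<zeta>|circle. norm (?h n \<zeta>))"
    proof (rule summable_comparison_test'[OF summable_mult2[OF a]])
      fix n
      have "(LINT \<zeta>|circle. norm (?h n \<zeta>)) \<le> (LINT \<zeta>|circle. norm (a n) * norm (f \<zeta>))"
      proof (rule integral_mono)
        show "integrable circle (\<lambda>\<zeta>. norm (?h n \<zeta>))" by (rule integrable_norm[OF int])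
        show "integrable circle (\<lambda>\<zeta>. norm (a n) * norm (f \<zeta>))" using f by simp
      qed (use bd in simp)
      then show "norm (LINT \<zeta>|circle. norm (?h n \<zeta>)) \<le> norm (a n) * (LINT \<zeta>|circle. norm (f \<zeta>))"
        by simp
    qed
  qed
  moreover have "(LINT \<zeta>|circle. (\<Sum>n. ?h n \<zeta>)) = (LINT \<zeta>|circle. f \<zeta> * (\<Sum>n. a n * g \<zeta> ^ n))"
  proof (rule Bochner_Integration.integral_cong[OF refl])
    fix \<zeta> assume "\<zeta> \<in> space circle"
    then have z: "norm \<zeta> = 1" by simp
    have "summable (\<lambda>n. norm (a n * g \<zeta> ^ n))"
    proof (rule summable_comparison_test'[OF a])
      fix n
      have "norm (g \<zeta>) ^ n \<le> 1" using g(2)[OF z] by (simp add: power_le_one)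
      from mult_left_mono[OF this, of "norm (a n)"]
      show "norm (norm (a n * g \<zeta> ^ n)) \<le> norm (a n)" by (simp add: norm_mult norm_power)
    qed
    then have "f \<zeta> * (\<Sum>n. a n * g \<zeta> ^ n) = (\<Sum>n. f \<zeta> * (a n * g \<zeta> ^ n))"
      by (rule suminf_mult[OF summable_norm_cancel, symmetric])
    moreover have "?h n \<zeta> = f \<zeta> * (a n * g \<zeta> ^ n)" for n by (rule mult.left_commute)
    ultimately show "(\<Sum>n. ?h n \<zeta>) = f \<zeta> * (\<Sum>n. a n * g \<zeta> ^ n)" by (simp only:)
  qed
  moreover have "integral\<^sup>L circle (?h n) = a n * (LINT \<zeta>|circle. f \<zeta> * g \<zeta> ^ n)" for n
    by (rule integral_mult_right_zero)
  ultimately show ?thesis by (simp only:)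
qed

lemma circle_moment:
  "(LINT \<zeta>|circle. \<zeta> ^ m * cnj \<zeta> ^ n) = (if m = n then 1 else 0)"
proof -
  define k where "k = real m - real n"
  have c: "cis t ^ m * cnj (cis t) ^ n = cis (k * t)" for t
  proof -
    have "cis t ^ m * cnj (cis t) ^ n = cis (real m * t + real n * (- t))"
      by (simp only: cis_cnj Complex.DeMoivre cis_mult)
    then show ?thesis by (simp add: k_def left_diff_distrib)
  qed
  have "(\<lambda>\<zeta>. \<zeta> ^ m * cnj \<zeta> ^ n) \<in> borel_measurable circle"
    by (intro continuous_measurable_circle continuous_intros)
  then have "(LINT \<zeta>|circle. \<zeta> ^ m * cnj \<zeta> ^ n) = (1 / (2 * pi)) *\<^sub>R (LINT t:{0..<2 * pi}|lborel. cis (k * t))"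
    by (subst circle_integral_eq) (simp_all add: c)
  also have "\<dots> = (if m = n then 1 else 0)"
  proof (cases "m = n")
    case True
    then have "(LINT t:{0..<2 * pi}|lborel. cis (k * t)) = (LINT t:{0..<2 * pi}|lborel. 1)"
      unfolding k_def by simp
    also have "\<dots> = complex_of_real (2 * pi)"
      by (simp add: set_lebesgue_integral_def scaleR_conv_of_real)
    finally show ?thesis using True by (simp add: scaleR_conv_of_real)
  next
    case False
    then have k: "k \<noteq> 0" unfolding k_def by simp
    let ?F = "\<lambda>z. exp (\<i> * complex_of_real k * z) / (\<i> * complex_of_real k)"
    have "(LBINT t=0..2 * pi. cis (k * t)) = ?F (complex_of_real (2 * pi)) - ?F (complex_of_real 0)"
      unfolding zero_ereal_def
    proof (rule interval_integral_FTC_finite)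
      show "continuous_on {min 0 (2 * pi)..max 0 (2 * pi)} (\<lambda>t. cis (k * t))"
        by (intro continuous_intros)
      fix t :: real
      have "(?F has_field_derivative cis (k * t)) (at (complex_of_real t))"
        using k by (auto intro!: derivative_eq_intros simp: cis_conv_exp mult_ac)
      then show "((\<lambda>t. ?F (complex_of_real t)) has_vector_derivative cis (k * t)) (at t within {min 0 (2 * pi)..max 0 (2 * pi)})"
        by (rule has_vector_derivative_real_field)
    qed
    moreover have "exp (\<i> * complex_of_real k * complex_of_real (2 * pi)) = 1"
    proof -
      have "cis (2 * pi * k) = 1" unfolding k_def by (intro cis_multiple_2pi) auto
      then show ?thesis by (simp add: cis_conv_exp mult_ac)
    qed
    ultimately have "(LBINT t=0..2 * pi. cis (k * t)) = 0" by simp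
    then have "(LINT t:{0..<2 * pi}|lborel. cis (k * t)) = 0"
      using interval_integral_Ico[of 0 "2 * pi" "\<lambda>t. cis (k * t)"] by (simp add: zero_ereal_def)
    then show ?thesis using False by simp
  qed
  finally show ?thesis .
qed

lemma Hker_sums:
  assumes "norm w < 1" shows "(\<lambda>n. (if n = 0 then 1 else 2) * w ^ n) sums Hker w"
proof -
  have "(\<lambda>n. 2 * w ^ n - (if n = 0 then 1 else 0)) sums (2 * (1 / (1 - w)) - 1)"
    by (intro sums_diff sums_mult geometric_sums assms) (use sums_single[of 0 "\<lambda>_. 1"] in simp)
  moreover have "2 * (1 / (1 - w)) - 1 = Hker w" 
  proof -
    have "1 - w \<noteq> 0" using assms by auto
    then show ?thesis unfolding Hker_def by (simp add: field_simps)
  qed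
  moreover have "(\<lambda>n. 2 * w ^ n - (if n = 0 then 1 else 0)) = (\<lambda>n. (if n = 0 then 1 else 2) * w ^ n)"
    by auto
  ultimately show ?thesis by simp
qed

section \<open>Bounded holomorphic functions on the disc\<close>

lemma eventually_at_left_1: "\<forall>\<^sub>F r in at_left (1::real). 0 < r \<and> r < 1"
  unfolding eventually_at_left_field by (intro exI[of _ 0]) auto

lemma Re_mult_cnj_self: "Re (a * cnj a) = (norm a)\<^sup>2"
  by (simp add: cmod_power2) (simp add: power2_eq_square)

lemma integrable_circle_continuous:
  "continuous_on (sphere 0 1) f \<Longrightarrow> integrable circle (f :: complex \<Rightarrow> complex)"
proof -
  assume c: "continuous_on (sphere 0 1) f"
  then have "bounded (f ` sphere 0 1)" by (intro compact_imp_bounded compact_continuous_image) auto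
  then obtain B where "\<forall>y\<in>f ` sphere 0 1. norm y \<le> B" unfolding bounded_iff by blast
  then show ?thesis
    by (intro circle.integrable_const_bound[where B = B] AE_I2 continuous_measurable_circle c) auto
qed

text \<open>The outer functions of the symbol need not be bounded, but their reciprocals and the
  quotients of two of them are. Radial limits, multiplication on \<open>H2\<close> and the action on
  reproducing kernels are developed here for bounded functions and then applied to those reciprocals
  and quotients.\<close>

locale bounded_holomorphic_disc =
  fixes \<Phi> :: "complex \<Rightarrow> complex" and C :: real
  assumes holo: "\<Phi> holomorphic_on ball 0 1"
    and bound: "\<And>z. norm z < 1 \<Longrightarrow> norm (\<Phi> z) \<le> C"
begin

abbreviation dil :: "real \<Rightarrow> complex \<Rightarrow> complex" where
  "dil r \<zeta> \<equiv> \<Phi> (complex_of_real r * \<zeta>)"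

definition coeff :: "nat \<Rightarrow> complex" where
  "coeff n = (deriv ^^ n) \<Phi> 0 / fact n"

lemma power_series: "norm z < 1 \<Longrightarrow> (\<lambda>n. coeff n * z ^ n) sums \<Phi> z"
  using holomorphic_power_series[OF holo, of z] by (simp add: coeff_def)

lemma summable_coeff:
  assumes "0 \<le> r" "r < 1" shows "summable (\<lambda>n. norm (coeff n * complex_of_real r ^ n))"
proof (rule powser_insidea)
  show "summable (\<lambda>n. coeff n * complex_of_real ((1 + r) / 2) ^ n)"
    using assms by (intro sums_summable[OF power_series]) (simp only: norm_of_real, simp)
  show "norm (complex_of_real r) < norm (complex_of_real ((1 + r) / 2))"
    using assms by (simp only: norm_of_real) simp
qed

lemma scaled_eq:
  assumes "0 \<le> r" "r < 1" "norm \<zeta> = 1"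
  shows "dil r \<zeta> = (\<Sum>n. (coeff n * complex_of_real r ^ n) * \<zeta> ^ n)"
  using power_series[of "complex_of_real r * \<zeta>"] assms
  by (simp add: norm_mult power_mult_distrib sums_iff mult.assoc)

lemma continuous_scaled:
  assumes "0 \<le> r" "r < 1" shows "continuous_on (sphere 0 1) (\<lambda>\<zeta>. dil r \<zeta>)"
  using assms by (intro continuous_on_compose2[OF holomorphic_on_imp_continuous_on[OF holo]] continuous_intros)
    (auto simp: norm_mult)

lemma integrable_scaled:
  assumes "0 \<le> r" "r < 1" shows "integrable circle (\<lambda>\<zeta>. dil r \<zeta>)"
proof (rule circle.integrable_const_bound[where B = C])
  show "AE \<zeta> in circle. norm (dil r \<zeta>) \<le> C"
    using assms by (intro AE_I2 bound) (simp add: norm_mult)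
qed (use continuous_measurable_circle[OF continuous_scaled[OF assms]] in simp)

lemma integral_scaled_mult:
  assumes r: "0 \<le> r" "r < 1" and f: "integrable circle f"
  shows "(\<lambda>n. coeff n * complex_of_real r ^ n * (LINT \<zeta>|circle. f \<zeta> * \<zeta> ^ n)) sums
    (LINT \<zeta>|circle. f \<zeta> * dil r \<zeta>)"
proof -
  have "(\<lambda>n. coeff n * complex_of_real r ^ n * (LINT \<zeta>|circle. f \<zeta> * \<zeta> ^ n)) sums
    (LINT \<zeta>|circle. f \<zeta> * (\<Sum>n. (coeff n * complex_of_real r ^ n) * \<zeta> ^ n))"
    by (intro circle_series_sums f summable_coeff r continuous_measurable_circle continuous_intros) simp
  also have "(LINT \<zeta>|circle. f \<zeta> * (\<Sum>n. (coeff n * complex_of_real r ^ n) * \<zeta> ^ n)) =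
      (LINT \<zeta>|circle. f \<zeta> * dil r \<zeta>)"
    using r by (intro Bochner_Integration.integral_cong) (simp_all add: scaled_eq)
  finally show ?thesis .
qed

lemma fourier_coeff:
  assumes r: "0 \<le> r" "r < 1"
  shows "(LINT \<zeta>|circle. dil r \<zeta> * cnj \<zeta> ^ k) = coeff k * complex_of_real r ^ k"
proof -
  have "integrable circle (\<lambda>\<zeta>. cnj \<zeta> ^ k)" by (intro integrable_circle_continuous continuous_intros)
  from integral_scaled_mult[OF r this]
  have "(\<lambda>n. coeff n * complex_of_real r ^ n * (if n = k then 1 else 0)) sums
    (LINT \<zeta>|circle. dil r \<zeta> * cnj \<zeta> ^ k)"
    by (simp add: circle_moment mult.commute[of "cnj _ ^ _"] mult.commute[of _ "\<Phi> _"])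
  moreover have "(\<lambda>n. coeff n * complex_of_real r ^ n * (if n = k then 1 else 0)) sums (coeff k * complex_of_real r ^ k)"
    using sums_single[of k "\<lambda>n. coeff n * complex_of_real r ^ n"] by (simp add: if_distrib cong: if_cong)
  ultimately show ?thesis by (rule sums_unique2)
qed

lemma fourier_coeff_neg:
  assumes r: "0 \<le> r" "r < 1"
  shows "(LINT \<zeta>|circle. dil r \<zeta> * \<zeta> ^ k) = (if k = 0 then coeff 0 else 0)"
proof -
  have "integrable circle (\<lambda>\<zeta>. \<zeta> ^ k)" by (intro integrable_circle_continuous continuous_intros)
  from integral_scaled_mult[OF r this]
  have "(\<lambda>n. coeff n * complex_of_real r ^ n * (LINT \<zeta>|circle. \<zeta> ^ (k + n) * cnj \<zeta> ^ 0)) sums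
    (LINT \<zeta>|circle. dil r \<zeta> * \<zeta> ^ k)"
    by (simp add: power_add mult.commute[of _ "\<Phi> _"])
  then have "(\<lambda>n. coeff n * complex_of_real r ^ n * (if k + n = 0 then 1 else 0)) sums
    (LINT \<zeta>|circle. dil r \<zeta> * \<zeta> ^ k)"
    unfolding circle_moment .
  moreover have "(\<lambda>n. coeff n * complex_of_real r ^ n * (if k + n = 0 then 1 else 0)) sums (if k = 0 then coeff 0 else 0)"
    using sums_single[of 0 "\<lambda>n. coeff n * complex_of_real r ^ n"] by (cases "k = 0") (simp_all add: if_distrib cong: if_cong)
  ultimately show ?thesis by (rule sums_unique2)
qed

text \<open>The squared L2 norm of the dilation by r is \<open>energy (r * r)\<close>. As a function
  of the product of two radii it also gives the inner product of two different dilations, so the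
  norm of a difference is expressed by three values of one increasing function.\<close>

definition energy :: "real \<Rightarrow> real" where
  "energy x = (\<Sum>n. (norm (coeff n))\<^sup>2 * x ^ n)"

lemma energy_sums:
  assumes r: "0 \<le> r" "r < 1" and s: "0 \<le> s" "s < 1"
  shows "summable (\<lambda>n. (norm (coeff n))\<^sup>2 * (r * s) ^ n)"
    and "(LINT \<zeta>|circle. dil r \<zeta> * cnj (dil s \<zeta>)) = complex_of_real (energy (r * s))"
proof -
  have "integrable circle (\<lambda>\<zeta>. cnj (dil s \<zeta>))" using integrable_scaled[OF s] by simp
  from integral_scaled_mult[OF r this]
  have 1: "(\<lambda>n. coeff n * complex_of_real r ^ n * (LINT \<zeta>|circle. cnj (dil s \<zeta>) * \<zeta> ^ n)) sums
    (LINT \<zeta>|circle. dil r \<zeta> * cnj (dil s \<zeta>))"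
    by (simp add: mult.commute[of _ "\<Phi> _"])
  have 2: "(LINT \<zeta>|circle. cnj (dil s \<zeta>) * \<zeta> ^ n) = cnj (coeff n * complex_of_real s ^ n)" for n
  proof -
    have "(LINT \<zeta>|circle. cnj (dil s \<zeta>) * \<zeta> ^ n) =
      (LINT \<zeta>|circle. cnj (dil s \<zeta> * cnj \<zeta> ^ n))" by simp
    also have "\<dots> = cnj (LINT \<zeta>|circle. dil s \<zeta> * cnj \<zeta> ^ n)"
      by (rule Bochner_Integration.integral_cnj)
    finally show ?thesis unfolding fourier_coeff[OF s] .
  qed
  have 3: "coeff n * complex_of_real r ^ n * cnj (coeff n * complex_of_real s ^ n) =
      complex_of_real ((norm (coeff n))\<^sup>2 * (r * s) ^ n)" for n
  proof -
    have "coeff n * complex_of_real r ^ n * cnj (coeff n * complex_of_real s ^ n) =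
      (coeff n * cnj (coeff n)) * complex_of_real (r * s) ^ n"
      by (simp add: power_mult_distrib)
    then show ?thesis by (simp add: complex_norm_square[symmetric])
  qed
  have 4: "(\<lambda>n. complex_of_real ((norm (coeff n))\<^sup>2 * (r * s) ^ n)) sums
    (LINT \<zeta>|circle. dil r \<zeta> * cnj (dil s \<zeta>))"
    using 1 unfolding 2 3 .
  from sums_Re[OF this] show sm: "summable (\<lambda>n. (norm (coeff n))\<^sup>2 * (r * s) ^ n)" by (simp add: sums_iff)
  show "(LINT \<zeta>|circle. dil r \<zeta> * cnj (dil s \<zeta>)) = complex_of_real (energy (r * s))"
    unfolding energy_def using 4 sums_of_real[OF summable_sums[OF sm], where 'a = complex] by (rule sums_unique2)
qed

lemma integrable_scaled_prod:
  assumes r: "0 \<le> r" "r < 1" and s: "0 \<le> s" "s < 1"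
  shows "integrable circle (\<lambda>\<zeta>. dil r \<zeta> * cnj (dil s \<zeta>))"
  by (intro integrable_circle_continuous continuous_intros continuous_scaled r s)

lemma integral_norm_square_scaled:
  assumes r: "0 \<le> r" "r < 1"
  shows "(LINT \<zeta>|circle. (norm (dil r \<zeta>))\<^sup>2) = energy (r * r)"
proof -
  have "(LINT \<zeta>|circle. Re (dil r \<zeta> * cnj (dil r \<zeta>))) = energy (r * r)"
    using Bochner_Integration.integral_Re[OF integrable_scaled_prod[OF r r]] energy_sums(2)[OF r r] by simp
  then show ?thesis unfolding Re_mult_cnj_self .
qed

lemma integral_norm_square_diff:
  assumes r: "0 \<le> r" "r < 1" and s: "0 \<le> s" "s < 1"
  shows "(LINT \<zeta>|circle. (norm (dil r \<zeta> - dil s \<zeta>))\<^sup>2) =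
    energy (r * r) + energy (s * s) - 2 * energy (r * s)"
proof -
  let ?a = "\<lambda>\<zeta>. dil r \<zeta>" and ?b = "\<lambda>\<zeta>. dil s \<zeta>"
  have e: "(norm (a - b))\<^sup>2 = (norm a)\<^sup>2 + (norm b)\<^sup>2 - 2 * Re (a * cnj b)" for a b :: complex
    by (simp add: cmod_power2) (simp add: power2_eq_square algebra_simps)
  have i1: "integrable circle (\<lambda>\<zeta>. (norm (?a \<zeta>))\<^sup>2)" and i2: "integrable circle (\<lambda>\<zeta>. (norm (?b \<zeta>))\<^sup>2)"
    using integrable_Re[OF integrable_scaled_prod[OF r r]] integrable_Re[OF integrable_scaled_prod[OF s s]]
    unfolding Re_mult_cnj_self .
  have i3: "integrable circle (\<lambda>\<zeta>. Re (?a \<zeta> * cnj (?b \<zeta>)))"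
    by (rule integrable_Re[OF integrable_scaled_prod[OF r s]])
  have "(LINT \<zeta>|circle. Re (?a \<zeta> * cnj (?b \<zeta>))) = energy (r * s)"
    using Bochner_Integration.integral_Re[OF integrable_scaled_prod[OF r s]] energy_sums(2)[OF r s] by simp
  moreover have "(LINT \<zeta>|circle. (norm (?a \<zeta> - ?b \<zeta>))\<^sup>2) =
      (LINT \<zeta>|circle. (norm (?a \<zeta>))\<^sup>2 + (norm (?b \<zeta>))\<^sup>2) - (LINT \<zeta>|circle. 2 * Re (?a \<zeta> * cnj (?b \<zeta>)))"
    unfolding e by (intro Bochner_Integration.integral_diff Bochner_Integration.integrable_add
        integrable_mult_right i1 i2 i3)
  moreover have "(LINT \<zeta>|circle. (norm (?a \<zeta>))\<^sup>2 + (norm (?b \<zeta>))\<^sup>2) = energy (r * r) + energy (s * s)"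
    using Bochner_Integration.integral_add[OF i1 i2] integral_norm_square_scaled[OF r] integral_norm_square_scaled[OF s]
    by (simp only:)
  ultimately show ?thesis by (simp only: integral_mult_right_zero)
qed

lemma energy_mono:
  assumes "0 \<le> x" "x \<le> y" "y < 1" shows "energy x \<le> energy y"
  unfolding energy_def
proof (rule suminf_le)
  show "summable (\<lambda>n. (norm (coeff n))\<^sup>2 * x ^ n)" "summable (\<lambda>n. (norm (coeff n))\<^sup>2 * y ^ n)"
    using energy_sums(1)[of "sqrt x" "sqrt x"] energy_sums(1)[of "sqrt y" "sqrt y"] assms by auto
  show "(norm (coeff n))\<^sup>2 * x ^ n \<le> (norm (coeff n))\<^sup>2 * y ^ n" for n
    using assms by (intro mult_left_mono power_mono) auto
qed

lemma energy_bound: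
  assumes "0 \<le> x" "x < 1" shows "energy x \<le> C\<^sup>2"
proof -
  have r: "0 \<le> sqrt x" "sqrt x < 1" using assms by auto
  have "energy x = (LINT \<zeta>|circle. (norm (dil (sqrt x) \<zeta>))\<^sup>2)"
    using integral_norm_square_scaled[OF r] assms by simp
  also have "\<dots> \<le> (LINT \<zeta>|circle. C\<^sup>2)"
  proof (rule integral_mono_AE)
    show "integrable circle (\<lambda>\<zeta>. (norm (dil (sqrt x) \<zeta>))\<^sup>2)"
      using integrable_Re[OF integrable_scaled_prod[OF r r]] unfolding Re_mult_cnj_self .
    show "AE \<zeta> in circle. (norm (dil (sqrt x) \<zeta>))\<^sup>2 \<le> C\<^sup>2"
      using r by (intro AE_I2 power_mono bound) (auto simp: norm_mult)
  qed simp
  also have "\<dots> = C\<^sup>2" using circle.prob_space by simp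
  finally show ?thesis .
qed

text \<open>Dilations are Cauchy in \<open>L\<^sup>2\<close> since \<^const>\<open>energy\<close> is increasing and bounded; a subsequence with
  rapidly decreasing increments converges almost everywhere.\<close>

lemma fast_Cauchy_radii:
  obtains \<rho> :: "nat \<Rightarrow> real" where "\<And>k. 0 \<le> \<rho> k" "\<And>k. \<rho> k < 1" "\<rho> \<longlonglongrightarrow> 1"
    "\<And>k. (LINT \<zeta>|circle. (norm (dil (\<rho> (Suc k)) \<zeta> - dil (\<rho> k) \<zeta>))\<^sup>2) \<le> (1 / 4) ^ k"
proof -
  define S where "S = Sup (energy ` {0..<1})"
  have bdd: "bdd_above (energy ` {0..<1})" by (rule bdd_aboveI[of _ "C\<^sup>2"]) (auto intro: energy_bound)
  have up: "energy x \<le> S" if "0 \<le> x" "x < 1" for x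
    unfolding S_def using that bdd by (intro cSup_upper) auto
  have "\<exists>r. 0 \<le> r \<and> r < 1 \<and> 1 - 1 / real (Suc k) \<le> r \<and> S - (1 / 4) ^ k / 2 \<le> energy (r * r)" for k
  proof -
    have "S - (1 / 4) ^ k / 2 < S" by simp
    then obtain x where x: "0 \<le> x" "x < 1" "S - (1 / 4) ^ k / 2 < energy x"
      unfolding S_def using less_cSupD[of "energy ` {0..<1}"] by fastforce
    define r where "r = max (sqrt x) (1 - 1 / real (Suc k))"
    have r: "0 \<le> r" "r < 1" "sqrt x \<le> r" "1 - 1 / real (Suc k) \<le> r"
      unfolding r_def using x by (auto simp: le_max_iff_disj)
    have "x \<le> r * r" using mult_mono[OF r(3) r(3)] r x by simp
    moreover have "r * r < 1" using r mult_strict_mono[of r 1 r 1] by simp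
    ultimately have "energy x \<le> energy (r * r)" using x by (intro energy_mono)
    then show ?thesis using x r by (intro exI[of _ r]) auto
  qed
  then obtain \<rho> where \<rho>: "\<And>k. 0 \<le> \<rho> k" "\<And>k. \<rho> k < 1" "\<And>k. 1 - 1 / real (Suc k) \<le> \<rho> k"
    "\<And>k. S - (1 / 4) ^ k / 2 \<le> energy (\<rho> k * \<rho> k)" by metis
  have sq: "0 \<le> a * b \<and> a * b < 1" if "0 \<le> a" "a < 1" "0 \<le> b" "b < 1" for a b :: real
    using that mult_strict_mono[of a 1 b 1] by simp
  show ?thesis
  proof (rule that[of \<rho>])
    show "\<rho> \<longlonglongrightarrow> 1"
    proof (rule tendsto_sandwich[of "\<lambda>k. 1 - 1 / real (Suc k)" _ _ "\<lambda>_. 1"])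
      show "(\<lambda>k. 1 - 1 / real (Suc k)) \<longlonglongrightarrow> 1" by real_asymp
    qed (use \<rho> in \<open>auto intro!: always_eventually less_imp_le\<close>)
    fix k
    \<comment> \<open>The radii need not increase with k. The mixed term is at least the energy of
      the smaller radius, hence at least S - (1/4)^k / 2, and the squared norm of the difference is
      at most 2 S - 2 (S - (1/4)^k / 2) = (1/4)^k.\<close>
    define m where "m = min (\<rho> k) (\<rho> (Suc k))"
    have m: "0 \<le> m" "m < 1" unfolding m_def using \<rho> by (auto simp: min_less_iff_disj)
    have "m * m \<le> \<rho> (Suc k) * \<rho> k" unfolding m_def using \<rho>(1) by (intro mult_mono) auto
    then have 1: "energy (m * m) \<le> energy (\<rho> (Suc k) * \<rho> k)"
      using sq \<rho> m by (intro energy_mono) auto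
    have "(1 / 4 :: real) ^ Suc k \<le> (1 / 4) ^ k" by simp
    then have 2: "S - (1 / 4) ^ k / 2 \<le> energy (m * m)"
    proof (cases "\<rho> k \<le> \<rho> (Suc k)")
      case True
      then show ?thesis using \<rho>(4)[of k] by (simp add: m_def min_def)
    next
      case False
      then have "m = \<rho> (Suc k)" by (simp add: m_def min_def)
      then show ?thesis using \<rho>(4)[of "Suc k"] \<open>(1 / 4 :: real) ^ Suc k \<le> (1 / 4) ^ k\<close> by (simp only:)
    qed
    have "energy (\<rho> (Suc k) * \<rho> (Suc k)) \<le> S" "energy (\<rho> k * \<rho> k) \<le> S" using up sq \<rho> by blast+
    with 1 2 show "(LINT \<zeta>|circle. (norm (dil (\<rho> (Suc k)) \<zeta> - dil (\<rho> k) \<zeta>))\<^sup>2) \<le> (1 / 4) ^ k"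
      unfolding integral_norm_square_diff[OF \<rho>(1,2) \<rho>(1,2)] by linarith
  qed (use \<rho> in auto)
qed

lemma AE_convergent_subsequence:
  obtains \<rho> :: "nat \<Rightarrow> real" where "\<And>k. 0 \<le> \<rho> k" "\<And>k. \<rho> k < 1" "\<rho> \<longlonglongrightarrow> 1"
    "AE \<zeta> in circle. convergent (\<lambda>k. dil (\<rho> k) \<zeta>)"
proof -
  obtain \<rho> :: "nat \<Rightarrow> real" where \<rho>: "\<And>k. 0 \<le> \<rho> k" "\<And>k. \<rho> k < 1" "\<rho> \<longlonglongrightarrow> 1"
    and q: "\<And>k. (LINT \<zeta>|circle. (norm (dil (\<rho> (Suc k)) \<zeta> - dil (\<rho> k) \<zeta>))\<^sup>2) \<le> (1 / 4) ^ k"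
    using fast_Cauchy_radii by blast
  define d where "d k \<zeta> = dil (\<rho> (Suc k)) \<zeta> - dil (\<rho> k) \<zeta>" for k \<zeta>
  have dc: "continuous_on (sphere 0 1) (d k)" for k
    unfolding d_def by (intro continuous_intros continuous_scaled \<rho>)
  have dm: "d k \<in> borel_measurable circle" for k by (rule continuous_measurable_circle[OF dc])
  have di: "integrable circle (d k)" for k by (rule integrable_circle_continuous[OF dc])
  have di2: "integrable circle (\<lambda>\<zeta>. (norm (d k \<zeta>))\<^sup>2)" for k
  proof -
    have "integrable circle (\<lambda>\<zeta>. d k \<zeta> * cnj (d k \<zeta>))"
      by (intro integrable_circle_continuous continuous_intros dc)
    from integrable_Re[OF this] show ?thesis unfolding Re_mult_cnj_self .
  qed
  have l1: "(LINT \<zeta>|circle. norm (d k \<zeta>)) \<le> (1 / 2) ^ k" for k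
  proof -
    \<comment> \<open>The square of e is the bound on the squared L2 norm of \<open>d k\<close>.
      Integrating 2 e t \<le> t^2 + e^2 at t = norm of \<open>d k\<close> replaces the
      Cauchy-Schwarz inequality and bounds the L1 norm by e, which is summable.\<close>
    define e :: real where "e = (1 / 2) ^ k"
    have e: "e > 0" unfolding e_def by simp
    have "norm (d k \<zeta>) \<le> (1 / (2 * e)) * (norm (d k \<zeta>))\<^sup>2 + e / 2" for \<zeta>
    proof -
      have "0 \<le> (norm (d k \<zeta>) - e)\<^sup>2" by simp
      then have "2 * e * norm (d k \<zeta>) \<le> (norm (d k \<zeta>))\<^sup>2 + e\<^sup>2" by (simp add: power2_eq_square algebra_simps)
      then show ?thesis using e by (simp add: field_simps power2_eq_square)
    qed
    then have "(LINT \<zeta>|circle. norm (d k \<zeta>)) \<le> (LINT \<zeta>|circle. (1 / (2 * e)) * (norm (d k \<zeta>))\<^sup>2 + e / 2)"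
      using di di2 by (intro integral_mono) auto
    also have "\<dots> = (1 / (2 * e)) * (LINT \<zeta>|circle. (norm (d k \<zeta>))\<^sup>2) + e / 2"
      using di2 circle.prob_space by (subst Bochner_Integration.integral_add) auto
    also have "\<dots> \<le> (1 / (2 * e)) * e\<^sup>2 + e / 2"
      using q[of k] e unfolding d_def e_def
      by (intro add_right_mono mult_left_mono) (auto simp: power2_eq_square power_mult_distrib[symmetric])
    also have "\<dots> = e" using e by (simp add: power2_eq_square)
    finally show ?thesis unfolding e_def .
  qed
  have "(\<integral>\<^sup>+\<zeta>. (\<Sum>k. ennreal (norm (d k \<zeta>))) \<partial>circle) = (\<Sum>k. \<integral>\<^sup>+\<zeta>. ennreal (norm (d k \<zeta>)) \<partial>circle)"
    using dm by (intro nn_integral_suminf) auto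
  also have "\<dots> = (\<Sum>k. ennreal (LINT \<zeta>|circle. norm (d k \<zeta>)))"
    using di by (intro suminf_cong nn_integral_eq_integral) auto
  also have "\<dots> \<le> (\<Sum>k. ennreal ((1 / 2) ^ k))"
    using l1 by (intro suminf_le ennreal_leI) auto
  also have "\<dots> = ennreal (\<Sum>k. (1 / 2) ^ k)" by (intro suminf_ennreal2 summable_geometric) auto
  also have "\<dots> < \<infinity>" by simp
  finally have "AE \<zeta> in circle. (\<Sum>k. ennreal (norm (d k \<zeta>))) \<noteq> \<infinity>"
    using dm by (intro nn_integral_PInf_AE) auto
  then have "AE \<zeta> in circle. convergent (\<lambda>k. dil (\<rho> k) \<zeta>)"
  proof eventually_elim
    case (elim \<zeta>)
    then have "summable (\<lambda>k. norm (d k \<zeta>))" by (intro summable_suminf_not_top) auto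
    then have "summable (\<lambda>k. d k \<zeta>)" by (rule summable_norm_cancel)
    then have "convergent (\<lambda>n. \<Sum>k<n. d k \<zeta>)" unfolding summable_iff_convergent .
    moreover have "(\<Sum>k<n. d k \<zeta>) = dil (\<rho> n) \<zeta> - dil (\<rho> 0) \<zeta>" for n
      unfolding d_def by (rule sum_lessThan_telescope)
    ultimately have "convergent (\<lambda>n. (dil (\<rho> n) \<zeta> - dil (\<rho> 0) \<zeta>) + dil (\<rho> 0) \<zeta>)"
      by (intro convergent_add convergent_const) simp
    then show ?case by simp
  qed
  with \<rho> show ?thesis by (rule that)
qed

text \<open>The real part of the Herglotz kernel is half the sum of the kernel and its conjugate.
  The dilation is an absolutely convergent power series on the circle, so its pairing with the
  kernel gives 2 \<Phi>(r z) - \<Phi>(0), and its pairing with the conjugate gives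
  \<Phi>(0).\<close>

lemma poisson_scaled:
  assumes r: "0 \<le> r" "r < 1" and z: "norm z < 1"
  shows "dil r z =
    (LINT \<zeta>|circle. dil r \<zeta> * complex_of_real (Re (Hker (z * cnj \<zeta>))))"
proof -
  let ?a = "\<lambda>\<zeta>. dil r \<zeta>"
  define h where "h n = (if n = 0 then 1 else 2 :: complex)" for n :: nat
  have sm: "summable (\<lambda>n. norm (h n * w ^ n))" if "norm w < 1" for w
  proof (rule summable_comparison_test')
    show "summable (\<lambda>n. 2 * norm w ^ n)" using that by (intro summable_mult summable_geometric) simp
    show "norm (norm (h n * w ^ n)) \<le> 2 * norm w ^ n" for n
      unfolding h_def by (simp add: norm_mult norm_power)
  qed
  have Hs: "Hker w = (\<Sum>n. h n * w ^ n)" if "norm w < 1" for w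
    using Hker_sums[OF that] unfolding h_def by (rule sums_unique)
  have nz: "norm (z * cnj \<zeta>) < 1" if "norm \<zeta> = 1" for \<zeta> using norm_mult_cnj_circle[OF that] z by simp
  have "(\<lambda>n. h n * z ^ n * (LINT \<zeta>|circle. ?a \<zeta> * cnj \<zeta> ^ n)) sums (LINT \<zeta>|circle. ?a \<zeta> * (\<Sum>n. h n * z ^ n * cnj \<zeta> ^ n))"
    by (intro circle_series_sums integrable_scaled r sm z continuous_measurable_circle continuous_intros) simp
  also have "(LINT \<zeta>|circle. ?a \<zeta> * (\<Sum>n. h n * z ^ n * cnj \<zeta> ^ n)) = (LINT \<zeta>|circle. ?a \<zeta> * Hker (z * cnj \<zeta>))"
    using nz by (intro Bochner_Integration.integral_cong) (simp_all add: Hs power_mult_distrib mult.assoc)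
  finally have 1: "(\<lambda>n. h n * z ^ n * (coeff n * complex_of_real r ^ n)) sums (LINT \<zeta>|circle. ?a \<zeta> * Hker (z * cnj \<zeta>))"
    unfolding fourier_coeff[OF r] .
  have rz: "norm (complex_of_real r * z) < 1"
  proof -
    have "r * norm z \<le> 1 * norm z" using r by (intro mult_right_mono) auto
    then show ?thesis using r z by (simp add: norm_mult)
  qed
  have "(\<lambda>n. 2 * (coeff n * (complex_of_real r * z) ^ n) - (if n = 0 then coeff n else 0)) sums (2 * dil r z - coeff 0)"
    by (intro sums_diff sums_mult power_series rz sums_single)
  moreover have "2 * (coeff n * (complex_of_real r * z) ^ n) - (if n = 0 then coeff n else 0) = h n * z ^ n * (coeff n * complex_of_real r ^ n)" for n
    unfolding h_def by (simp add: power_mult_distrib)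
  ultimately have I1: "(LINT \<zeta>|circle. ?a \<zeta> * Hker (z * cnj \<zeta>)) = 2 * dil r z - coeff 0"
    using 1 by (metis (no_types, lifting) sums_cong sums_unique2)
  have "(\<lambda>n. h n * cnj z ^ n * (LINT \<zeta>|circle. ?a \<zeta> * \<zeta> ^ n)) sums (LINT \<zeta>|circle. ?a \<zeta> * (\<Sum>n. h n * cnj z ^ n * \<zeta> ^ n))"
    using z by (intro circle_series_sums integrable_scaled r sm continuous_measurable_circle continuous_intros) simp_all
  also have "(LINT \<zeta>|circle. ?a \<zeta> * (\<Sum>n. h n * cnj z ^ n * \<zeta> ^ n)) = (LINT \<zeta>|circle. ?a \<zeta> * cnj (Hker (z * cnj \<zeta>)))"
  proof (rule Bochner_Integration.integral_cong[OF refl])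
    fix \<zeta> assume "\<zeta> \<in> space circle"
    then have "norm \<zeta> = 1" by simp
    then have "cnj (Hker (z * cnj \<zeta>)) = Hker (cnj z * \<zeta>)" "norm (cnj z * \<zeta>) < 1"
      using z by (simp_all add: Hker_def norm_mult)
    then show "?a \<zeta> * (\<Sum>n. h n * cnj z ^ n * \<zeta> ^ n) = ?a \<zeta> * cnj (Hker (z * cnj \<zeta>))"
      by (simp add: Hs power_mult_distrib mult.assoc)
  qed
  finally have "(\<lambda>n. h n * cnj z ^ n * (if n = 0 then coeff 0 else 0)) sums (LINT \<zeta>|circle. ?a \<zeta> * cnj (Hker (z * cnj \<zeta>)))"
    unfolding fourier_coeff_neg[OF r] .
  moreover have "(\<lambda>n. h n * cnj z ^ n * (if n = 0 then coeff 0 else 0)) = (\<lambda>n. if n = 0 then coeff n else 0)"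
    by (auto simp: h_def)
  ultimately have I2: "(LINT \<zeta>|circle. ?a \<zeta> * cnj (Hker (z * cnj \<zeta>))) = coeff 0"
    using sums_unique2[OF _ sums_single[of 0 coeff]] by simp
  have i1: "integrable circle (\<lambda>\<zeta>. ?a \<zeta> * Hker (z * cnj \<zeta>))"
    by (intro circle_integrable_mult_Hker integrable_scaled r z)
  have i2: "integrable circle (\<lambda>\<zeta>. ?a \<zeta> * cnj (Hker (z * cnj \<zeta>)))"
    by (intro integrable_circle_continuous continuous_intros continuous_scaled r continuous_on_Hker_circle z)
  have "(LINT \<zeta>|circle. ?a \<zeta> * complex_of_real (Re (Hker (z * cnj \<zeta>)))) =
    (LINT \<zeta>|circle. (1 / 2) * (?a \<zeta> * Hker (z * cnj \<zeta>) + ?a \<zeta> * cnj (Hker (z * cnj \<zeta>))))"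
  proof (rule Bochner_Integration.integral_cong[OF refl])
    fix \<zeta>
    have "complex_of_real (Re (Hker (z * cnj \<zeta>))) = (1 / 2) * (Hker (z * cnj \<zeta>) + cnj (Hker (z * cnj \<zeta>)))"
      by (simp add: complex_add_cnj)
    then show "?a \<zeta> * complex_of_real (Re (Hker (z * cnj \<zeta>))) = (1 / 2) * (?a \<zeta> * Hker (z * cnj \<zeta>) + ?a \<zeta> * cnj (Hker (z * cnj \<zeta>)))"
      by (simp only: distrib_left mult.left_commute)
  qed
  also have "\<dots> = (1 / 2) * ((LINT \<zeta>|circle. ?a \<zeta> * Hker (z * cnj \<zeta>)) + (LINT \<zeta>|circle. ?a \<zeta> * cnj (Hker (z * cnj \<zeta>))))"
    by (simp only: integral_mult_right_zero Bochner_Integration.integral_add[OF i1 i2])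
  also have "\<dots> = dil r z" unfolding I1 I2 by simp
  finally show ?thesis by simp
qed

text \<open>The almost everywhere limit along the subsequence of radii is a bounded function whose
  Poisson integral is \<Phi>, by dominated convergence in \<open>poisson_scaled\<close>. Radial
  limits of Poisson integrals then give convergence along all radii.\<close>

theorem radial_limits:
  "AE \<zeta> in circle. \<exists>l. norm l \<le> C \<and> ((\<lambda>r. dil r \<zeta>) \<longlongrightarrow> l) (at_left 1)"
proof -
  obtain \<rho> :: "nat \<Rightarrow> real" where \<rho>: "\<And>k. 0 \<le> \<rho> k" "\<And>k. \<rho> k < 1" "\<rho> \<longlonglongrightarrow> 1"
    and conv: "AE \<zeta> in circle. convergent (\<lambda>k. dil (\<rho> k) \<zeta>)"
    using AE_convergent_subsequence by blast
  define \<phi> where "\<phi> \<zeta> = lim (\<lambda>k. dil (\<rho> k) \<zeta>)" for \<zeta>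
  have \<phi>m: "\<phi> \<in> borel_measurable circle"
    unfolding \<phi>_def by (intro borel_measurable_lim_metric continuous_measurable_circle continuous_scaled \<rho>)
  have lim: "AE \<zeta> in circle. (\<lambda>k. dil (\<rho> k) \<zeta>) \<longlonglongrightarrow> \<phi> \<zeta>"
    using conv unfolding \<phi>_def convergent_LIMSEQ_iff .
  have bd: "norm (dil (\<rho> k) \<zeta>) \<le> C" if "norm \<zeta> = 1" for k \<zeta>
    using \<rho>(1,2)[of k] that by (intro bound) (simp add: norm_mult)
  have "AE \<zeta> in circle. \<zeta> \<in> space circle" by (rule AE_space)
  with lim have \<phi>b: "AE \<zeta> in circle. norm (\<phi> \<zeta>) \<le> C"
  proof eventually_elim
    case (elim \<zeta>)
    show ?case by (rule LIMSEQ_le_const2[OF tendsto_norm[OF elim(1)]]) (use bd elim(2) in auto)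
  qed
  have \<phi>i: "integrable circle \<phi>" by (rule circle.integrable_const_bound[OF \<phi>b \<phi>m])
  have rep: "\<Phi> z = (LINT \<zeta>|circle. \<phi> \<zeta> * complex_of_real (Re (Hker (z * cnj \<zeta>))))" if z: "norm z < 1" for z
  proof (rule LIMSEQ_unique)
    have "(\<lambda>k. complex_of_real (\<rho> k) * z) \<longlonglongrightarrow> complex_of_real 1 * z" by (intro tendsto_intros \<rho>)
    then have "(\<lambda>k. complex_of_real (\<rho> k) * z) \<longlonglongrightarrow> z" by simp
    then show "(\<lambda>k. dil (\<rho> k) z) \<longlonglongrightarrow> \<Phi> z"
      using z by (intro isCont_tendsto_compose[of z \<Phi>])
        (auto intro!: continuous_on_interior[OF holomorphic_on_imp_continuous_on[OF holo]])
    have "(\<lambda>k. LINT \<zeta>|circle. dil (\<rho> k) \<zeta> * complex_of_real (Re (Hker (z * cnj \<zeta>)))) \<longlonglongrightarrow>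
      (LINT \<zeta>|circle. \<phi> \<zeta> * complex_of_real (Re (Hker (z * cnj \<zeta>))))"
    proof (rule integral_dominated_convergence[where w = "\<lambda>\<zeta>. C * norm (complex_of_real (Re (Hker (z * cnj \<zeta>))))"])
      have Hc: "continuous_on (sphere 0 1) (\<lambda>\<zeta>. complex_of_real (Re (Hker (z * cnj \<zeta>))))"
        by (intro continuous_intros continuous_on_Hker_circle z)
      show "(\<lambda>\<zeta>. \<phi> \<zeta> * complex_of_real (Re (Hker (z * cnj \<zeta>)))) \<in> borel_measurable circle"
        by (intro borel_measurable_times \<phi>m continuous_measurable_circle Hc)
      show "(\<lambda>\<zeta>. dil (\<rho> k) \<zeta> * complex_of_real (Re (Hker (z * cnj \<zeta>)))) \<in> borel_measurable circle" for k
        by (intro borel_measurable_times continuous_measurable_circle Hc continuous_scaled \<rho>)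
      show "integrable circle (\<lambda>\<zeta>. C * norm (complex_of_real (Re (Hker (z * cnj \<zeta>)))))"
        by (intro integrable_mult_right integrable_norm integrable_circle_continuous Hc)
      show "AE \<zeta> in circle. (\<lambda>k. dil (\<rho> k) \<zeta> * complex_of_real (Re (Hker (z * cnj \<zeta>)))) \<longlonglongrightarrow>
          \<phi> \<zeta> * complex_of_real (Re (Hker (z * cnj \<zeta>)))"
        using lim by eventually_elim (intro tendsto_intros)
      show "AE \<zeta> in circle. norm (dil (\<rho> k) \<zeta> * complex_of_real (Re (Hker (z * cnj \<zeta>)))) \<le>
          C * norm (complex_of_real (Re (Hker (z * cnj \<zeta>))))" for k
        unfolding norm_mult using bd by (intro AE_I2 mult_right_mono) auto
    qed
    then show "(\<lambda>k. dil (\<rho> k) z) \<longlonglongrightarrow> (LINT \<zeta>|circle. \<phi> \<zeta> * complex_of_real (Re (Hker (z * cnj \<zeta>))))"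
      unfolding poisson_scaled[OF \<rho>(1,2) z, symmetric] .
  qed
  have "AE \<zeta> in circle. \<zeta> \<in> space circle" by (rule AE_space)
  with \<phi>b poisson_integral_radial_limit[OF \<phi>i] show ?thesis
  proof eventually_elim
    case (elim \<zeta>)
    have "((\<lambda>r. dil r \<zeta>) \<longlongrightarrow> \<phi> \<zeta>) (at_left 1)"
    proof (rule Lim_transform_eventually[OF elim(2)], rule eventually_mono[OF eventually_at_left_1])
      fix r :: real assume "0 < r \<and> r < 1"
      then show "(LINT \<eta>|circle. \<phi> \<eta> * complex_of_real (Re (Hker (complex_of_real r * \<zeta> * cnj \<eta>)))) = dil r \<zeta>"
        using elim(3) by (intro rep[symmetric]) (simp add: norm_mult)
    qed
    then show ?case using elim(1) by auto
  qed
qed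

end

text \<open>The Cauchy criterion with all quantifiers countable: accuracies and thresholds are
  indexed by natural numbers and radii are rational. In this form the set of boundary points with a
  radial limit is measurable.\<close>

lemma radial_limit_exists_iff:
  fixes \<Phi> :: "complex \<Rightarrow> complex"
  assumes cont: "continuous_on (ball 0 1) \<Phi>" and \<zeta>: "norm \<zeta> = 1"
  shows "(\<exists>l. ((\<lambda>r. \<Phi> (complex_of_real r * \<zeta>)) \<longlongrightarrow> l) (at_left 1)) \<longleftrightarrow>
    (\<forall>k::nat. \<exists>n::nat. \<forall>p q::rat. max 0 (1 - 1 / real (Suc n)) < of_rat p \<and> of_rat p < (1::real) \<and>
       max 0 (1 - 1 / real (Suc n)) < of_rat q \<and> of_rat q < (1::real) \<longrightarrow>
       dist (\<Phi> (complex_of_real (of_rat p) * \<zeta>)) (\<Phi> (complex_of_real (of_rat q) * \<zeta>)) \<le> 1 / real (Suc k))"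
    (is "?L \<longleftrightarrow> ?R")
proof
  define f where "f r = \<Phi> (complex_of_real r * \<zeta>)" for r
  assume ?L
  then obtain l where l: "(f \<longlongrightarrow> l) (at_left 1)" unfolding f_def by blast
  show ?R
  proof
    fix k :: nat
    have "\<forall>\<^sub>F r in at_left 1. dist (f r) l < 1 / (2 * real (Suc k))" by (intro tendstoD[OF l]) simp
    then obtain b where b: "b < 1" "\<And>r. b < r \<Longrightarrow> r < 1 \<Longrightarrow> dist (f r) l < 1 / (2 * real (Suc k))"
      unfolding eventually_at_left_field by auto
    obtain n where n: "1 / real (Suc n) < 1 - b" using nat_approx_posE[of "1 - b"] b(1) by auto
    show "\<exists>n::nat. \<forall>p q::rat. max 0 (1 - 1 / real (Suc n)) < of_rat p \<and> of_rat p < (1::real) \<and>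
       max 0 (1 - 1 / real (Suc n)) < of_rat q \<and> of_rat q < (1::real) \<longrightarrow>
       dist (\<Phi> (complex_of_real (of_rat p) * \<zeta>)) (\<Phi> (complex_of_real (of_rat q) * \<zeta>)) \<le> 1 / real (Suc k)"
    proof (intro exI[of _ n] allI impI)
      fix p q :: rat
      assume a: "max 0 (1 - 1 / real (Suc n)) < of_rat p \<and> of_rat p < (1::real) \<and>
       max 0 (1 - 1 / real (Suc n)) < of_rat q \<and> of_rat q < (1::real)"
      have "dist (f (of_rat p)) (f (of_rat q)) \<le> dist (f (of_rat p)) l + dist (f (of_rat q)) l"
        by (rule dist_triangle2)
      also have "\<dots> \<le> 1 / (2 * real (Suc k)) + 1 / (2 * real (Suc k))"
        using a n by (intro add_mono less_imp_le b(2)) auto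
      also have "\<dots> = 1 / real (Suc k)" by (simp add: field_simps)
      finally show "dist (\<Phi> (complex_of_real (of_rat p) * \<zeta>)) (\<Phi> (complex_of_real (of_rat q) * \<zeta>)) \<le> 1 / real (Suc k)"
        unfolding f_def .
    qed
  qed
next
  define f where "f r = \<Phi> (complex_of_real r * \<zeta>)" for r
  assume R: ?R
  have fc: "isCont f r" if "0 < r" "r < 1" for r
  proof -
    have "continuous_on {0<..<1} f" unfolding f_def
      using \<zeta> by (intro continuous_on_compose2[OF cont] continuous_intros) (auto simp: norm_mult)
    then show ?thesis using that by (simp add: continuous_on_eq_continuous_at)
  qed
  \<comment> \<open>Rational radii in (0, 1) increasing to 1; the limit of this sequence is the only
    candidate for the radial limit.\<close>
  define a where "a m = f (1 - 1 / real (m + 2))" for m :: nat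
  have arat: "1 - 1 / real (m + 2) = of_rat (1 - 1 / of_nat (m + 2))" for m :: nat
    by (simp add: of_rat_diff of_rat_divide of_rat_add)
  have am: "dist (f (of_rat p)) (a m) \<le> 1 / real (Suc k)"
    if n: "\<forall>p q::rat. max 0 (1 - 1 / real (Suc n)) < of_rat p \<and> of_rat p < (1::real) \<and>
       max 0 (1 - 1 / real (Suc n)) < of_rat q \<and> of_rat q < (1::real) \<longrightarrow>
       dist (f (of_rat p)) (f (of_rat q)) \<le> 1 / real (Suc k)"
    and m: "n \<le> m" and p: "max 0 (1 - 1 / real (Suc n)) < of_rat p" "of_rat p < (1::real)" for n m k p
  proof -
    have "1 / real (m + 2) < 1 / real (Suc n)" using m by (intro divide_strict_left_mono) auto
    then have "max 0 (1 - 1 / real (Suc n)) < 1 - 1 / real (m + 2)" "1 - 1 / real (m + 2) < 1" by auto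
    then show ?thesis unfolding a_def arat using n p by blast
  qed
  have R': "\<exists>n::nat. \<forall>p q::rat. max 0 (1 - 1 / real (Suc n)) < of_rat p \<and> of_rat p < (1::real) \<and>
       max 0 (1 - 1 / real (Suc n)) < of_rat q \<and> of_rat q < (1::real) \<longrightarrow>
       dist (f (of_rat p)) (f (of_rat q)) \<le> 1 / real (Suc k)" for k
    using R unfolding f_def by blast
  have "Cauchy a"
  proof (rule metric_CauchyI)
    fix e :: real assume "e > 0"
    then obtain k where k: "1 / real (Suc k) < e" using nat_approx_posE by blast
    obtain n where n: "\<forall>p q::rat. max 0 (1 - 1 / real (Suc n)) < of_rat p \<and> of_rat p < (1::real) \<and>
       max 0 (1 - 1 / real (Suc n)) < of_rat q \<and> of_rat q < (1::real) \<longrightarrow>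
       dist (f (of_rat p)) (f (of_rat q)) \<le> 1 / real (Suc k)" using R' by blast
    show "\<exists>M. \<forall>m\<ge>M. \<forall>n\<ge>M. dist (a m) (a n) < e"
    proof (intro exI[of _ n] allI impI)
      fix i j assume ij: "n \<le> i" "n \<le> j"
      have "1 / real (i + 2) < 1 / real (Suc n)" using ij by (intro divide_strict_left_mono) auto
      then have i: "max 0 (1 - 1 / real (Suc n)) < 1 - 1 / real (i + 2)" "1 - 1 / real (i + 2) < 1" by auto
      have "dist (a i) (a j) \<le> 1 / real (Suc k)"
        using am[OF n ij(2) i[unfolded arat]] unfolding a_def arat .
      then show "dist (a i) (a j) < e" using k by simp
    qed
  qed
  then obtain l where l: "a \<longlonglongrightarrow> l" using Cauchy_convergent convergent_def by blast
  have "(f \<longlongrightarrow> l) (at_left 1)"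
  proof (rule tendstoI)
    fix e :: real assume "e > 0"
    then obtain k where k: "1 / real (Suc k) < e / 2" using nat_approx_posE[of "e / 2"] by auto
    obtain n where n: "\<forall>p q::rat. max 0 (1 - 1 / real (Suc n)) < of_rat p \<and> of_rat p < (1::real) \<and>
       max 0 (1 - 1 / real (Suc n)) < of_rat q \<and> of_rat q < (1::real) \<longrightarrow>
       dist (f (of_rat p)) (f (of_rat q)) \<le> 1 / real (Suc k)" using R' by blast
    let ?b = "max 0 (1 - 1 / real (Suc n))"
    show "\<forall>\<^sub>F r in at_left 1. dist (f r) l < e"
      unfolding eventually_at_left_field
    proof (intro exI[of _ ?b] conjI allI impI)
      fix r assume r: "?b < r" "r < 1"
      have r0: "0 < r" using r(1) by linarith
      \<comment> \<open>Continuity at the interior radius r transfers the estimate from a nearby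
        rational radius to r.\<close>
      have "\<forall>\<^sub>F s in at r. dist (f s) (f r) < e / 2"
        using fc[OF r0 r(2)] \<open>e > 0\<close> unfolding isCont_def by (intro tendstoD) auto
      then obtain d where d: "d > 0" "\<And>s. s \<noteq> r \<Longrightarrow> dist s r < d \<Longrightarrow> dist (f s) (f r) < e / 2"
        unfolding eventually_at by auto
      obtain p where p: "r < of_rat p" "of_rat p < min (r + d) 1" using of_rat_dense[of r "min (r + d) 1"] r d by auto
      have "dist (f (of_rat p)) l \<le> 1 / real (Suc k)"
      proof (rule LIMSEQ_le_const2[OF tendsto_dist[OF tendsto_const l]])
        show "\<exists>N. \<forall>m\<ge>N. dist (f (of_rat p)) (a m) \<le> 1 / real (Suc k)"
          using am[OF n] p r by (intro exI[of _ n]) auto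
      qed
      moreover have "dist (f (of_rat p)) (f r) < e / 2" using p by (intro d(2)) (auto simp: dist_real_def)
      ultimately show "dist (f r) l < e" using k dist_triangle3[of "f r" l "f (of_rat p)"] by linarith
    qed simp
  qed
  then show ?L unfolding f_def by blast
qed

text \<open>\<open>Lim\<close> is a definite description: at points without a radial limit its value
  is the constant \<open>THE l. False\<close>. The boundary function is thus a sequential limit on a
  measurable set and constant on the complement, and is measurable on the entire circle.\<close>

lemma borel_measurable_boundary_value:
  fixes \<Phi> :: "complex \<Rightarrow> complex"
  assumes cont: "continuous_on (ball 0 1) \<Phi>"
  shows "boundary_value \<Phi> \<in> borel_measurable circle"
proof -
  \<comment> \<open>Radii outside [0, 1) get the value 0, so that \<open>\<Psi> r\<close> is
    measurable for every real r and the predicate \<open>P\<close> below may quantify over all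
    rationals.\<close>
  define \<Psi> where "\<Psi> r \<zeta> = (if 0 \<le> r \<and> r < 1 then \<Phi> (complex_of_real r * \<zeta>) else 0)" for r \<zeta>
  have \<Psi>m[measurable]: "\<Psi> r \<in> borel_measurable circle" for r
  proof (cases "0 \<le> r \<and> r < 1")
    case True
    then have "\<Psi> r = (\<lambda>\<zeta>. \<Phi> (complex_of_real r * \<zeta>))" unfolding \<Psi>_def by simp
    moreover have "continuous_on (sphere 0 1) (\<lambda>\<zeta>. \<Phi> (complex_of_real r * \<zeta>))"
      using True by (intro continuous_on_compose2[OF cont] continuous_intros) (auto simp: norm_mult)
    ultimately show ?thesis using continuous_measurable_circle by simp
  next
    case False
    then have "\<Psi> r = (\<lambda>\<zeta>. 0)" unfolding \<Psi>_def by auto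
    then show ?thesis by simp
  qed
  define P where "P \<zeta> \<longleftrightarrow> (\<forall>k::nat. \<exists>n::nat. \<forall>p q::rat. max 0 (1 - 1 / real (Suc n)) < of_rat p \<and> of_rat p < (1::real) \<and>
       max 0 (1 - 1 / real (Suc n)) < of_rat q \<and> of_rat q < (1::real) \<longrightarrow>
       dist (\<Psi> (of_rat p) \<zeta>) (\<Psi> (of_rat q) \<zeta>) \<le> 1 / real (Suc k))" for \<zeta>
  have [measurable]: "Measurable.pred circle P" unfolding P_def by measurable
  have P: "P \<zeta> \<longleftrightarrow> (\<exists>l. ((\<lambda>r. \<Phi> (complex_of_real r * \<zeta>)) \<longlongrightarrow> l) (at_left 1))" if "norm \<zeta> = 1" for \<zeta>
    unfolding radial_limit_exists_iff[OF cont that] P_def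
  proof (intro all_cong1 ex_cong1 imp_cong refl)
    fix k n :: nat and p q :: rat
    assume a: "max 0 (1 - 1 / real (Suc n)) < of_rat p \<and> of_rat p < (1::real) \<and>
       max 0 (1 - 1 / real (Suc n)) < of_rat q \<and> of_rat q < (1::real)"
    then have "0 \<le> real_of_rat p \<and> real_of_rat p < 1" "0 \<le> real_of_rat q \<and> real_of_rat q < 1" by linarith+
    then show "dist (\<Psi> (of_rat p) \<zeta>) (\<Psi> (of_rat q) \<zeta>) \<le> 1 / real (Suc k) \<longleftrightarrow>
       dist (\<Phi> (complex_of_real (of_rat p) * \<zeta>)) (\<Phi> (complex_of_real (of_rat q) * \<zeta>)) \<le> 1 / real (Suc k)"
      by (simp only: \<Psi>_def if_True simp_thms)
  qed
  have eq: "boundary_value \<Phi> \<zeta> = (if P \<zeta> then lim (\<lambda>m. \<Psi> (1 - 1 / real (m + 2)) \<zeta>) else (THE l. False))"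
    if "\<zeta> \<in> space circle" for \<zeta>
  proof -
    have n: "norm \<zeta> = 1" using that by simp
    show ?thesis
    proof (cases "P \<zeta>")
      case True
      then obtain l where l: "((\<lambda>r. \<Phi> (complex_of_real r * \<zeta>)) \<longlongrightarrow> l) (at_left 1)" using P[OF n] by auto
      have f: "filterlim (\<lambda>m. 1 - 1 / real (m + 2)) (at_left 1) sequentially" by real_asymp
      have "(\<lambda>m. \<Phi> (complex_of_real (1 - 1 / real (m + 2)) * \<zeta>)) \<longlonglongrightarrow> l"
        by (rule filterlim_compose[OF l f])
      moreover have "\<Psi> (1 - 1 / real (m + 2)) \<zeta> = \<Phi> (complex_of_real (1 - 1 / real (m + 2)) * \<zeta>)" for m
        unfolding \<Psi>_def by simp
      ultimately have "(\<lambda>m. \<Psi> (1 - 1 / real (m + 2)) \<zeta>) \<longlonglongrightarrow> l" by simp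
      then have "lim (\<lambda>m. \<Psi> (1 - 1 / real (m + 2)) \<zeta>) = l" by (rule limI)
      moreover have "boundary_value \<Phi> \<zeta> = l" unfolding boundary_value_def by (rule tendsto_Lim[OF _ l]) simp
      ultimately show ?thesis using True by simp
    next
      case False
      then have "\<not> ((\<lambda>r. \<Phi> (complex_of_real r * \<zeta>)) \<longlongrightarrow> l) (at_left 1)" for l using P[OF n] by auto
      then show ?thesis using False unfolding boundary_value_def t2_space_class.Lim_def by simp
    qed
  qed
  have "(\<lambda>\<zeta>. if P \<zeta> then lim (\<lambda>m. \<Psi> (1 - 1 / real (m + 2)) \<zeta>) else (THE l. False)) \<in> borel_measurable circle"
    by measurable
  then show ?thesis by (rule iffD2[OF measurable_cong, rotated]) (rule eq)
qed

lemma boundary_value_eqI: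
  "((\<lambda>r. \<Phi> (complex_of_real r * \<zeta>)) \<longlongrightarrow> l) (at_left 1) \<Longrightarrow> boundary_value \<Phi> \<zeta> = l"
  unfolding boundary_value_def by (rule tendsto_Lim) simp_all


section \<open>The Hardy space\<close>

lemma L2_measurable: "f \<in> L2 \<Longrightarrow> f \<in> borel_measurable circle"
  unfolding L2_def by simp

lemma L2_integrable_mult:
  assumes f: "f \<in> L2" and g: "g \<in> L2" shows "integrable circle (\<lambda>\<zeta>. f \<zeta> * g \<zeta>)"
proof (rule Bochner_Integration.integrable_bound)
  show "integrable circle (\<lambda>\<zeta>. (norm (f \<zeta>))\<^sup>2 + (norm (g \<zeta>))\<^sup>2)" using f g unfolding L2_def by simp
  show "(\<lambda>\<zeta>. f \<zeta> * g \<zeta>) \<in> borel_measurable circle"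
    by (intro borel_measurable_times L2_measurable f g)
  have "norm (a * b) \<le> norm ((norm a)\<^sup>2 + (norm b)\<^sup>2)" for a b :: complex
  proof -
    have "norm a * norm b \<le> (norm a)\<^sup>2 + (norm b)\<^sup>2"
      using sum_squares_bound[of "norm a" "norm b"] mult_nonneg_nonneg[OF norm_ge_zero[of a] norm_ge_zero[of b]]
      by linarith
    then show ?thesis by (simp add: norm_mult)
  qed
  then show "AE \<zeta> in circle. norm (f \<zeta> * g \<zeta>) \<le> norm ((norm (f \<zeta>))\<^sup>2 + (norm (g \<zeta>))\<^sup>2)" by simp
qed

lemma L2_cnj:
  assumes "f \<in> L2" shows "(\<lambda>\<zeta>. cnj (f \<zeta>)) \<in> L2"
proof -
  have "cnj \<in> borel_measurable borel" by (intro borel_measurable_continuous_onI continuous_intros)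
  from measurable_compose[OF L2_measurable[OF assms] this] show ?thesis
    using assms unfolding L2_def by simp
qed

lemma L2_integrable_ip: "f \<in> L2 \<Longrightarrow> g \<in> L2 \<Longrightarrow> integrable circle (\<lambda>\<zeta>. f \<zeta> * cnj (g \<zeta>))"
  using L2_integrable_mult[OF _ L2_cnj] by blast

lemma L2_continuous: "continuous_on (sphere 0 1) f \<Longrightarrow> f \<in> L2"
  unfolding L2_def using continuous_measurable_circle[of f]
    integrable_norm[OF integrable_circle_continuous[of "\<lambda>\<zeta>. f \<zeta> * f \<zeta>"]]
  by (auto intro!: continuous_intros simp: norm_mult power2_eq_square)

lemma L2_add:
  assumes f: "f \<in> L2" and g: "g \<in> L2" shows "(\<lambda>\<zeta>. f \<zeta> + g \<zeta>) \<in> L2"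
proof -
  have m: "(\<lambda>\<zeta>. f \<zeta> + g \<zeta>) \<in> borel_measurable circle"
    by (intro borel_measurable_add L2_measurable f g)
  have "integrable circle (\<lambda>\<zeta>. (norm (f \<zeta> + g \<zeta>))\<^sup>2)"
  proof (rule Bochner_Integration.integrable_bound)
    show "integrable circle (\<lambda>\<zeta>. 2 * (norm (f \<zeta>))\<^sup>2 + 2 * (norm (g \<zeta>))\<^sup>2)" using f g unfolding L2_def by simp
    show "(\<lambda>\<zeta>. (norm (f \<zeta> + g \<zeta>))\<^sup>2) \<in> borel_measurable circle" using m by simp
    have "(norm (a + b))\<^sup>2 \<le> 2 * (norm a)\<^sup>2 + 2 * (norm b)\<^sup>2" for a b :: complex
    proof -
      have "(norm (a + b))\<^sup>2 \<le> (norm a + norm b)\<^sup>2" by (intro power_mono norm_triangle_ineq) simp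
      also have "\<dots> \<le> 2 * (norm a)\<^sup>2 + 2 * (norm b)\<^sup>2"
        using sum_squares_bound[of "norm a" "norm b"] by (simp add: power2_sum)
      finally show ?thesis .
    qed
    then show "AE \<zeta> in circle. norm ((norm (f \<zeta> + g \<zeta>))\<^sup>2) \<le> norm (2 * (norm (f \<zeta>))\<^sup>2 + 2 * (norm (g \<zeta>))\<^sup>2)"
      by simp
  qed
  then show ?thesis using m unfolding L2_def by simp
qed

lemma L2_mult_bounded:
  assumes f: "f \<in> L2" and m: "m \<in> borel_measurable circle" and b: "AE \<zeta> in circle. norm (m \<zeta>) \<le> B"
  shows "(\<lambda>\<zeta>. m \<zeta> * f \<zeta>) \<in> L2"
proof -
  have mm: "(\<lambda>\<zeta>. m \<zeta> * f \<zeta>) \<in> borel_measurable circle"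
    by (intro borel_measurable_times L2_measurable f m)
  have "integrable circle (\<lambda>\<zeta>. (norm (m \<zeta> * f \<zeta>))\<^sup>2)"
  proof (rule Bochner_Integration.integrable_bound)
    show "integrable circle (\<lambda>\<zeta>. B\<^sup>2 * (norm (f \<zeta>))\<^sup>2)" using f unfolding L2_def by simp
    show "(\<lambda>\<zeta>. (norm (m \<zeta> * f \<zeta>))\<^sup>2) \<in> borel_measurable circle" using mm by simp
    show "AE \<zeta> in circle. norm ((norm (m \<zeta> * f \<zeta>))\<^sup>2) \<le> norm (B\<^sup>2 * (norm (f \<zeta>))\<^sup>2)"
      using b
    proof eventually_elim
      case (elim \<zeta>)
      then have "(norm (m \<zeta>))\<^sup>2 \<le> B\<^sup>2" by (intro power_mono) auto
      then show ?case by (simp add: norm_mult power_mult_distrib mult_right_mono)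
    qed
  qed
  then show ?thesis using mm unfolding L2_def by simp
qed

lemma L2_cmult: "f \<in> L2 \<Longrightarrow> (\<lambda>\<zeta>. c * f \<zeta>) \<in> L2"
  by (rule L2_mult_bounded[where B = "norm c"]) auto

lemma L2_cong_AE:
  assumes f: "f \<in> L2" and g: "g \<in> borel_measurable circle" and e: "AE \<zeta> in circle. f \<zeta> = g \<zeta>"
  shows "g \<in> L2"
proof -
  have "integrable circle (\<lambda>\<zeta>. (norm (f \<zeta>))\<^sup>2) = integrable circle (\<lambda>\<zeta>. (norm (g \<zeta>))\<^sup>2)"
    using f g e by (intro integrable_cong_AE) (auto simp: L2_def elim: eventually_mono)
  then show ?thesis using f g unfolding L2_def by simp
qed

lemma H2_L2: "f \<in> H2 \<Longrightarrow> f \<in> L2" unfolding H2_def by simp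

lemma L2_integrable_power: "f \<in> L2 \<Longrightarrow> integrable circle (\<lambda>\<zeta>. f \<zeta> * \<zeta> ^ n)"
  by (rule L2_integrable_mult[OF _ L2_continuous]) (auto intro!: continuous_intros)

lemma H2_add:
  assumes f: "f \<in> H2" and g: "g \<in> H2" shows "(\<lambda>\<zeta>. f \<zeta> + g \<zeta>) \<in> H2"
  using f g L2_add[OF H2_L2[OF f] H2_L2[OF g]] L2_integrable_power[OF H2_L2[OF f]] L2_integrable_power[OF H2_L2[OF g]]
  unfolding H2_def by (simp add: distrib_right)

lemma H2_cmult:
  assumes f: "f \<in> H2" shows "(\<lambda>\<zeta>. c * f \<zeta>) \<in> H2"
  using f L2_cmult[OF H2_L2[OF f]] unfolding H2_def by (simp add: mult.assoc)

lemma H2_cong_AE: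
  assumes f: "f \<in> H2" and g: "g \<in> borel_measurable circle" and e: "AE \<zeta> in circle. f \<zeta> = g \<zeta>"
  shows "g \<in> H2"
proof -
  have "(LINT \<zeta>|circle. f \<zeta> * \<zeta> ^ n) = (LINT \<zeta>|circle. g \<zeta> * \<zeta> ^ n)" for n
  proof (rule integral_cong_AE)
    show "(\<lambda>\<zeta>. f \<zeta> * \<zeta> ^ n) \<in> borel_measurable circle"
      using L2_integrable_power[OF H2_L2[OF f]] by (rule borel_measurable_integrable)
    show "(\<lambda>\<zeta>. g \<zeta> * \<zeta> ^ n) \<in> borel_measurable circle"
      by (intro borel_measurable_times g continuous_measurable_circle continuous_intros)
    show "AE \<zeta> in circle. f \<zeta> * \<zeta> ^ n = g \<zeta> * \<zeta> ^ n" using e by eventually_elim simp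
  qed
  then show ?thesis using f L2_cong_AE[OF H2_L2[OF f] g e] unfolding H2_def by auto
qed

lemma norm_cnj_mult_circle: "norm u < 1 \<Longrightarrow> norm \<zeta> = 1 \<Longrightarrow> norm (cnj u * \<zeta>) < 1"
  by (simp add: norm_mult)

lemma continuous_on_Kker: "norm u < 1 \<Longrightarrow> continuous_on (sphere 0 1) (Kker u)"
proof -
  assume u: "norm u < 1"
  have "1 - cnj u * \<zeta> \<noteq> 0" if "norm \<zeta> = 1" for \<zeta> using norm_cnj_mult_circle[OF u that] by auto
  then show ?thesis unfolding Kker_def by (intro continuous_intros) auto
qed

lemma integral_mult_Kker_sums:
  assumes u: "norm u < 1" and f: "integrable circle f"
  shows "(\<lambda>n. cnj u ^ n * (LINT \<zeta>|circle. f \<zeta> * \<zeta> ^ n)) sums (LINT \<zeta>|circle. f \<zeta> * Kker u \<zeta>)"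
proof -
  have "(\<lambda>n. cnj u ^ n * (LINT \<zeta>|circle. f \<zeta> * \<zeta> ^ n)) sums (LINT \<zeta>|circle. f \<zeta> * (\<Sum>n. cnj u ^ n * \<zeta> ^ n))"
    using u by (intro circle_series_sums f continuous_measurable_circle continuous_intros)
      (auto simp: norm_power)
  also have "(LINT \<zeta>|circle. f \<zeta> * (\<Sum>n. cnj u ^ n * \<zeta> ^ n)) = (LINT \<zeta>|circle. f \<zeta> * Kker u \<zeta>)"
  proof (rule Bochner_Integration.integral_cong[OF refl])
    fix \<zeta> assume "\<zeta> \<in> space circle"
    then have "norm (cnj u * \<zeta>) < 1" using norm_cnj_mult_circle[OF u] by simp
    then have "(\<Sum>n. cnj u ^ n * \<zeta> ^ n) = Kker u \<zeta>"
      using suminf_geometric[of "cnj u * \<zeta>"] by (simp add: power_mult_distrib Kker_def inverse_eq_divide)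
    then show "f \<zeta> * (\<Sum>n. cnj u ^ n * \<zeta> ^ n) = f \<zeta> * Kker u \<zeta>" by simp
  qed
  finally show ?thesis .
qed

lemma Kker_H2:
  assumes u: "norm u < 1" shows "Kker u \<in> H2"
proof -
  have "(LINT \<zeta>|circle. Kker u \<zeta> * \<zeta> ^ n) = 0" if n: "n \<ge> 1" for n
  proof -
    have "integrable circle (\<lambda>\<zeta>. \<zeta> ^ n)" by (intro integrable_circle_continuous continuous_intros)
    from integral_mult_Kker_sums[OF u this]
    have "(\<lambda>k. cnj u ^ k * (LINT \<zeta>|circle. \<zeta> ^ (n + k) * cnj \<zeta> ^ 0)) sums (LINT \<zeta>|circle. Kker u \<zeta> * \<zeta> ^ n)"
      by (simp add: power_add mult.commute[of _ "Kker u _"])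
    then have "(\<lambda>k. 0) sums (LINT \<zeta>|circle. Kker u \<zeta> * \<zeta> ^ n)" unfolding circle_moment using n by simp
    then show ?thesis using sums_unique2 sums_zero by blast
  qed
  then show ?thesis unfolding H2_def using L2_continuous[OF continuous_on_Kker[OF u]] by simp
qed

lemma ip_Kker_Kker:
  assumes u: "norm u < 1" and v: "norm v < 1"
  shows "ip (Kker u) (Kker v) = inverse (1 - cnj u * v)"
proof -
  have 1: "(LINT \<zeta>|circle. cnj \<zeta> ^ n * Kker v \<zeta>) = cnj v ^ n" for n
  proof -
    have "integrable circle (\<lambda>\<zeta>. cnj \<zeta> ^ n)" by (intro integrable_circle_continuous continuous_intros)
    from integral_mult_Kker_sums[OF v this]
    have "(\<lambda>k. cnj v ^ k * (if k = n then 1 else 0)) sums (LINT \<zeta>|circle. cnj \<zeta> ^ n * Kker v \<zeta>)"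
      by (simp add: circle_moment mult.commute[of "cnj _ ^ _"])
    moreover have "(\<lambda>k. cnj v ^ k * (if k = n then 1 else 0)) sums (cnj v ^ n)"
      using sums_single[of n "\<lambda>k. cnj v ^ k"] by (simp add: if_distrib cong: if_cong)
    ultimately show ?thesis by (rule sums_unique2)
  qed
  have 2: "(LINT \<zeta>|circle. cnj (Kker v \<zeta>) * \<zeta> ^ n) = v ^ n" for n
  proof -
    have "(LINT \<zeta>|circle. cnj (Kker v \<zeta>) * \<zeta> ^ n) = (LINT \<zeta>|circle. cnj (cnj \<zeta> ^ n * Kker v \<zeta>))"
      by (simp add: mult.commute)
    also have "\<dots> = cnj (LINT \<zeta>|circle. cnj \<zeta> ^ n * Kker v \<zeta>)" by (rule Bochner_Integration.integral_cnj)
    finally show ?thesis unfolding 1 by simp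
  qed
  have "integrable circle (\<lambda>\<zeta>. cnj (Kker v \<zeta>))"
    by (intro integrable_circle_continuous continuous_intros continuous_on_Kker v)
  from integral_mult_Kker_sums[OF u this]
  have "(\<lambda>n. cnj u ^ n * v ^ n) sums ip (Kker u) (Kker v)"
    unfolding 2 ip_def by (simp add: mult.commute)
  moreover have "norm (cnj u * v) < 1"
  proof -
    have "norm u * norm v \<le> 1 * norm v" using u by (intro mult_right_mono) auto
    then show ?thesis using v by (simp add: norm_mult)
  qed
  from geometric_sums[OF this] have "(\<lambda>n. cnj u ^ n * v ^ n) sums inverse (1 - cnj u * v)"
    by (simp add: power_mult_distrib inverse_eq_divide)
  ultimately show ?thesis by (rule sums_unique2)
qed

text \<open>On the circle \<open>cnj (Kker u \<zeta>) * \<zeta> = \<zeta> + u * cnj (Kker u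
  \<zeta>)\<close>, and the positive moments of \<open>f\<close> vanish; so each further factor
  \<open>\<zeta>\<close> contributes a factor \<open>u\<close>. This is the reproducing property for
  f times a monomial, stated without point values of \<open>f\<close> in the disc.\<close>

lemma integral_cnj_Kker_shift:
  assumes f: "f \<in> H2" and u: "norm u < 1"
  shows "(LINT \<zeta>|circle. f \<zeta> * cnj (Kker u \<zeta>) * \<zeta> ^ n) = u ^ n * ip f (Kker u)"
proof (induction n)
  case 0
  then show ?case by (simp add: ip_def)
next
  case (Suc n)
  have K: "(\<lambda>\<zeta>. cnj (Kker u \<zeta>) * \<zeta> ^ n) \<in> L2"
    by (intro L2_continuous continuous_intros continuous_on_Kker u)
  have "(LINT \<zeta>|circle. f \<zeta> * cnj (Kker u \<zeta>) * \<zeta> ^ Suc n) =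
    (LINT \<zeta>|circle. f \<zeta> * \<zeta> ^ Suc n + u * (f \<zeta> * (cnj (Kker u \<zeta>) * \<zeta> ^ n)))"
  proof (rule Bochner_Integration.integral_cong[OF refl])
    fix \<zeta> assume "\<zeta> \<in> space circle"
    then have n: "norm \<zeta> = 1" by simp
    then have zz: "\<zeta> * cnj \<zeta> = 1" by (simp add: complex_norm_square[symmetric])
    have "1 - u * cnj \<zeta> \<noteq> 0" using norm_mult_cnj_circle[OF n, of u] u by auto
    then have "cnj (Kker u \<zeta>) * (1 - u * cnj \<zeta>) = 1" unfolding Kker_def by simp
    then have h: "cnj (Kker u \<zeta>) * \<zeta> = \<zeta> + u * cnj (Kker u \<zeta>)" using zz by algebra
    have "f \<zeta> * cnj (Kker u \<zeta>) * \<zeta> ^ Suc n = f \<zeta> * (cnj (Kker u \<zeta>) * \<zeta>) * \<zeta> ^ n" by (simp add: mult.assoc)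
    then show "f \<zeta> * cnj (Kker u \<zeta>) * \<zeta> ^ Suc n = f \<zeta> * \<zeta> ^ Suc n + u * (f \<zeta> * (cnj (Kker u \<zeta>) * \<zeta> ^ n))"
      unfolding h by (simp add: algebra_simps)
  qed
  also have "\<dots> = (LINT \<zeta>|circle. f \<zeta> * \<zeta> ^ Suc n) + u * (LINT \<zeta>|circle. f \<zeta> * (cnj (Kker u \<zeta>) * \<zeta> ^ n))"
    by (subst Bochner_Integration.integral_add)
      (intro L2_integrable_power H2_L2 f integrable_mult_right L2_integrable_mult K
       | simp only: integral_mult_right_zero)+
  also have "(LINT \<zeta>|circle. f \<zeta> * \<zeta> ^ Suc n) = 0" using f unfolding H2_def by (simp del: power_Suc)
  finally show ?case using Suc by (simp add: mult.assoc)
qed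

section \<open>Multiplication of the Hardy space by bounded analytic functions\<close>

context bounded_holomorphic_disc
begin

lemma continuous_disc: "continuous_on (ball 0 1) \<Phi>"
  using holo by (rule holomorphic_on_imp_continuous_on)

lemma AE_boundary_value:
  "AE \<zeta> in circle. norm (boundary_value \<Phi> \<zeta>) \<le> C \<and>
     ((\<lambda>r. dil r \<zeta>) \<longlongrightarrow> boundary_value \<Phi> \<zeta>) (at_left 1)"
  using radial_limits by eventually_elim (auto dest: boundary_value_eqI)

lemma boundary_value_measurable: "boundary_value \<Phi> \<in> borel_measurable circle"
  by (rule borel_measurable_boundary_value[OF continuous_disc])

text \<open>Dominated convergence with majorant C \<bar>f\<bar>, along radii tending to 1. It
  reduces statements about boundary values to dilations, which have convergent power series on the
  closed disc. The offset 2 keeps the radii in [1/2, 1).\<close>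

lemma integral_boundary_value_mult:
  assumes f: "integrable circle f"
  shows "(\<lambda>m. LINT \<zeta>|circle. f \<zeta> * dil (1 - 1 / real (m + 2)) \<zeta>) \<longlonglongrightarrow>
    (LINT \<zeta>|circle. f \<zeta> * boundary_value \<Phi> \<zeta>)"
proof (rule integral_dominated_convergence[where w = "\<lambda>\<zeta>. C * norm (f \<zeta>)"])
  have r: "0 \<le> 1 - 1 / real (m + 2)" "1 - 1 / real (m + 2) < 1" for m by auto
  show "(\<lambda>\<zeta>. f \<zeta> * boundary_value \<Phi> \<zeta>) \<in> borel_measurable circle"
    using f by (intro borel_measurable_times boundary_value_measurable) auto
  show "(\<lambda>\<zeta>. f \<zeta> * dil (1 - 1 / real (m + 2)) \<zeta>) \<in> borel_measurable circle" for m
    by (rule borel_measurable_times[OF borel_measurable_integrable[OF f] continuous_measurable_circle[OF continuous_scaled[OF r]]])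
  show "integrable circle (\<lambda>\<zeta>. C * norm (f \<zeta>))" using f by simp
  have flt: "filterlim (\<lambda>m. 1 - 1 / real (m + 2)) (at_left 1) sequentially" by real_asymp
  show "AE \<zeta> in circle. (\<lambda>m. f \<zeta> * dil (1 - 1 / real (m + 2)) \<zeta>) \<longlonglongrightarrow> f \<zeta> * boundary_value \<Phi> \<zeta>"
    using AE_boundary_value
    by eventually_elim (intro tendsto_mult tendsto_const filterlim_compose[OF _ flt], blast)
  show "AE \<zeta> in circle. norm (f \<zeta> * dil (1 - 1 / real (m + 2)) \<zeta>) \<le> C * norm (f \<zeta>)" for m
  proof (rule AE_I2)
    fix \<zeta> assume "\<zeta> \<in> space circle"
    then have "norm (complex_of_real (1 - 1 / real (m + 2)) * \<zeta>) < 1" using r[of m] by (simp only: norm_mult norm_of_real) simp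
    from mult_left_mono[OF bound[OF this], of "norm (f \<zeta>)"]
    show "norm (f \<zeta> * dil (1 - 1 / real (m + 2)) \<zeta>) \<le> C * norm (f \<zeta>)"
      by (simp add: norm_mult mult.commute)
  qed
qed

text \<open>For a dilation the moments of the product vanish by termwise integration of its power
  series against \<open>f\<close>; the limit of the radii gives the boundary function itself. Square
  integrability follows from its bound \<open>C\<close>.\<close>

lemma mult_H2:
  assumes f: "f \<in> H2"
  shows "(\<lambda>\<zeta>. boundary_value \<Phi> \<zeta> * f \<zeta>) \<in> H2"
proof -
  have r: "0 \<le> 1 - 1 / real (m + 2)" "1 - 1 / real (m + 2) < 1" for m by auto
  have "(LINT \<zeta>|circle. boundary_value \<Phi> \<zeta> * f \<zeta> * \<zeta> ^ n) = 0" if n: "n \<ge> 1" for n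
  proof -
    have i: "integrable circle (\<lambda>\<zeta>. f \<zeta> * \<zeta> ^ n)" by (rule L2_integrable_power[OF H2_L2[OF f]])
    have "(LINT \<zeta>|circle. f \<zeta> * \<zeta> ^ n * dil (1 - 1 / real (m + 2)) \<zeta>) = 0" for m
    proof -
      have "(LINT \<zeta>|circle. f \<zeta> * \<zeta> ^ n * \<zeta> ^ k) = 0" for k
        using f n unfolding H2_def by (simp add: mult.assoc power_add[symmetric])
      with integral_scaled_mult[OF r i, of m]
      have "(\<lambda>k. 0) sums (LINT \<zeta>|circle. f \<zeta> * \<zeta> ^ n * dil (1 - 1 / real (m + 2)) \<zeta>)"
        by simp
      then show ?thesis using sums_unique2 sums_zero by blast
    qed
    with integral_boundary_value_mult[OF i]
    have "(LINT \<zeta>|circle. f \<zeta> * \<zeta> ^ n * boundary_value \<Phi> \<zeta>) = 0" by (simp add: LIMSEQ_const_iff)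
    then show ?thesis by (simp add: mult_ac)
  qed
  moreover have "AE \<zeta> in circle. norm (boundary_value \<Phi> \<zeta>) \<le> C"
    using AE_boundary_value by eventually_elim simp
  ultimately show ?thesis
    unfolding H2_def using L2_mult_bounded[OF H2_L2[OF f] boundary_value_measurable] by auto
qed

text \<open>The adjoint of multiplication by \<Phi> has the reproducing kernels as eigenvectors,
  with eigenvalue the conjugate of \<Phi>(u). For a dilation, \<open>integral_cnj_Kker_shift\<close>
  replaces each power of \<zeta> by the same power of u, which sums up to the value at u.\<close>

lemma ip_mult_Kker:
  assumes f: "f \<in> H2" and u: "norm u < 1"
  shows "ip (\<lambda>\<zeta>. boundary_value \<Phi> \<zeta> * f \<zeta>) (Kker u) = \<Phi> u * ip f (Kker u)"
proof (rule LIMSEQ_unique)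
  have r: "0 \<le> 1 - 1 / real (m + 2)" "1 - 1 / real (m + 2) < 1" for m by auto
  have i: "integrable circle (\<lambda>\<zeta>. f \<zeta> * cnj (Kker u \<zeta>))"
    by (intro L2_integrable_ip H2_L2 f Kker_H2 u)
  show "(\<lambda>m. LINT \<zeta>|circle. f \<zeta> * cnj (Kker u \<zeta>) * dil (1 - 1 / real (m + 2)) \<zeta>) \<longlonglongrightarrow>
    ip (\<lambda>\<zeta>. boundary_value \<Phi> \<zeta> * f \<zeta>) (Kker u)"
    using integral_boundary_value_mult[OF i] by (simp add: ip_def mult_ac)
  have "(LINT \<zeta>|circle. f \<zeta> * cnj (Kker u \<zeta>) * dil (1 - 1 / real (m + 2)) \<zeta>) =
      dil (1 - 1 / real (m + 2)) u * ip f (Kker u)" for m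
  proof (rule sums_unique2)
    let ?r = "1 - 1 / real (m + 2)"
    show "(\<lambda>k. coeff k * complex_of_real ?r ^ k * (u ^ k * ip f (Kker u))) sums
        (LINT \<zeta>|circle. f \<zeta> * cnj (Kker u \<zeta>) * dil ?r \<zeta>)"
      using integral_scaled_mult[OF r i, of m] unfolding integral_cnj_Kker_shift[OF f u] .
    have "?r * norm u \<le> 1 * norm u" using r by (intro mult_right_mono) auto
    then have "norm (complex_of_real ?r * u) < 1" using u r[of m] by (simp only: norm_mult norm_of_real)
    from sums_mult2[OF power_series[OF this], of "ip f (Kker u)"]
    show "(\<lambda>k. coeff k * complex_of_real ?r ^ k * (u ^ k * ip f (Kker u))) sums (dil ?r u * ip f (Kker u))"
      by (simp only: power_mult_distrib mult.assoc)
  qed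
  moreover have "(\<lambda>m. dil (1 - 1 / real (m + 2)) u * ip f (Kker u)) \<longlonglongrightarrow> \<Phi> u * ip f (Kker u)"
  proof (intro tendsto_mult tendsto_const)
    have "(\<lambda>m. 1 - 1 / real (m + 2)) \<longlonglongrightarrow> 1" by real_asymp
    then have "(\<lambda>m. complex_of_real (1 - 1 / real (m + 2)) * u) \<longlonglongrightarrow> complex_of_real 1 * u" by (intro tendsto_intros)
    then show "(\<lambda>m. dil (1 - 1 / real (m + 2)) u) \<longlonglongrightarrow> \<Phi> u"
      using u by (intro isCont_tendsto_compose[of u \<Phi>]) (auto intro!: continuous_on_interior[OF continuous_disc])
  qed
  ultimately show "(\<lambda>m. LINT \<zeta>|circle. f \<zeta> * cnj (Kker u \<zeta>) * dil (1 - 1 / real (m + 2)) \<zeta>) \<longlonglongrightarrow>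
      \<Phi> u * ip f (Kker u)" by simp
qed

end

text \<open>Difference quotients are bounded by the local majorant of the derivative through the
  mean value inequality on a closed disc, and dominated convergence applies along sequences. The
  exceptional null set is common to all \<open>z\<close>; for a spectral measure it is the part of
  the line below \<gamma>.\<close>

lemma holomorphic_on_integral:
  fixes f f' :: "complex \<Rightarrow> 'a \<Rightarrow> complex"
  assumes int: "\<And>z. z \<in> S \<Longrightarrow> integrable M (f z)"
    and f'm: "\<And>z. z \<in> S \<Longrightarrow> f' z \<in> borel_measurable M"
    and der: "AE x in M. \<forall>z\<in>S. ((\<lambda>z. f z x) has_field_derivative f' z x) (at z)"
    and bd: "\<And>z0. z0 \<in> S \<Longrightarrow> \<exists>r>0. \<exists>w. cball z0 r \<subseteq> S \<and> integrable M w \<and>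
      (AE x in M. \<forall>z\<in>cball z0 r. norm (f' z x) \<le> (w x :: real))"
  shows "(\<lambda>z. LINT x|M. f z x) holomorphic_on S"
proof (rule holomorphic_onI)
  fix z0 assume z0: "z0 \<in> S"
  obtain r w where r: "r > 0" and w: "cball z0 r \<subseteq> S" "integrable M w"
    "AE x in M. \<forall>z\<in>cball z0 r. norm (f' z x) \<le> (w x :: real)" using bd[OF z0] by blast
  have "((\<lambda>z. LINT x|M. f z x) has_field_derivative (LINT x|M. f' z0 x)) (at z0)"
    unfolding has_field_derivative_iff tendsto_at_iff_sequentially
  proof (intro allI impI)
    fix X :: "nat \<Rightarrow> complex" assume X: "\<forall>i. X i \<in> UNIV - {z0}" "X \<longlonglongrightarrow> z0"
    obtain N where N: "\<And>i. N \<le> i \<Longrightarrow> dist (X i) z0 < r" using metric_LIMSEQ_D[OF X(2) r] by blast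
    define Y where "Y i = X (i + N)" for i
    have Y: "Y \<longlonglongrightarrow> z0" "\<And>i. Y i \<noteq> z0"
      using X(1) unfolding Y_def by (auto intro: LIMSEQ_ignore_initial_segment[OF X(2)])
    have Y3: "Y i \<in> cball z0 r" for i
      using N[of "i + N"] unfolding Y_def mem_cball by (simp add: dist_commute)
    have YS: "Y i \<in> S" for i using Y3 w(1) by blast
    have "(\<lambda>i. LINT x|M. (f (Y i) x - f z0 x) / (Y i - z0)) \<longlonglongrightarrow> (LINT x|M. f' z0 x)"
    proof (rule integral_dominated_convergence[OF _ _ w(2)])
      show "f' z0 \<in> borel_measurable M" by (rule f'm[OF z0])
      show "(\<lambda>x. (f (Y i) x - f z0 x) / (Y i - z0)) \<in> borel_measurable M" for i
        using int[OF YS[of i]] int[OF z0] by auto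
      show "AE x in M. (\<lambda>i. (f (Y i) x - f z0 x) / (Y i - z0)) \<longlonglongrightarrow> f' z0 x"
        using der
      proof eventually_elim
        case (elim x)
        then have "((\<lambda>y. (f y x - f z0 x) / (y - z0)) \<longlongrightarrow> f' z0 x) (at z0)"
          using z0 unfolding has_field_derivative_iff by blast
        then show ?case using Y(1,2) unfolding tendsto_at_iff_sequentially o_def by blast
      qed
      show "AE x in M. norm ((f (Y i) x - f z0 x) / (Y i - z0)) \<le> w x" for i
        using der w(3)
      proof eventually_elim
        case (elim x)
        have "norm (f (Y i) x - f z0 x) \<le> w x * norm (Y i - z0)"
        proof (rule field_differentiable_bound[of "cball z0 r" "\<lambda>z. f z x" "\<lambda>z. f' z x"])
          show "((\<lambda>z. f z x) has_field_derivative f' z x) (at z within cball z0 r)" if "z \<in> cball z0 r" for z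
            using elim(1) that w(1) by (meson has_field_derivative_at_within subsetD)
        qed (use elim(2) Y3 r in auto)
        then show ?case using Y(2)[of i] by (simp add: norm_divide field_simps)
      qed
    qed
    moreover have "(LINT x|M. (f (Y i) x - f z0 x) / (Y i - z0)) = ((LINT x|M. f (Y i) x) - (LINT x|M. f z0 x)) / (Y i - z0)" for i
      using int[OF YS[of i]] int[OF z0] by simp
    ultimately have "(\<lambda>i. ((LINT x|M. f (Y i) x) - (LINT x|M. f z0 x)) / (Y i - z0)) \<longlonglongrightarrow> (LINT x|M. f' z0 x)"
      by (simp only:)
    then show "((\<lambda>y. ((LINT x|M. f y x) - (LINT x|M. f z0 x)) / (y - z0)) \<circ> X) \<longlonglongrightarrow> (LINT x|M. f' z0 x)"
      unfolding Y_def o_def by (rule LIMSEQ_offset)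
  qed
  then show "(\<lambda>z. LINT x|M. f z x) field_differentiable at z0 within S"
    using field_differentiable_def has_field_derivative_at_within by blast
qed


section \<open>Outer functions\<close>

text \<open>The outer function whose modulus on the circle is \<open>exp (g / 2)\<close>.\<close>

definition exp_outer :: "(complex \<Rightarrow> real) \<Rightarrow> complex \<Rightarrow> complex" where
  "exp_outer g z = exp (1 / 2 * (LINT \<zeta>|circle. complex_of_real (g \<zeta>) * Hker (z * cnj \<zeta>)))"

lemma outer_eq_exp_outer: "outer \<omega> l = exp_outer (\<lambda>\<zeta>. ln (\<omega> \<zeta> - l))"
  by (simp add: fun_eq_iff outer_def exp_outer_def)

lemma Hker_integral_holomorphic:
  fixes g :: "complex \<Rightarrow> complex"
  assumes g: "integrable circle g"
  shows "(\<lambda>z. LINT \<zeta>|circle. g \<zeta> * Hker (z * cnj \<zeta>)) holomorphic_on ball 0 1"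
proof (rule holomorphic_on_integral[where f' = "\<lambda>z \<zeta>. g \<zeta> * (2 * cnj \<zeta> / (1 - z * cnj \<zeta>)\<^sup>2)"])
  have nz: "1 - norm z \<le> norm (1 - z * cnj \<zeta>)" if "norm \<zeta> = 1" for z \<zeta>
    using norm_triangle_ineq2[of 1 "z * cnj \<zeta>"] norm_mult_cnj_circle[OF that, of z] by simp
  show "integrable circle (\<lambda>\<zeta>. g \<zeta> * Hker (z * cnj \<zeta>))" if "z \<in> ball 0 1" for z
    using that by (intro circle_integrable_mult_Hker g) simp
  show "(\<lambda>\<zeta>. g \<zeta> * (2 * cnj \<zeta> / (1 - z * cnj \<zeta>)\<^sup>2)) \<in> borel_measurable circle" if "z \<in> ball 0 1" for z
  proof (rule borel_measurable_times[OF borel_measurable_integrable[OF g] continuous_measurable_circle])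
    have "1 - z * cnj \<zeta> \<noteq> 0" if "norm \<zeta> = 1" for \<zeta> using nz[OF that, of z] \<open>z \<in> ball 0 1\<close> by auto
    then show "continuous_on (sphere 0 1) (\<lambda>\<zeta>. 2 * cnj \<zeta> / (1 - z * cnj \<zeta>)\<^sup>2)"
      by (intro continuous_intros) auto
  qed
  show "AE \<zeta> in circle. \<forall>z\<in>ball 0 1. ((\<lambda>z. g \<zeta> * Hker (z * cnj \<zeta>)) has_field_derivative
      g \<zeta> * (2 * cnj \<zeta> / (1 - z * cnj \<zeta>)\<^sup>2)) (at z)"
  proof (intro AE_I2 ballI)
    fix \<zeta> z :: complex assume "\<zeta> \<in> space circle" "z \<in> ball 0 1"
    then have "1 - z * cnj \<zeta> \<noteq> 0" using nz[of \<zeta> z] by auto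
    then have "((\<lambda>z. Hker (z * cnj \<zeta>)) has_field_derivative 2 * cnj \<zeta> / (1 - z * cnj \<zeta>)\<^sup>2) (at z)"
      unfolding Hker_def by (auto intro!: derivative_eq_intros simp: power2_eq_square field_simps)
    then show "((\<lambda>z. g \<zeta> * Hker (z * cnj \<zeta>)) has_field_derivative g \<zeta> * (2 * cnj \<zeta> / (1 - z * cnj \<zeta>)\<^sup>2)) (at z)"
      by (rule DERIV_cmult)
  qed
  fix z0 :: complex assume "z0 \<in> ball 0 1"
  then have z0: "norm z0 < 1" by simp
  define r where "r = (1 - norm z0) / 2"
  have r: "r > 0" unfolding r_def using z0 by simp
  have nr: "norm z \<le> 1 - r" if "z \<in> cball z0 r" for z
    using that norm_triangle_ineq3[of z z0] unfolding r_def by (simp add: dist_norm norm_minus_commute field_simps)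
  show "\<exists>r>0. \<exists>w. cball z0 r \<subseteq> ball 0 1 \<and> integrable circle w \<and>
    (AE \<zeta> in circle. \<forall>z\<in>cball z0 r. norm (g \<zeta> * (2 * cnj \<zeta> / (1 - z * cnj \<zeta>)\<^sup>2)) \<le> w \<zeta>)"
  proof (intro exI[of _ r] conjI r exI[of _ "\<lambda>\<zeta>. norm (g \<zeta>) * (2 / r\<^sup>2)"])
    show "cball z0 r \<subseteq> ball 0 1" using nr r by (force simp: subset_iff)
    show "integrable circle (\<lambda>\<zeta>. norm (g \<zeta>) * (2 / r\<^sup>2))" using g by simp
    show "AE \<zeta> in circle. \<forall>z\<in>cball z0 r. norm (g \<zeta> * (2 * cnj \<zeta> / (1 - z * cnj \<zeta>)\<^sup>2)) \<le> norm (g \<zeta>) * (2 / r\<^sup>2)"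
    proof (intro AE_I2 ballI)
      fix \<zeta> z assume z: "\<zeta> \<in> space circle" "z \<in> cball z0 r"
      have "r \<le> norm (1 - z * cnj \<zeta>)" using nz[of \<zeta> z] nr[OF z(2)] z(1) by simp
      then have "r\<^sup>2 \<le> (norm (1 - z * cnj \<zeta>))\<^sup>2" using r by (intro power_mono) auto
      then have "2 / (norm (1 - z * cnj \<zeta>))\<^sup>2 \<le> 2 / r\<^sup>2" using r by (intro frac_le) auto
      from mult_left_mono[OF this, of "norm (g \<zeta>)"]
      show "norm (g \<zeta> * (2 * cnj \<zeta> / (1 - z * cnj \<zeta>)\<^sup>2)) \<le> norm (g \<zeta>) * (2 / r\<^sup>2)"
        using z(1) by (simp add: norm_mult norm_divide norm_power)
    qed
  qed
qed

lemma exp_outer_holomorphic: "integrable circle g \<Longrightarrow> exp_outer g holomorphic_on ball 0 1"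
  unfolding exp_outer_def[abs_def]
  by (intro holomorphic_intros Hker_integral_holomorphic) simp

lemma exp_outer_add:
  assumes "integrable circle g" "integrable circle h" "norm z < 1"
  shows "exp_outer (\<lambda>\<zeta>. g \<zeta> + h \<zeta>) z = exp_outer g z * exp_outer h z"
proof -
  have "(LINT \<zeta>|circle. complex_of_real (g \<zeta> + h \<zeta>) * Hker (z * cnj \<zeta>)) =
    (LINT \<zeta>|circle. complex_of_real (g \<zeta>) * Hker (z * cnj \<zeta>)) + (LINT \<zeta>|circle. complex_of_real (h \<zeta>) * Hker (z * cnj \<zeta>))"
    unfolding of_real_add distrib_right using assms
    by (intro Bochner_Integration.integral_add circle_integrable_mult_Hker) simp_all
  then show ?thesis unfolding exp_outer_def by (simp only: distrib_left exp_add)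
qed

lemma exp_outer_uminus: "exp_outer (\<lambda>\<zeta>. - g \<zeta>) z = inverse (exp_outer g z)"
  unfolding exp_outer_def by (simp add: exp_minus)

lemma norm_exp_outer:
  assumes g: "integrable circle g" and z: "norm z < 1"
  shows "norm (exp_outer g z) = exp (1 / 2 * (LINT \<zeta>|circle. g \<zeta> * Re (Hker (z * cnj \<zeta>))))"
proof -
  have "integrable circle (\<lambda>\<zeta>. complex_of_real (g \<zeta>))" using g by simp
  from Bochner_Integration.integral_Re[OF circle_integrable_mult_Hker[OF this z]]
  have "Re (LINT \<zeta>|circle. complex_of_real (g \<zeta>) * Hker (z * cnj \<zeta>)) = (LINT \<zeta>|circle. g \<zeta> * Re (Hker (z * cnj \<zeta>)))"
    by simp
  then show ?thesis unfolding exp_outer_def by (simp add: norm_exp_eq_Re)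
qed

lemma Re_Hker_pos:
  assumes "norm w < 1" shows "0 < Re (Hker w)"
  unfolding Re_Hker using assms by (intro divide_pos_pos) (auto simp: power_less_one_iff)

lemma integral_Re_Hker:
  assumes z: "norm z < 1" shows "(LINT \<zeta>|circle. Re (Hker (z * cnj \<zeta>))) = 1"
proof -
  interpret bounded_holomorphic_disc "\<lambda>_. 1" 1 by unfold_locales auto
  have "complex_of_real (LINT \<zeta>|circle. Re (Hker (z * cnj \<zeta>))) = 1"
    using poisson_scaled[of 0 z] z by (simp flip: integral_of_real)
  then show ?thesis using of_real_eq_1_iff by blast
qed

lemma norm_exp_outer_le:
  assumes g: "integrable circle g" and z: "norm z < 1" and b: "AE \<zeta> in circle. g \<zeta> \<le> B"
  shows "norm (exp_outer g z) \<le> exp (B / 2)"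
proof -
  have "(LINT \<zeta>|circle. g \<zeta> * Re (Hker (z * cnj \<zeta>))) \<le> (LINT \<zeta>|circle. B * Re (Hker (z * cnj \<zeta>)))"
  proof (rule integral_mono_AE)
    show "AE \<zeta> in circle. g \<zeta> * Re (Hker (z * cnj \<zeta>)) \<le> B * Re (Hker (z * cnj \<zeta>))"
      using b AE_space
    proof eventually_elim
      case (elim \<zeta>)
      then have "norm (z * cnj \<zeta>) < 1" using norm_mult_cnj_circle[of \<zeta> z] z by simp
      then have "0 \<le> Re (Hker (z * cnj \<zeta>))" by (intro less_imp_le Re_Hker_pos)
      with elim(1) show ?case by (rule mult_right_mono)
    qed
  qed (intro circle_integrable_mult_Re_Hker g z circle.integrable_const)+
  also have "\<dots> = B" using integral_Re_Hker[OF z] by simp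
  finally show ?thesis unfolding norm_exp_outer[OF g z] by simp
qed

lemma exp_outer_bounded:
  assumes "integrable circle g" "AE \<zeta> in circle. g \<zeta> \<le> B"
  shows "bounded_holomorphic_disc (exp_outer g) (exp (B / 2))"
  using assms by unfold_locales (auto intro: exp_outer_holomorphic norm_exp_outer_le)

text \<open>The modulus is the exponential of a Poisson integral, so its radial limit exists for
  every integrable \<open>g\<close>. Convergence of the function itself, with its phase, is obtained
  below from boundedness of \<open>g\<close> on one side.\<close>

lemma AE_norm_exp_outer_radial:
  assumes g: "integrable circle g"
  shows "AE \<zeta> in circle. ((\<lambda>r. norm (exp_outer g (complex_of_real r * \<zeta>))) \<longlongrightarrow> exp (g \<zeta> / 2)) (at_left 1)"
  using poisson_integral_radial_limit_real[OF g] AE_space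
proof eventually_elim
  case (elim \<zeta>)
  have "((\<lambda>r. exp (1 / 2 * (LINT \<eta>|circle. g \<eta> * Re (Hker (complex_of_real r * \<zeta> * cnj \<eta>))))) \<longlongrightarrow> exp (1 / 2 * g \<zeta>)) (at_left 1)"
    by (intro tendsto_intros elim)
  then have lim: "((\<lambda>r. exp (1 / 2 * (LINT \<eta>|circle. g \<eta> * Re (Hker (complex_of_real r * \<zeta> * cnj \<eta>))))) \<longlongrightarrow> exp (g \<zeta> / 2)) (at_left 1)"
    by simp
  show ?case
  proof (rule Lim_transform_eventually[OF lim], rule eventually_mono[OF eventually_at_left_1])
    fix r :: real assume "0 < r \<and> r < 1"
    then show "exp (1 / 2 * (LINT \<eta>|circle. g \<eta> * Re (Hker (complex_of_real r * \<zeta> * cnj \<eta>)))) = norm (exp_outer g (complex_of_real r * \<zeta>))"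
      using elim by (intro norm_exp_outer[OF g, symmetric]) (simp add: norm_mult)
  qed
qed

lemma AE_exp_outer_boundary_value_above:
  assumes g: "integrable circle g" and b: "AE \<zeta> in circle. g \<zeta> \<le> B"
  shows "AE \<zeta> in circle. ((\<lambda>r. exp_outer g (complex_of_real r * \<zeta>)) \<longlongrightarrow> boundary_value (exp_outer g) \<zeta>) (at_left 1) \<and>
    norm (boundary_value (exp_outer g) \<zeta>) = exp (g \<zeta> / 2)"
proof -
  interpret bounded_holomorphic_disc "exp_outer g" "exp (B / 2)" by (rule exp_outer_bounded[OF g b])
  show ?thesis using AE_boundary_value AE_norm_exp_outer_radial[OF g]
  proof eventually_elim
    case (elim \<zeta>)
    then show ?case using tendsto_unique[OF _ tendsto_norm] trivial_limit_at_left_real by blast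
  qed
qed

text \<open>The reciprocal is the outer function of - g, which is bounded above. Its radial limit
  has modulus exp (- g/2) and is therefore nonzero, so inverting preserves the limit.\<close>

lemma AE_exp_outer_boundary_value_below:
  assumes g: "integrable circle g" and b: "AE \<zeta> in circle. B \<le> g \<zeta>"
  shows "AE \<zeta> in circle. ((\<lambda>r. exp_outer g (complex_of_real r * \<zeta>)) \<longlongrightarrow> boundary_value (exp_outer g) \<zeta>) (at_left 1) \<and>
    norm (boundary_value (exp_outer g) \<zeta>) = exp (g \<zeta> / 2)"
proof -
  have g': "integrable circle (\<lambda>\<zeta>. - g \<zeta>)" and b': "AE \<zeta> in circle. - g \<zeta> \<le> - B" using g b by auto
  show ?thesis using AE_exp_outer_boundary_value_above[OF g' b'] AE_norm_exp_outer_radial[OF g]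
  proof eventually_elim
    case (elim \<zeta>)
    let ?b = "boundary_value (exp_outer (\<lambda>\<zeta>. - g \<zeta>)) \<zeta>"
    have "?b \<noteq> 0" using elim(1) by auto
    then have "((\<lambda>r. inverse (exp_outer (\<lambda>\<zeta>. - g \<zeta>) (complex_of_real r * \<zeta>))) \<longlongrightarrow> inverse ?b) (at_left 1)"
      using elim(1) by (intro tendsto_inverse) auto
    then have l: "((\<lambda>r. exp_outer g (complex_of_real r * \<zeta>)) \<longlongrightarrow> inverse ?b) (at_left 1)"
      by (simp add: exp_outer_uminus)
    then have "boundary_value (exp_outer g) \<zeta> = inverse ?b" by (rule boundary_value_eqI)
    moreover have "norm (inverse ?b) = exp (g \<zeta> / 2)"
      by (rule tendsto_unique[OF _ tendsto_norm[OF l] elim(2)]) simp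
    ultimately show ?case using l by simp
  qed
qed

section \<open>The resolvent of the Toeplitz operator on reproducing kernels\<close>

lemma ip_add_left:
  assumes "f \<in> L2" "g \<in> L2" "h \<in> L2" shows "ip (\<lambda>\<zeta>. f \<zeta> + g \<zeta>) h = ip f h + ip g h"
  unfolding ip_def distrib_right using assms by (intro Bochner_Integration.integral_add L2_integrable_ip)

lemma ip_cmult_left: "ip (\<lambda>\<zeta>. c * f \<zeta>) h = c * ip f h"
  unfolding ip_def by (simp add: mult.assoc)

lemma ip_cnj: "cnj (ip f g) = ip g f"
  unfolding ip_def by (simp add: mult.commute flip: Bochner_Integration.integral_cnj)

lemma ip_cong_AE:
  assumes "f \<in> L2" "g \<in> L2" "f' \<in> L2" "g' \<in> L2" "AE \<zeta> in circle. f \<zeta> = f' \<zeta>" "AE \<zeta> in circle. g \<zeta> = g' \<zeta>"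
  shows "ip f g = ip f' g'"
  unfolding ip_def
proof (rule integral_cong_AE)
  show "AE \<zeta> in circle. f \<zeta> * cnj (g \<zeta>) = f' \<zeta> * cnj (g' \<zeta>)"
    using assms(5,6) by eventually_elim simp
qed (use assms L2_integrable_ip in \<open>auto intro!: borel_measurable_integrable\<close>)

lemma ip_self: "f \<in> L2 \<Longrightarrow> ip f f = complex_of_real (LINT \<zeta>|circle. (norm (f \<zeta>))\<^sup>2)"
  unfolding ip_def complex_norm_square[symmetric] by (rule integral_complex_of_real)

lemma abs_ln_le:
  fixes c x :: real
  assumes "0 < c" "c \<le> x" shows "\<bar>ln x\<bar> \<le> \<bar>ln c\<bar> + x"
proof -
  have "ln x \<le> x" using ln_le_minus_one[of x] assms by simp
  moreover have "ln c \<le> ln x" using assms by simp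
  ultimately show ?thesis using assms by linarith
qed

section \<open>Factorization of the Toeplitz form by the outer function\<close>

locale semibounded_symbol =
  fixes \<omega> :: "complex \<Rightarrow> real"
  assumes integrable_symbol: "integrable circle \<omega>"
    and essinf_symbol: "essinf circle \<omega> > -\<infinity>"
begin

definition \<gamma> :: real where "\<gamma> = real_of_ereal (essinf circle \<omega>)"

lemma AE_essinf_le: "AE \<zeta> in circle. essinf circle \<omega> \<le> ereal (\<omega> \<zeta>)"
proof -
  have "AE \<zeta> in circle. ereal (- \<omega> \<zeta>) \<le> esssup circle (\<lambda>\<zeta>. ereal (- \<omega> \<zeta>))" by (rule esssup_AE)
  then show ?thesis
  proof eventually_elim
    case (elim \<zeta>)
    then have "- esssup circle (\<lambda>\<zeta>. ereal (- \<omega> \<zeta>)) \<le> - ereal (- \<omega> \<zeta>)" by (simp only: ereal_minus_le_minus)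
    then show ?case by (simp add: essinf_def)
  qed
qed

lemma essinf_eq: "essinf circle \<omega> = ereal \<gamma>"
proof -
  have "essinf circle \<omega> \<noteq> \<infinity>"
  proof
    assume "essinf circle \<omega> = \<infinity>"
    then have "AE \<zeta> in circle. False" using AE_essinf_le by simp
    then show False using circle.AE_False by simp
  qed
  then show ?thesis unfolding \<gamma>_def using essinf_symbol by (cases "essinf circle \<omega>") auto
qed

lemma AE_symbol_ge: "AE \<zeta> in circle. \<gamma> \<le> \<omega> \<zeta>"
  using AE_essinf_le unfolding essinf_eq by simp

lemma symbol_measurable: "\<omega> \<in> borel_measurable circle"
  using integrable_symbol by (rule borel_measurable_integrable)

abbreviation lg :: "real \<Rightarrow> complex \<Rightarrow> real" where "lg l \<zeta> \<equiv> ln (\<omega> \<zeta> - l)"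

lemma integrable_lg:
  assumes l: "l < \<gamma>" shows "integrable circle (lg l)"
proof (rule Bochner_Integration.integrable_bound)
  show "integrable circle (\<lambda>\<zeta>. \<bar>ln (\<gamma> - l)\<bar> + (\<omega> \<zeta> - l))" using integrable_symbol by simp
  show "lg l \<in> borel_measurable circle" using symbol_measurable by measurable
  show "AE \<zeta> in circle. norm (lg l \<zeta>) \<le> norm (\<bar>ln (\<gamma> - l)\<bar> + (\<omega> \<zeta> - l))"
    using AE_symbol_ge
  proof eventually_elim
    case (elim \<zeta>)
    then show ?case using abs_ln_le[of "\<gamma> - l" "\<omega> \<zeta> - l"] l by simp
  qed
qed

lemma AE_lg_ge:
  assumes l: "l < \<gamma>" shows "AE \<zeta> in circle. ln (\<gamma> - l) \<le> lg l \<zeta>"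
  using AE_symbol_ge by eventually_elim (use l in simp)

text \<open>The reciprocal is written as an outer function in its own right, because it is bounded
  on the disc and falls under \<open>bounded_holomorphic_disc\<close>.\<close>

definition inv_outer :: "real \<Rightarrow> complex \<Rightarrow> complex" where
  "inv_outer l = exp_outer (\<lambda>\<zeta>. - lg l \<zeta>)"

lemma inv_outer_eq: "inv_outer l z = inverse (outer \<omega> l z)"
  unfolding inv_outer_def outer_eq_exp_outer by (rule exp_outer_uminus)

lemma inv_outer_bounded:
  assumes l: "l < \<gamma>" shows "bounded_holomorphic_disc (inv_outer l) (exp (- ln (\<gamma> - l) / 2))"
  unfolding inv_outer_def
proof (rule exp_outer_bounded)
  show "AE \<zeta> in circle. - lg l \<zeta> \<le> - ln (\<gamma> - l)" using AE_lg_ge[OF l] by eventually_elim simp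
qed (use integrable_lg[OF l] in simp)

text \<open>Collects on one null set the relations among the boundary values of F and 1/F and the
  symbol, so that later identities hold almost everywhere by algebra.\<close>

lemma AE_outer_boundary:
  assumes l: "l < \<gamma>"
  shows "AE \<zeta> in circle. ((\<lambda>r. outer \<omega> l (complex_of_real r * \<zeta>)) \<longlongrightarrow> boundary_value (outer \<omega> l) \<zeta>) (at_left 1) \<and>
    boundary_value (outer \<omega> l) \<zeta> * cnj (boundary_value (outer \<omega> l) \<zeta>) = complex_of_real (\<omega> \<zeta> - l) \<and>
    boundary_value (outer \<omega> l) \<zeta> \<noteq> 0 \<and>
    boundary_value (inv_outer l) \<zeta> = inverse (boundary_value (outer \<omega> l) \<zeta>)"
  unfolding outer_eq_exp_outer
  using AE_exp_outer_boundary_value_below[OF integrable_lg[OF l] AE_lg_ge[OF l]] AE_symbol_ge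
proof eventually_elim
  case (elim \<zeta>)
  let ?b = "boundary_value (exp_outer (lg l)) \<zeta>"
  have nz: "?b \<noteq> 0" using elim(1) by auto
  have "((\<lambda>r. inverse (exp_outer (lg l) (complex_of_real r * \<zeta>))) \<longlongrightarrow> inverse ?b) (at_left 1)"
    using nz elim(1) by (intro tendsto_inverse) auto
  then have "boundary_value (inv_outer l) \<zeta> = inverse ?b"
    unfolding inv_outer_def by (intro boundary_value_eqI) (simp add: exp_outer_uminus)
  moreover have "?b * cnj ?b = complex_of_real (\<omega> \<zeta> - l)"
  proof -
    have "(norm ?b)\<^sup>2 = exp (lg l \<zeta> / 2) * exp (lg l \<zeta> / 2)" using elim(1) by (simp add: power2_eq_square)
    also have "\<dots> = \<omega> \<zeta> - l" using elim(2) l by (simp add: exp_add[symmetric])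
    finally show ?thesis by (simp only: complex_norm_square[symmetric] of_real_power)
  qed
  ultimately show ?case using nz elim(1) by simp
qed

lemma outer_boundary_measurable:
  assumes l: "l < \<gamma>" shows "boundary_value (outer \<omega> l) \<in> borel_measurable circle"
  unfolding outer_eq_exp_outer
  by (intro borel_measurable_boundary_value holomorphic_on_imp_continuous_on exp_outer_holomorphic integrable_lg l)

lemma form_domainD:
  assumes "f \<in> form_domain \<omega>"
  shows "f \<in> H2" and "\<And>l. l < \<gamma> \<Longrightarrow> (\<lambda>\<zeta>. boundary_value (outer \<omega> l) \<zeta> * f \<zeta>) \<in> H2"
  using assms unfolding form_domain_def essinf_eq by auto

lemma form_domainI:
  assumes "f \<in> H2" "\<And>l. l < \<gamma> \<Longrightarrow> (\<lambda>\<zeta>. boundary_value (outer \<omega> l) \<zeta> * f \<zeta>) \<in> H2"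
  shows "f \<in> form_domain \<omega>"
  using assms unfolding form_domain_def essinf_eq by auto

lemma form_domain_lincomb:
  assumes f: "f \<in> form_domain \<omega>" and g: "g \<in> form_domain \<omega>"
  shows "(\<lambda>\<zeta>. f \<zeta> + c * g \<zeta>) \<in> form_domain \<omega>"
proof (rule form_domainI)
  show "(\<lambda>\<zeta>. f \<zeta> + c * g \<zeta>) \<in> H2"
    by (intro H2_add H2_cmult form_domainD(1) f g)
  fix l assume l: "l < \<gamma>"
  have "(\<lambda>\<zeta>. boundary_value (outer \<omega> l) \<zeta> * f \<zeta> + c * (boundary_value (outer \<omega> l) \<zeta> * g \<zeta>)) \<in> H2"
    by (intro H2_add H2_cmult form_domainD(2) f g l)
  then show "(\<lambda>\<zeta>. boundary_value (outer \<omega> l) \<zeta> * (f \<zeta> + c * g \<zeta>)) \<in> H2"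
    by (simp add: distrib_left mult.left_commute)
qed

lemma AE_shifted_form:
  assumes l: "l < \<gamma>"
  shows "AE \<zeta> in circle. (boundary_value (outer \<omega> l) \<zeta> * f \<zeta>) * cnj (boundary_value (outer \<omega> l) \<zeta> * g \<zeta>) =
    complex_of_real (\<omega> \<zeta>) * f \<zeta> * cnj (g \<zeta>) - complex_of_real l * (f \<zeta> * cnj (g \<zeta>))"
  using AE_outer_boundary[OF l]
proof eventually_elim
  case (elim \<zeta>)
  let ?b = "boundary_value (outer \<omega> l) \<zeta>"
  have "(?b * f \<zeta>) * cnj (?b * g \<zeta>) = (?b * cnj ?b) * (f \<zeta> * cnj (g \<zeta>))" by (simp add: mult_ac)
  also have "?b * cnj ?b = complex_of_real (\<omega> \<zeta>) - complex_of_real l" using elim by simp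
  finally show ?case by (simp add: left_diff_distrib mult.assoc)
qed

text \<open>Since \<bar>F\<bar>^2 = \<omega> - l on the circle, the form shifted by l is the inner
  product of F f and F g. Integrability of the form is a conclusion here: \<omega> need not be
  bounded, and the product is integrable because F f and F g are in \<open>L2\<close>.\<close>

lemma toeplitz_form_shift:
  assumes l: "l < \<gamma>" and f: "f \<in> L2" and g: "g \<in> L2"
    and bf: "(\<lambda>\<zeta>. boundary_value (outer \<omega> l) \<zeta> * f \<zeta>) \<in> L2"
    and bg: "(\<lambda>\<zeta>. boundary_value (outer \<omega> l) \<zeta> * g \<zeta>) \<in> L2"
  shows "integrable circle (\<lambda>\<zeta>. complex_of_real (\<omega> \<zeta>) * f \<zeta> * cnj (g \<zeta>))"
    and "toeplitz_form \<omega> f g = complex_of_real l * ip f g +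
      ip (\<lambda>\<zeta>. boundary_value (outer \<omega> l) \<zeta> * f \<zeta>) (\<lambda>\<zeta>. boundary_value (outer \<omega> l) \<zeta> * g \<zeta>)"
proof -
  let ?b = "boundary_value (outer \<omega> l)"
  have i1: "integrable circle (\<lambda>\<zeta>. complex_of_real l * (f \<zeta> * cnj (g \<zeta>)))"
    by (intro integrable_mult_right L2_integrable_ip f g)
  have i2: "integrable circle (\<lambda>\<zeta>. (?b \<zeta> * f \<zeta>) * cnj (?b \<zeta> * g \<zeta>))"
    by (rule L2_integrable_ip[OF bf bg])
  have m: "(\<lambda>\<zeta>. complex_of_real (\<omega> \<zeta>) * f \<zeta> * cnj (g \<zeta>)) \<in> borel_measurable circle"
    by (intro borel_measurable_times measurable_compose[OF symbol_measurable]
        L2_measurable[OF f] L2_measurable[OF L2_cnj[OF g]]) (intro borel_measurable_continuous_onI continuous_intros)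
  have ae: "AE \<zeta> in circle. complex_of_real l * (f \<zeta> * cnj (g \<zeta>)) + (?b \<zeta> * f \<zeta>) * cnj (?b \<zeta> * g \<zeta>) =
      complex_of_real (\<omega> \<zeta>) * f \<zeta> * cnj (g \<zeta>)"
    using AE_shifted_form[OF l, of f g] by eventually_elim simp
  have i3: "integrable circle (\<lambda>\<zeta>. complex_of_real l * (f \<zeta> * cnj (g \<zeta>)) + (?b \<zeta> * f \<zeta>) * cnj (?b \<zeta> * g \<zeta>))"
    by (intro Bochner_Integration.integrable_add i1 i2)
  show "integrable circle (\<lambda>\<zeta>. complex_of_real (\<omega> \<zeta>) * f \<zeta> * cnj (g \<zeta>))"
    using integrable_cong_AE_imp[OF i3 m] ae by (auto elim: eventually_mono)
  have "toeplitz_form \<omega> f g = (LINT \<zeta>|circle. complex_of_real l * (f \<zeta> * cnj (g \<zeta>)) + (?b \<zeta> * f \<zeta>) * cnj (?b \<zeta> * g \<zeta>))"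
    unfolding toeplitz_form_def using ae
    by (intro integral_cong_AE m borel_measurable_integrable[OF i3]) (auto elim: eventually_mono)
  also have "\<dots> = complex_of_real l * ip f g + ip (\<lambda>\<zeta>. ?b \<zeta> * f \<zeta>) (\<lambda>\<zeta>. ?b \<zeta> * g \<zeta>)"
    unfolding ip_def Bochner_Integration.integral_add[OF i1 i2] by (simp only: integral_mult_right_zero)
  finally show "toeplitz_form \<omega> f g = complex_of_real l * ip f g + ip (\<lambda>\<zeta>. ?b \<zeta> * f \<zeta>) (\<lambda>\<zeta>. ?b \<zeta> * g \<zeta>)" .
qed

lemma form_domain_shift:
  assumes l: "l < \<gamma>" and f: "f \<in> form_domain \<omega>" and g: "g \<in> form_domain \<omega>"
  shows "integrable circle (\<lambda>\<zeta>. complex_of_real (\<omega> \<zeta>) * f \<zeta> * cnj (g \<zeta>))"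
    and "toeplitz_form \<omega> f g = complex_of_real l * ip f g +
      ip (\<lambda>\<zeta>. boundary_value (outer \<omega> l) \<zeta> * f \<zeta>) (\<lambda>\<zeta>. boundary_value (outer \<omega> l) \<zeta> * g \<zeta>)"
  by (intro toeplitz_form_shift[OF l] H2_L2 form_domainD(1)[OF f] form_domainD(1)[OF g]
      form_domainD(2)[OF f l] form_domainD(2)[OF g l])+

lemma toeplitzD:
  assumes "(f, h) \<in> toeplitz \<omega>"
  shows "f \<in> form_domain \<omega>" "h \<in> H2" "\<And>g. g \<in> form_domain \<omega> \<Longrightarrow> ip h g = toeplitz_form \<omega> f g"
  using assms unfolding toeplitz_def by simp_all

lemma toeplitz_lincomb:
  assumes 1: "(f1, h1) \<in> toeplitz \<omega>" and 2: "(f2, h2) \<in> toeplitz \<omega>"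
  shows "((\<lambda>\<zeta>. f1 \<zeta> + c * f2 \<zeta>), (\<lambda>\<zeta>. h1 \<zeta> + c * h2 \<zeta>)) \<in> toeplitz \<omega>"
proof -
  have f: "f1 \<in> form_domain \<omega>" "f2 \<in> form_domain \<omega>" and h: "h1 \<in> H2" "h2 \<in> H2"
    using toeplitzD[OF 1] toeplitzD[OF 2] by blast+
  have "ip (\<lambda>\<zeta>. h1 \<zeta> + c * h2 \<zeta>) g = toeplitz_form \<omega> (\<lambda>\<zeta>. f1 \<zeta> + c * f2 \<zeta>) g" if g: "g \<in> form_domain \<omega>" for g
  proof -
    have "ip (\<lambda>\<zeta>. h1 \<zeta> + c * h2 \<zeta>) g = ip h1 g + c * ip h2 g"
      using ip_add_left[OF H2_L2[OF h(1)] L2_cmult[OF H2_L2[OF h(2)]] H2_L2[OF form_domainD(1)[OF g]]]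
      by (simp add: ip_cmult_left)
    also have "\<dots> = toeplitz_form \<omega> f1 g + c * toeplitz_form \<omega> f2 g"
      by (simp only: toeplitzD(3)[OF 1 g] toeplitzD(3)[OF 2 g])
    also have "\<dots> = toeplitz_form \<omega> (\<lambda>\<zeta>. f1 \<zeta> + c * f2 \<zeta>) g"
    proof -
      have l: "\<gamma> - 1 < \<gamma>" by simp
      have "(LINT \<zeta>|circle. complex_of_real (\<omega> \<zeta>) * (f1 \<zeta> + c * f2 \<zeta>) * cnj (g \<zeta>)) =
        (LINT \<zeta>|circle. complex_of_real (\<omega> \<zeta>) * f1 \<zeta> * cnj (g \<zeta>) + c * (complex_of_real (\<omega> \<zeta>) * f2 \<zeta> * cnj (g \<zeta>)))"
      proof (rule Bochner_Integration.integral_cong[OF refl])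
        fix \<zeta>
        show "complex_of_real (\<omega> \<zeta>) * (f1 \<zeta> + c * f2 \<zeta>) * cnj (g \<zeta>) =
          complex_of_real (\<omega> \<zeta>) * f1 \<zeta> * cnj (g \<zeta>) + c * (complex_of_real (\<omega> \<zeta>) * f2 \<zeta> * cnj (g \<zeta>))"
          by (simp add: algebra_simps)
      qed
      also have "\<dots> = (LINT \<zeta>|circle. complex_of_real (\<omega> \<zeta>) * f1 \<zeta> * cnj (g \<zeta>)) + (LINT \<zeta>|circle. c * (complex_of_real (\<omega> \<zeta>) * f2 \<zeta> * cnj (g \<zeta>)))"
        by (intro Bochner_Integration.integral_add integrable_mult_right form_domain_shift[OF l] f g)
      finally show ?thesis unfolding toeplitz_form_def by (simp only: integral_mult_right_zero)
    qed
    finally show ?thesis .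
  qed
  then show ?thesis unfolding toeplitz_def using form_domain_lincomb[OF f] H2_add[OF h(1) H2_cmult[OF h(2)]] by simp
qed

lemma toeplitz_bounded_below:
  assumes "(f, h) \<in> toeplitz \<omega>" and l: "l < \<gamma>"
  shows "l * Re (ip f f) \<le> Re (ip h f)"
proof -
  have f: "f \<in> form_domain \<omega>" by (rule toeplitzD[OF assms(1)])
  let ?b = "\<lambda>\<zeta>. boundary_value (outer \<omega> l) \<zeta> * f \<zeta>"
  have "ip h f = complex_of_real l * ip f f + ip ?b ?b"
    by (simp only: toeplitzD(3)[OF assms(1) f] form_domain_shift(2)[OF l f f])
  moreover have "0 \<le> Re (ip ?b ?b)"
    using ip_self[OF H2_L2[OF form_domainD(2)[OF f l]]] by simp
  ultimately show ?thesis by simp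
qed

definition resolvent_Kker :: "real \<Rightarrow> complex \<Rightarrow> complex \<Rightarrow> complex" where
  "resolvent_Kker l u \<zeta> = cnj (inv_outer l u) * (boundary_value (inv_outer l) \<zeta> * Kker u \<zeta>)"

lemma resolvent_Kker_H2:
  assumes l: "l < \<gamma>" and u: "norm u < 1"
  shows "resolvent_Kker l u \<in> H2"
proof -
  interpret bounded_holomorphic_disc "inv_outer l" "exp (- ln (\<gamma> - l) / 2)" by (rule inv_outer_bounded[OF l])
  show ?thesis unfolding resolvent_Kker_def[abs_def] by (intro H2_cmult mult_H2 Kker_H2 u)
qed

text \<open>The form domain imposes its condition for every k below \<gamma>. Multiplying by F_k
  leaves the quotient F_k / F_l times K_u, and the quotient is a bounded outer function, so it maps
  \<open>H2\<close> into itself.\<close>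

lemma resolvent_Kker_form_domain:
  assumes l: "l < \<gamma>" and u: "norm u < 1"
  shows "resolvent_Kker l u \<in> form_domain \<omega>"
proof (rule form_domainI[OF resolvent_Kker_H2[OF l u]])
  fix k assume k: "k < \<gamma>"
  \<comment> \<open>From (\<omega> - k) / (\<omega> - l) = 1 + (l - k) / (\<omega> - l) and \<omega>
    - l \<ge> \<gamma> - l.\<close>
  define B where "B = ln (1 + \<bar>l - k\<bar> / (\<gamma> - l))"
  let ?g = "\<lambda>\<zeta>. lg k \<zeta> + - lg l \<zeta>"
  have gi: "integrable circle ?g" using integrable_lg[OF l] integrable_lg[OF k] by simp
  have "AE \<zeta> in circle. ?g \<zeta> \<le> B"
    using AE_symbol_ge
  proof eventually_elim
    case (elim \<zeta>)
    have p: "0 < \<omega> \<zeta> - l" "0 < \<omega> \<zeta> - k" using elim l k by auto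
    have "?g \<zeta> = ln ((\<omega> \<zeta> - k) / (\<omega> \<zeta> - l))" using p by (simp add: ln_div)
    also have "(\<omega> \<zeta> - k) / (\<omega> \<zeta> - l) = 1 + (l - k) / (\<omega> \<zeta> - l)" using p by (simp add: field_simps)
    also have "ln \<dots> \<le> B"
    proof -
      have "(l - k) / (\<omega> \<zeta> - l) \<le> \<bar>l - k\<bar> / (\<gamma> - l)"
        using elim l p by (intro frac_le) auto
      moreover have "1 + (l - k) / (\<omega> \<zeta> - l) > 0" using p by (simp add: field_simps)
      ultimately show ?thesis unfolding B_def by simp
    qed
    finally show ?case .
  qed
  from exp_outer_bounded[OF gi this] interpret R: bounded_holomorphic_disc "exp_outer ?g" "exp (B / 2)" .
  have "(\<lambda>\<zeta>. cnj (inv_outer l u) * (boundary_value (exp_outer ?g) \<zeta> * Kker u \<zeta>)) \<in> H2"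
    by (intro H2_cmult R.mult_H2 Kker_H2 u)
  then show "(\<lambda>\<zeta>. boundary_value (outer \<omega> k) \<zeta> * resolvent_Kker l u \<zeta>) \<in> H2"
  proof (rule H2_cong_AE)
    show "(\<lambda>\<zeta>. boundary_value (outer \<omega> k) \<zeta> * resolvent_Kker l u \<zeta>) \<in> borel_measurable circle"
      by (intro borel_measurable_times outer_boundary_measurable k L2_measurable H2_L2 resolvent_Kker_H2 l u)
    show "AE \<zeta> in circle. cnj (inv_outer l u) * (boundary_value (exp_outer ?g) \<zeta> * Kker u \<zeta>) =
      boundary_value (outer \<omega> k) \<zeta> * resolvent_Kker l u \<zeta>"
      using AE_outer_boundary[OF k] AE_outer_boundary[OF l] AE_space
    proof eventually_elim
      case (elim \<zeta>)
      have "((\<lambda>r. outer \<omega> k (complex_of_real r * \<zeta>) * inverse (outer \<omega> l (complex_of_real r * \<zeta>))) \<longlongrightarrow>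
        boundary_value (outer \<omega> k) \<zeta> * inverse (boundary_value (outer \<omega> l) \<zeta>)) (at_left 1)"
        using elim by (intro tendsto_mult tendsto_inverse) auto
      then have "((\<lambda>r. exp_outer ?g (complex_of_real r * \<zeta>)) \<longlongrightarrow>
        boundary_value (outer \<omega> k) \<zeta> * inverse (boundary_value (outer \<omega> l) \<zeta>)) (at_left 1)"
      proof (rule Lim_transform_eventually, intro eventually_mono[OF eventually_at_left_1])
        fix r :: real assume "0 < r \<and> r < 1"
        then have "norm (complex_of_real r * \<zeta>) < 1" using elim(3) by (simp add: norm_mult)
        then show "outer \<omega> k (complex_of_real r * \<zeta>) * inverse (outer \<omega> l (complex_of_real r * \<zeta>)) = exp_outer ?g (complex_of_real r * \<zeta>)"
          using integrable_lg[OF l] integrable_lg[OF k]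
          by (subst exp_outer_add) (simp_all add: outer_eq_exp_outer exp_outer_uminus)
      qed
      then have "boundary_value (exp_outer ?g) \<zeta> = boundary_value (outer \<omega> k) \<zeta> * inverse (boundary_value (outer \<omega> l) \<zeta>)"
        by (rule boundary_value_eqI)
      then show ?case unfolding resolvent_Kker_def using elim by (simp add: mult_ac)
    qed
  qed
qed

text \<open>With f = \<open>resolvent_Kker l u\<close>, F f is a constant multiple of K_u, the
  constant being the conjugate of (1/F)(u). Against F g this constant is absorbed by the adjoint of
  multiplication by 1/F, which turns F g back into g; hence (F f, F g) = (K_u, g). Together with the
  shifted form this is the equation T f = K_u + l f.\<close>

theorem resolvent_Kker_toeplitz:
  assumes l: "l < \<gamma>" and u: "norm u < 1"
  shows "(resolvent_Kker l u, \<lambda>\<zeta>. Kker u \<zeta> + complex_of_real l * resolvent_Kker l u \<zeta>) \<in> toeplitz \<omega>"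
proof -
  interpret R: bounded_holomorphic_disc "inv_outer l" "exp (- ln (\<gamma> - l) / 2)" by (rule inv_outer_bounded[OF l])
  let ?f = "resolvent_Kker l u" and ?b = "boundary_value (outer \<omega> l)"
  have fd: "?f \<in> form_domain \<omega>" by (rule resolvent_Kker_form_domain[OF l u])
  have "ip (\<lambda>\<zeta>. Kker u \<zeta> + complex_of_real l * ?f \<zeta>) g = toeplitz_form \<omega> ?f g" if g: "g \<in> form_domain \<omega>" for g
  proof -
    have gH: "g \<in> H2" and bg: "(\<lambda>\<zeta>. ?b \<zeta> * g \<zeta>) \<in> H2" using form_domainD[OF g] l by auto
    have bf: "(\<lambda>\<zeta>. ?b \<zeta> * ?f \<zeta>) \<in> H2" using form_domainD[OF fd] l by auto
    have "ip g (Kker u) = ip (\<lambda>\<zeta>. boundary_value (inv_outer l) \<zeta> * (?b \<zeta> * g \<zeta>)) (Kker u)"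
    proof (rule ip_cong_AE)
      show "AE \<zeta> in circle. g \<zeta> = boundary_value (inv_outer l) \<zeta> * (?b \<zeta> * g \<zeta>)"
        using AE_outer_boundary[OF l] by eventually_elim simp
    qed (fact H2_L2[OF gH] H2_L2[OF Kker_H2[OF u]] H2_L2[OF R.mult_H2[OF bg]] | simp)+
    also have "\<dots> = inv_outer l u * ip (\<lambda>\<zeta>. ?b \<zeta> * g \<zeta>) (Kker u)" by (rule R.ip_mult_Kker[OF bg u])
    finally have gK: "ip g (Kker u) = inv_outer l u * ip (\<lambda>\<zeta>. ?b \<zeta> * g \<zeta>) (Kker u)" .
    have "ip (\<lambda>\<zeta>. ?b \<zeta> * ?f \<zeta>) (\<lambda>\<zeta>. ?b \<zeta> * g \<zeta>) = ip (\<lambda>\<zeta>. cnj (inv_outer l u) * Kker u \<zeta>) (\<lambda>\<zeta>. ?b \<zeta> * g \<zeta>)"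
    proof (rule ip_cong_AE)
      show "AE \<zeta> in circle. ?b \<zeta> * ?f \<zeta> = cnj (inv_outer l u) * Kker u \<zeta>"
        using AE_outer_boundary[OF l] by eventually_elim (simp add: resolvent_Kker_def)
    qed (auto intro: H2_L2 bf bg H2_cmult Kker_H2[OF u])
    also have "\<dots> = cnj (inv_outer l u * ip (\<lambda>\<zeta>. ?b \<zeta> * g \<zeta>) (Kker u))" by (simp add: ip_cmult_left ip_cnj)
    also have "\<dots> = ip (Kker u) g" unfolding gK[symmetric] by (rule ip_cnj)
    finally have "toeplitz_form \<omega> ?f g = complex_of_real l * ip ?f g + ip (Kker u) g"
      using form_domain_shift(2)[OF l fd g] by simp
    moreover have "ip (\<lambda>\<zeta>. Kker u \<zeta> + complex_of_real l * ?f \<zeta>) g = ip (Kker u) g + complex_of_real l * ip ?f g"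
      using ip_add_left[OF H2_L2[OF Kker_H2[OF u]] L2_cmult[OF H2_L2[OF form_domainD(1)[OF fd]]] H2_L2[OF gH]]
      by (simp add: ip_cmult_left)
    ultimately show ?thesis by simp
  qed
  then show ?thesis
    unfolding toeplitz_def using fd H2_add[OF Kker_H2[OF u] H2_cmult[OF form_domainD(1)[OF fd]]] by simp
qed

lemma ip_resolvent_Kker:
  assumes l: "l < \<gamma>" and u: "norm u < 1" and v: "norm v < 1"
  shows "ip (resolvent_Kker l u) (Kker v) = inverse (1 - cnj u * v) * cnj (inv_outer l u) * inv_outer l v"
proof -
  interpret R: bounded_holomorphic_disc "inv_outer l" "exp (- ln (\<gamma> - l) / 2)" by (rule inv_outer_bounded[OF l])
  show ?thesis
    unfolding resolvent_Kker_def[abs_def] ip_cmult_left R.ip_mult_Kker[OF Kker_H2[OF u] v] ip_Kker_Kker[OF u v]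
    by (simp add: mult_ac)
qed

end

section \<open>Spectral measures\<close>

text \<open>States that M is the sum of M1 and M2 without constructing a sum of measures. It is the
  device by which a difference of two positive measures is integrated without leaving nonnegative
  functions: the subtracted one is put on the other side.\<close>

lemma nn_integral_add_measure:
  assumes s: "sets M1 = sets M" "sets M2 = sets M"
    and add: "\<And>Y. Y \<in> sets M \<Longrightarrow> emeasure M1 Y + emeasure M2 Y = emeasure M Y"
    and f: "f \<in> borel_measurable M"
  shows "(\<integral>\<^sup>+x. f x \<partial>M1) + (\<integral>\<^sup>+x. f x \<partial>M2) = (\<integral>\<^sup>+x. f x \<partial>M)"
  using f
proof (induction rule: borel_measurable_induct)
  case (cong f g)
  then have "(\<integral>\<^sup>+x. f x \<partial>N) = (\<integral>\<^sup>+x. g x \<partial>N)" if "sets N = sets M" for N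
    using sets_eq_imp_space_eq[OF that] by (intro nn_integral_cong) auto
  then show ?case using cong s by metis
next
  case (set A)
  then show ?case using add s by simp
next
  case (mult u c)
  have "u \<in> borel_measurable M1" "u \<in> borel_measurable M2"
    using mult(2) measurable_cong_sets[OF s(1) refl, of borel] measurable_cong_sets[OF s(2) refl, of borel] by blast+
  then show ?case using mult by (simp add: nn_integral_cmult distrib_left[symmetric])
next
  case (add u v)
  have "u \<in> borel_measurable M1" "u \<in> borel_measurable M2" "v \<in> borel_measurable M1" "v \<in> borel_measurable M2"
    using add measurable_cong_sets[OF s(1) refl, of borel] measurable_cong_sets[OF s(2) refl, of borel] by blast+
  then show ?case using add by (simp add: nn_integral_add ac_simps)
next
  case (seq U)
  have m: "U i \<in> borel_measurable M1" "U i \<in> borel_measurable M2" for i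
    using seq(1) measurable_cong_sets[OF s(1) refl, of borel] measurable_cong_sets[OF s(2) refl, of borel] by blast+
  have S: "(SUP i. U i) = (\<lambda>x. SUP i. U i x)" by (simp add: fun_eq_iff image_comp)
  have inc: "incseq (\<lambda>i. \<integral>\<^sup>+x. U i x \<partial>N)" for N
    using seq(3) by (auto simp: incseq_def le_fun_def intro!: nn_integral_mono)
  have "(\<integral>\<^sup>+x. (SUP i. U i) x \<partial>M1) + (\<integral>\<^sup>+x. (SUP i. U i) x \<partial>M2) =
      (SUP i. \<integral>\<^sup>+x. U i x \<partial>M1) + (SUP i. \<integral>\<^sup>+x. U i x \<partial>M2)"
    unfolding S using m seq(3) by (simp add: nn_integral_monotone_convergence_SUP)
  also have "\<dots> = (SUP i. (\<integral>\<^sup>+x. U i x \<partial>M1) + (\<integral>\<^sup>+x. U i x \<partial>M2))"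
    by (intro ennreal_SUP_add[symmetric] inc)
  also have "\<dots> = (SUP i. \<integral>\<^sup>+x. U i x \<partial>M)" by (simp only: seq.IH)
  also have "\<dots> = (\<integral>\<^sup>+x. (SUP i. U i) x \<partial>M)"
    unfolding S using seq(1,3) by (simp add: nn_integral_monotone_convergence_SUP)
  finally show ?case .
qed

text \<open>The two measures have to agree only inside \<open>X\<close>; both set integrals are
  integrals with respect to the density given by the indicator of \<open>X\<close>, and these
  densities coincide. It serves vectors altered by a spectral projection, whose measures change on
  one side of a cut only.\<close>

lemma set_integral_cong_measure:
  fixes f :: "'a \<Rightarrow> real"
  assumes s: "sets M = sets N" and X: "X \<in> sets M" and f: "f \<in> borel_measurable M"
    and eq: "\<And>Y. Y \<in> sets M \<Longrightarrow> Y \<subseteq> X \<Longrightarrow> emeasure M Y = emeasure N Y"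
  shows "(LINT t:X|M. f t) = (LINT t:X|N. f t)"
proof -
  have XN: "X \<in> sets N" using X s by simp
  have fN: "f \<in> borel_measurable N" using f measurable_cong_sets[OF s refl, of borel] by blast
  have e: "emeasure (density L (\<lambda>x. ennreal (indicator X x))) Y = emeasure L (X \<inter> Y)"
    if "X \<in> sets L" "Y \<in> sets L" for L Y
  proof -
    have "emeasure (density L (\<lambda>x. ennreal (indicator X x))) Y = (\<integral>\<^sup>+x. ennreal (indicator X x) * indicator Y x \<partial>L)"
      using that by (intro emeasure_density) auto
    also have "\<dots> = (\<integral>\<^sup>+x. indicator (X \<inter> Y) x \<partial>L)"
      by (intro nn_integral_cong) (auto split: split_indicator)
    finally show ?thesis using that by simp
  qed
  have d: "density M (\<lambda>x. ennreal (indicator X x)) = density N (\<lambda>x. ennreal (indicator X x))"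
  proof (rule measure_eqI)
    show "sets (density M (\<lambda>x. ennreal (indicator X x))) = sets (density N (\<lambda>x. ennreal (indicator X x)))" using s by simp
    fix Y assume "Y \<in> sets (density M (\<lambda>x. ennreal (indicator X x)))"
    then have Y: "Y \<in> sets M" "Y \<in> sets N" using s by auto
    show "emeasure (density M (\<lambda>x. ennreal (indicator X x))) Y = emeasure (density N (\<lambda>x. ennreal (indicator X x))) Y"
      unfolding e[OF X Y(1)] e[OF XN Y(2)] using X Y by (intro eq) auto
  qed
  have i: "(LINT t:X|L. f t) = integral\<^sup>L (density L (\<lambda>x. ennreal (indicator X x))) f"
    if "X \<in> sets L" "f \<in> borel_measurable L" for L
    unfolding set_lebesgue_integral_def using that by (simp add: integral_density)
  show ?thesis unfolding i[OF X f] i[OF XN fN] d ..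
qed

section \<open>Scalar measures of a projection-valued measure\<close>

locale spectral_resolution =
  fixes E :: "real set \<Rightarrow> (complex \<Rightarrow> complex) \<Rightarrow> (complex \<Rightarrow> complex)"
  assumes pvm: "projection_valued_measure E"
begin

lemma E_H2: "X \<in> sets borel \<Longrightarrow> f \<in> H2 \<Longrightarrow> E X f \<in> H2"
  using pvm unfolding projection_valued_measure_def by simp

lemma E_sym: "X \<in> sets borel \<Longrightarrow> f \<in> H2 \<Longrightarrow> g \<in> H2 \<Longrightarrow> ip (E X f) g = ip f (E X g)"
  using pvm unfolding projection_valued_measure_def by simp

lemma ip_E_Int:
  assumes "X \<in> sets borel" "Y \<in> sets borel" "f \<in> H2" "g \<in> H2"
  shows "ip (E X f) (E Y g) = ip (E (X \<inter> Y) f) g"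
proof -
  have "AE \<zeta> in circle. E (Y \<inter> X) f \<zeta> = E Y (E X f) \<zeta>"
    using pvm assms unfolding projection_valued_measure_def by blast
  then have "ip (E (Y \<inter> X) f) g = ip (E Y (E X f)) g"
    using assms by (intro ip_cong_AE H2_L2 E_H2 sets.Int) auto
  then show ?thesis using E_sym[of Y "E X f" g] assms E_H2 by (simp add: Int_commute)
qed

lemma ip_E_UNIV:
  assumes "f \<in> H2" "g \<in> H2" shows "ip (E UNIV f) g = ip f g"
proof -
  have "AE \<zeta> in circle. E UNIV f \<zeta> = f \<zeta>" using pvm assms unfolding projection_valued_measure_def by blast
  then show ?thesis using assms by (intro ip_cong_AE H2_L2 E_H2) auto
qed

lemma ip_E_lincomb:
  assumes X: "X \<in> sets borel" and f: "f \<in> H2" and g: "g \<in> H2" and h: "h \<in> H2"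
  shows "ip (E X (\<lambda>\<zeta>. f \<zeta> + c * g \<zeta>)) h = ip (E X f) h + c * ip (E X g) h"
proof -
  have "ip (E X (\<lambda>\<zeta>. f \<zeta> + c * g \<zeta>)) h = ip (\<lambda>\<zeta>. f \<zeta> + c * g \<zeta>) (E X h)"
    by (intro E_sym X H2_add H2_cmult f g h)
  also have "\<dots> = ip f (E X h) + c * ip g (E X h)"
    using ip_add_left[OF H2_L2[OF f] L2_cmult[OF H2_L2[OF g]] H2_L2[OF E_H2[OF X h]]] by (simp add: ip_cmult_left)
  finally show ?thesis using E_sym[OF X] f g h by simp
qed

abbreviation sm :: "(complex \<Rightarrow> complex) \<Rightarrow> real measure" where "sm \<equiv> scalar_measure E"

lemma sets_sm [simp]: "sets (sm f) = sets borel"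
  unfolding scalar_measure_def by (simp add: sets_measure_of_conv sets.sigma_sets_eq[of borel, simplified])

lemma space_sm [simp]: "space (sm f) = UNIV"
  using sets_eq_imp_space_eq[OF sets_sm] by simp

lemma ip_E_self:
  assumes "X \<in> sets borel" "f \<in> H2"
  shows "ip (E X f) f = complex_of_real (Re (ip (E X f) f))" "0 \<le> Re (ip (E X f) f)"
proof -
  have "ip (E X f) f = complex_of_real (LINT \<zeta>|circle. (norm (E X f \<zeta>))\<^sup>2)"
    using ip_E_Int[OF assms(1,1,2,2)] ip_self[OF H2_L2[OF E_H2[OF assms]]] by simp
  then show "ip (E X f) f = complex_of_real (Re (ip (E X f) f))" "0 \<le> Re (ip (E X f) f)" by simp_all
qed

lemma emeasure_sm:
  assumes f: "f \<in> H2" and X: "X \<in> sets borel"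
  shows "emeasure (sm f) X = ennreal (Re (ip (E X f) f))"
proof (rule emeasure_measure_of[OF scalar_measure_def])
  have sums: "(\<lambda>i. ip (E (A i) f) f) sums ip (E (\<Union>i. A i) f) f"
    if "range A \<subseteq> sets borel" "disjoint_family A" for A :: "nat \<Rightarrow> real set"
    using pvm f that unfolding projection_valued_measure_def by blast
  \<comment> \<open>The empty set is the disjoint union of countably many copies of itself;
    summability of a constant sequence forces the constant to be 0.\<close>
  have "(\<lambda>i::nat. ip (E {} f) f) sums ip (E (\<Union>i::nat. {}) f) f"
    by (rule sums[of "\<lambda>_. {}"]) (auto simp: disjoint_family_on_def)
  then have "summable (\<lambda>i::nat. ip (E {} f) f)" by (rule sums_summable)
  then have "ip (E {} f) f = 0" by (simp only: summable_const_iff)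
  then show "positive (sets (sm f)) (\<lambda>X. ennreal (Re (ip (E X f) f)))"
    by (simp add: positive_def)
  show "countably_additive (sets (sm f)) (\<lambda>X. ennreal (Re (ip (E X f) f)))"
  proof (rule countably_additiveI)
    fix A :: "nat \<Rightarrow> real set" assume A: "range A \<subseteq> sets (sm f)" "disjoint_family A" "(\<Union>i. A i) \<in> sets (sm f)"
    then have "(\<lambda>i. Re (ip (E (A i) f) f)) sums Re (ip (E (\<Union>i. A i) f) f)"
      by (intro sums_Re sums) auto
    then show "(\<Sum>i. ennreal (Re (ip (E (A i) f) f))) = ennreal (Re (ip (E (\<Union>i. A i) f) f))"
      using A f by (intro suminf_ennreal_eq ip_E_self(2)) auto
  qed
qed (use X in auto)

lemma finite_measure_sm: "f \<in> H2 \<Longrightarrow> finite_measure (sm f)"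
  by (intro finite_measureI) (simp add: emeasure_sm)

lemma measure_sm:
  assumes "f \<in> H2" "X \<in> sets borel" shows "measure (sm f) X = Re (ip (E X f) f)"
  using emeasure_sm[OF assms] ip_E_self(2)[OF assms(2,1)] by (simp add: measure_def)

lemma measure_sm_lincomb:
  assumes f: "f \<in> H2" and g: "g \<in> H2" and X: "X \<in> sets borel"
  shows "measure (sm (\<lambda>\<zeta>. f \<zeta> + c * g \<zeta>)) X =
    measure (sm f) X + (norm c)\<^sup>2 * measure (sm g) X + 2 * Re (cnj c * ip (E X f) g)"
proof -
  have fg: "(\<lambda>\<zeta>. f \<zeta> + c * g \<zeta>) \<in> H2" by (intro H2_add H2_cmult f g)
  have r: "ip h (\<lambda>\<zeta>. f \<zeta> + c * g \<zeta>) = ip h f + cnj c * ip h g" if "h \<in> H2" for h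
  proof -
    have "ip (\<lambda>\<zeta>. f \<zeta> + c * g \<zeta>) h = ip f h + c * ip g h"
      using ip_add_left[OF H2_L2[OF f] L2_cmult[OF H2_L2[OF g]] H2_L2[OF that]] by (simp add: ip_cmult_left)
    then have "cnj (ip (\<lambda>\<zeta>. f \<zeta> + c * g \<zeta>) h) = cnj (ip f h) + cnj c * cnj (ip g h)" by simp
    then show ?thesis by (simp only: ip_cnj)
  qed
  have gf: "ip (E X g) f = cnj (ip (E X f) g)" using E_sym[OF X f g] by (simp add: ip_cnj)
  have "ip (E X (\<lambda>\<zeta>. f \<zeta> + c * g \<zeta>)) (\<lambda>\<zeta>. f \<zeta> + c * g \<zeta>) =
    ip (E X f) f + cnj c * ip (E X f) g + c * (cnj (ip (E X f) g) + cnj c * ip (E X g) g)"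
    unfolding ip_E_lincomb[OF X f g fg] r[OF E_H2[OF X f]] r[OF E_H2[OF X g]] gf ..
  also have "\<dots> = ip (E X f) f + (cnj c * ip (E X f) g + cnj (cnj c * ip (E X f) g)) + (c * cnj c) * ip (E X g) g"
    by (simp add: algebra_simps)
  finally have "Re (ip (E X (\<lambda>\<zeta>. f \<zeta> + c * g \<zeta>)) (\<lambda>\<zeta>. f \<zeta> + c * g \<zeta>)) =
    Re (ip (E X f) f) + 2 * Re (cnj c * ip (E X f) g) + Re ((c * cnj c) * ip (E X g) g)"
    by (simp only: plus_complex.sel complex_add_cnj Re_complex_of_real)
  moreover have "Re ((c * cnj c) * ip (E X g) g) = (norm c)\<^sup>2 * Re (ip (E X g) g)"
    unfolding complex_norm_square[symmetric] by (simp only: Re_complex_of_real times_complex.sel Im_complex_of_real mult_zero_left diff_zero)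
  ultimately show ?thesis using measure_sm f g X fg by simp
qed

text \<open>Projecting a vector restricts its scalar measure to \<open>X\<close>, because the three
  projections that occur multiply to the one of the intersection.\<close>

lemma measure_sm_E:
  assumes "f \<in> H2" "X \<in> sets borel" "Y \<in> sets borel"
  shows "measure (sm (E X f)) Y = measure (sm f) (X \<inter> Y)"
proof -
  have "ip (E Y (E X f)) (E X f) = ip (E X f) (E Y (E X f))" using assms by (intro E_sym E_H2)
  also have "\<dots> = ip (E (X \<inter> Y) f) (E X f)" using assms by (intro ip_E_Int E_H2)
  also have "\<dots> = ip (E (X \<inter> Y \<inter> X) f) f" using assms by (intro ip_E_Int) auto
  also have "X \<inter> Y \<inter> X = X \<inter> Y" by auto
  finally show ?thesis using assms by (simp add: measure_sm E_H2)
qed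

text \<open>In the expansion of the scalar measure every term that involves the projected vector
  only sees the part of \<open>Y\<close> inside \<open>X\<close>. So f + c E X k has the measure of
  f + c k on \<open>X\<close> and that of f off \<open>X\<close>.\<close>

lemma measure_sm_cutoff:
  assumes f: "f \<in> H2" and k: "k \<in> H2" and X: "X \<in> sets borel" and Y: "Y \<in> sets borel"
  shows "Y \<subseteq> X \<Longrightarrow> measure (sm (\<lambda>\<zeta>. f \<zeta> + c * E X k \<zeta>)) Y = measure (sm (\<lambda>\<zeta>. f \<zeta> + c * k \<zeta>)) Y"
    and "Y \<subseteq> - X \<Longrightarrow> measure (sm (\<lambda>\<zeta>. f \<zeta> + c * E X k \<zeta>)) Y = measure (sm f) Y"
proof -
  have e: "measure (sm (\<lambda>\<zeta>. f \<zeta> + c * E X k \<zeta>)) Y =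
    measure (sm f) Y + (norm c)\<^sup>2 * measure (sm k) (X \<inter> Y) + 2 * Re (cnj c * ip (E (X \<inter> Y) f) k)"
    using measure_sm_lincomb[OF f E_H2[OF X k] Y, of c] measure_sm_E[OF k X Y] ip_E_Int[OF Y X f k]
    by (simp add: Int_commute)
  show "measure (sm (\<lambda>\<zeta>. f \<zeta> + c * E X k \<zeta>)) Y = measure (sm (\<lambda>\<zeta>. f \<zeta> + c * k \<zeta>)) Y" if "Y \<subseteq> X"
  proof -
    have "X \<inter> Y = Y" using that by auto
    then show ?thesis unfolding e by (simp only: measure_sm_lincomb[OF f k Y])
  qed
  show "measure (sm (\<lambda>\<zeta>. f \<zeta> + c * E X k \<zeta>)) Y = measure (sm f) Y" if "Y \<subseteq> - X"
  proof -
    have XY: "X \<inter> Y = {}" using that by auto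
    have k0: "measure (sm k) {} = 0" and f0: "measure (sm f) {} = 0" by simp_all
    \<comment> \<open>The scalar measure of the empty set is 0, so \<open>E {} f\<close> has norm
      zero and vanishes almost everywhere; this removes the mixed term.\<close>
    have "ip (E {} f) (E {} f) = 0"
      using f0 measure_sm[OF f, of "{}"] ip_E_self(1)[of "{}" f] ip_E_Int[of "{}" "{}" f f] f by simp
    then have "(LINT \<zeta>|circle. (norm (E {} f \<zeta>))\<^sup>2) = 0"
      using ip_self[OF H2_L2[OF E_H2[OF _ f]], of "{}"] by simp
    then have ae: "AE \<zeta> in circle. E {} f \<zeta> = 0"
      using integral_nonneg_eq_0_iff_AE[of circle "\<lambda>\<zeta>. (norm (E {} f \<zeta>))\<^sup>2"] H2_L2[OF E_H2[OF _ f], of "{}"]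
      unfolding L2_def by simp
    have "ip (E {} f) k = ip (\<lambda>_. 0) k"
      by (rule ip_cong_AE) (use ae H2_L2[OF E_H2[OF _ f], of "{}"] H2_L2[OF k] L2_continuous[of "\<lambda>_. 0"] in auto)
    then have "ip (E {} f) k = 0" by (simp add: ip_def)
    then show ?thesis unfolding e XY k0 by simp
  qed
qed

end

section \<open>The spectral measure of the Toeplitz operator: support and resolvent\<close>

locale toeplitz_spectral = semibounded_symbol \<omega> + spectral_resolution E
  for \<omega> :: "complex \<Rightarrow> real" and E :: "real set \<Rightarrow> (complex \<Rightarrow> complex) \<Rightarrow> (complex \<Rightarrow> complex)" +
  assumes spectral: "spectral_measure_of (toeplitz \<omega>) E"
begin

lemma Domain_iff: "f \<in> Domain (toeplitz \<omega>) \<longleftrightarrow> f \<in> H2 \<and> integrable (sm f) (\<lambda>t. t\<^sup>2)"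
  using spectral unfolding spectral_measure_of_def by simp

lemma ip_spectral_integral:
  "(f, h) \<in> toeplitz \<omega> \<Longrightarrow> g \<in> Domain (toeplitz \<omega>) \<Longrightarrow> ip h g = spectral_integral E (\<lambda>t. t) f g"
  using spectral unfolding spectral_measure_of_def by auto

text \<open>The integrals are real, so the two polarization terms with factors \<i> and - \<i>
  contribute only to the imaginary part.\<close>

lemma Re_spectral_integral:
  "Re (spectral_integral E \<phi> f g) =
     ((LINT t|sm (\<lambda>\<zeta>. f \<zeta> + 1 * g \<zeta>). \<phi> t) - (LINT t|sm (\<lambda>\<zeta>. f \<zeta> + - 1 * g \<zeta>). \<phi> t)) / 4"
proof -
  have i3: "\<i> ^ 3 = - \<i>" by (simp add: eval_nat_numeral)
  show ?thesis
    unfolding spectral_integral_def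
    by (simp add: lessThan_nat_numeral lessThan_Suc eval_nat_numeral(2,3) i3)
qed

lemma integrable_id_sm:
  assumes f: "f \<in> H2" and i: "integrable (sm f) (\<lambda>t. t\<^sup>2)" shows "integrable (sm f) (\<lambda>t. t)"
proof -
  interpret finite_measure "sm f" by (rule finite_measure_sm[OF f])
  show ?thesis
  proof (rule Bochner_Integration.integrable_bound)
    show "integrable (sm f) (\<lambda>t. 1 + t\<^sup>2)" using i by simp
    show "(\<lambda>t. t) \<in> borel_measurable (sm f)" by (simp add: measurable_cong_sets[OF sets_sm refl])
    have "\<bar>t\<bar> \<le> 1 + t\<^sup>2" for t :: real
    proof -
      have "0 \<le> (1 - \<bar>t\<bar>)\<^sup>2 + \<bar>t\<bar>" by simp
      then show ?thesis by (simp add: power2_eq_square algebra_simps)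
    qed
    then show "AE t in sm f. norm t \<le> norm (1 + t\<^sup>2)" by simp
  qed
qed

lemma AE_sm_cutoff:
  assumes k: "k \<in> H2" and X: "X \<in> sets borel"
  shows "AE t in sm (E X k). t \<in> X"
proof -
  have "measure (sm (E X k)) (- X) = 0" using measure_sm_E[OF k X, of "- X"] X by simp
  then have "emeasure (sm (E X k)) (- X) = 0"
    using finite_measure.emeasure_eq_measure[OF finite_measure_sm[OF E_H2[OF X k]]] by simp
  then show ?thesis using X by (intro AE_I[where N = "- X"]) auto
qed

text \<open>The scalar measure of \<open>E X k\<close> is carried by the bounded set
  \<open>X\<close>, so its second moment is finite. These projections supply the test vectors for
  the operator, whatever \<open>k\<close> is.\<close>

lemma cutoff_Domain:
  assumes k: "k \<in> H2" and X: "X \<in> sets borel" "X \<subseteq> {-R..R}"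
  shows "E X k \<in> Domain (toeplitz \<omega>)"
proof -
  interpret finite_measure "sm (E X k)" by (rule finite_measure_sm[OF E_H2[OF X(1) k]])
  have "integrable (sm (E X k)) (\<lambda>t. t\<^sup>2)"
  proof (rule integrable_const_bound)
    show "AE t in sm (E X k). norm (t\<^sup>2) \<le> R\<^sup>2"
      using AE_sm_cutoff[OF k X(1)]
    proof eventually_elim
      case (elim t)
      then have "t \<in> {-R..R}" using X(2) by blast
      then have "\<bar>t\<bar> \<le> R" by auto
      then have "\<bar>t\<bar>\<^sup>2 \<le> R\<^sup>2" by (intro power_mono) auto
      then show ?case by simp
    qed
    show "(\<lambda>t. t\<^sup>2) \<in> borel_measurable (sm (E X k))" by (simp add: measurable_cong_sets[OF sets_sm refl])
  qed
  then show ?thesis unfolding Domain_iff using E_H2[OF X(1) k] by simp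
qed

text \<open>For g = E X f the spectral integral gives (T g, g) \<le> b (g, g), since the scalar
  measure of g lives on \<open>X\<close>. The form bound gives a larger multiple of (g, g) as lower
  bound, and so g = 0. Boundedness of \<open>X\<close> puts g into the domain of T.\<close>

lemma measure_sm_below_bounded:
  assumes f: "f \<in> H2" and b: "b < \<gamma>" and X: "X \<in> sets borel" "X \<subseteq> {-R..b}"
  shows "measure (sm f) X = 0"
proof -
  define g where "g = E X f"
  have g: "g \<in> H2" unfolding g_def by (rule E_H2[OF X(1) f])
  have "{-R..b} \<subseteq> {- max R b..max R b}" by auto
  with X(2) have "X \<subseteq> {- max R b..max R b}" by (rule subset_trans)
  then have gD: "g \<in> Domain (toeplitz \<omega>)" unfolding g_def by (rule cutoff_Domain[OF f X(1)])
  then obtain h where h: "(g, h) \<in> toeplitz \<omega>" by blast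
  have gg: "measure (sm g) UNIV = Re (ip g g)" using measure_sm[OF g] ip_E_UNIV[OF g g] by simp
  \<comment> \<open>Polarization with both arguments equal to g involves the measures of g - g and g
    + g, that is, zero and four times the scalar measure of g.\<close>
  have mm: "measure (sm (\<lambda>\<zeta>. g \<zeta> + - 1 * g \<zeta>)) Y = 0" "measure (sm (\<lambda>\<zeta>. g \<zeta> + 1 * g \<zeta>)) Y = 4 * measure (sm g) Y"
    if "Y \<in> sets borel" for Y
    using measure_sm_lincomb[OF g g that, of "-1"] measure_sm_lincomb[OF g g that, of 1] measure_sm[OF g that] by simp_all
  have g2: "(\<lambda>\<zeta>. g \<zeta> + 1 * g \<zeta>) \<in> H2" "(\<lambda>\<zeta>. g \<zeta> + - 1 * g \<zeta>) \<in> H2" by (intro H2_add H2_cmult g)+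
  interpret P: finite_measure "sm (\<lambda>\<zeta>. g \<zeta> + 1 * g \<zeta>)" by (rule finite_measure_sm[OF g2(1)])
  interpret M: finite_measure "sm (\<lambda>\<zeta>. g \<zeta> + - 1 * g \<zeta>)" by (rule finite_measure_sm[OF g2(2)])
  have "emeasure (sm (\<lambda>\<zeta>. g \<zeta> + - 1 * g \<zeta>)) UNIV = 0" using mm(1)[of UNIV] M.emeasure_eq_measure by simp
  then have "AE t in sm (\<lambda>\<zeta>. g \<zeta> + - 1 * g \<zeta>). t = (0::real)" by (intro AE_I[where N = UNIV]) auto
  then have z: "(LINT t|sm (\<lambda>\<zeta>. g \<zeta> + - 1 * g \<zeta>). t) = 0" by (rule integral_eq_zero_AE)
  have ae: "AE t in sm (\<lambda>\<zeta>. g \<zeta> + 1 * g \<zeta>). t \<in> X"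
  proof -
    have "measure (sm g) (- X) = 0" unfolding g_def using measure_sm_E[OF f X(1), of "- X"] X by simp
    then have "emeasure (sm (\<lambda>\<zeta>. g \<zeta> + 1 * g \<zeta>)) (- X) = 0" using mm(2)[of "- X"] X P.emeasure_eq_measure by simp
    then show ?thesis using X by (intro AE_I[where N = "- X"]) auto
  qed
  have "(LINT t|sm (\<lambda>\<zeta>. g \<zeta> + 1 * g \<zeta>). t) \<le> (LINT t|sm (\<lambda>\<zeta>. g \<zeta> + 1 * g \<zeta>). b)"
  proof (rule integral_mono_AE)
    have "(\<lambda>\<zeta>. g \<zeta> + 1 * g \<zeta>) \<in> Domain (toeplitz \<omega>)" using toeplitz_lincomb[OF h h] by blast
    then show "integrable (sm (\<lambda>\<zeta>. g \<zeta> + 1 * g \<zeta>)) (\<lambda>t. t)" using integrable_id_sm[OF g2(1)] unfolding Domain_iff by blast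
    show "AE t in sm (\<lambda>\<zeta>. g \<zeta> + 1 * g \<zeta>). t \<le> b" using ae by eventually_elim (use X in auto)
  qed (rule P.integrable_const)
  also have "\<dots> = 4 * (b * measure (sm g) UNIV)" using mm(2)[of UNIV] by simp
  finally have "Re (ip h g) \<le> b * Re (ip g g)"
    using ip_spectral_integral[OF h gD] Re_spectral_integral[of "\<lambda>t. t" g g] z unfolding gg by simp
  \<comment> \<open>The form bound is available for numbers strictly below \<gamma>; the midpoint is
    one that still exceeds b.\<close>
  moreover have "(b + \<gamma>) / 2 * Re (ip g g) \<le> Re (ip h g)" by (rule toeplitz_bounded_below[OF h]) (use b in simp)
  ultimately have "((b + \<gamma>) / 2 - b) * Re (ip g g) \<le> 0" unfolding left_diff_distrib by linarith
  moreover have "0 < (b + \<gamma>) / 2 - b" using b by simp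
  ultimately have "Re (ip g g) \<le> 0" by (metis mult_pos_pos not_le)
  then have "measure (sm g) UNIV = 0" unfolding gg[symmetric] using measure_nonneg[of "sm g" UNIV] by linarith
  then show ?thesis using measure_sm_E[OF f X(1), of UNIV] unfolding g_def by simp
qed

text \<open>The half-line below \<gamma> is a countable union of bounded intervals staying strictly
  below \<gamma>, each of measure zero.\<close>

lemma AE_sm_ge:
  assumes f: "f \<in> H2" shows "AE t in sm f. \<gamma> \<le> t"
proof -
  interpret finite_measure "sm f" by (rule finite_measure_sm[OF f])
  have "{- real n..\<gamma> - 1 / real (Suc n)} \<in> null_sets (sm f)" for n :: nat
    using measure_sm_below_bounded[OF f, of "\<gamma> - 1 / real (Suc n)" "{- real n..\<gamma> - 1 / real (Suc n)}" "real n"]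
    by (auto simp: null_sets_def emeasure_eq_measure)
  then have "(\<Union>n. {- real n..\<gamma> - 1 / real (Suc n)}) \<in> null_sets (sm f)" by (intro null_sets_UN)
  then show ?thesis
  proof (rule AE_I')
    show "{t \<in> space (sm f). \<not> \<gamma> \<le> t} \<subseteq> (\<Union>n. {- real n..\<gamma> - 1 / real (Suc n)})"
    proof
      fix t assume "t \<in> {t \<in> space (sm f). \<not> \<gamma> \<le> t}"
      then have t: "t < \<gamma>" by simp
      obtain n1 where n1: "1 / real (Suc n1) < \<gamma> - t" using nat_approx_posE[of "\<gamma> - t"] t by auto
      obtain n2 :: nat where n2: "- t < real n2" using reals_Archimedean2 by blast
      have "1 / real (Suc (max n1 n2)) \<le> 1 / real (Suc n1)" by (intro divide_left_mono) auto
      then have "t \<in> {- real (max n1 n2)..\<gamma> - 1 / real (Suc (max n1 n2))}" using n1 n2 by auto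
      then show "t \<in> (\<Union>n. {- real n..\<gamma> - 1 / real (Suc n)})" by blast
    qed
  qed
qed

text \<open>The data say that (T - l) f = k. From this the transform of the positive measure
  \<open>sm k\<close> at l is to be identified with the real part of (f, k). Real parts suffice,
  since \<open>sm k\<close> is a positive measure; hence only \<open>P\<close> and \<open>Q\<close>,
  belonging to f + k and f - k, are needed for polarization.\<close>

context
  fixes f h k :: "complex \<Rightarrow> complex" and l :: real
  assumes fh: "(f, h) \<in> toeplitz \<omega>" and k: "k \<in> H2" and h_eq: "h = (\<lambda>\<zeta>. k \<zeta> + complex_of_real l * f \<zeta>)"
begin

abbreviation "S c \<equiv> sm (\<lambda>\<zeta>. f \<zeta> + c * k \<zeta>)"
abbreviation "P \<equiv> S 1"
abbreviation "Q \<equiv> S (- 1)"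

lemma f_H2: "f \<in> H2" using fh Domain_iff by blast

lemma fk_H2: "(\<lambda>\<zeta>. f \<zeta> + c * k \<zeta>) \<in> H2" by (intro H2_add H2_cmult f_H2 k)

lemma polarization: "X \<in> sets borel \<Longrightarrow> measure P X - measure Q X = 4 * Re (ip (E X f) k)"
  using measure_sm_lincomb[OF f_H2 k, of X 1] measure_sm_lincomb[OF f_H2 k, of X "-1"] by simp

lemma finite_sm_fk: "finite_measure (S c)"
  by (rule finite_measure_sm[OF fk_H2])

lemma set_integrable_bounded_fk:
  assumes X: "X \<in> sets borel" "X \<subseteq> {-R..R}"
  shows "set_integrable (S c) X (\<lambda>t. t)"
proof -
  interpret finite_measure "S c" by (rule finite_sm_fk)
  show ?thesis unfolding set_integrable_def
  proof (rule integrable_const_bound[where B = "\<bar>R\<bar>"])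
    show "AE t in S c. norm (indicat_real X t *\<^sub>R t) \<le> \<bar>R\<bar>"
    proof (rule AE_I2)
      fix t
      show "norm (indicat_real X t *\<^sub>R t) \<le> \<bar>R\<bar>"
      proof (cases "t \<in> X")
        case True
        then have "t \<in> {-R..R}" using X(2) by blast
        then show ?thesis using True by auto
      qed simp
    qed
    show "(\<lambda>t. indicat_real X t *\<^sub>R t) \<in> borel_measurable (S c)"
      using X by (subst measurable_cong_sets[OF sets_sm refl]) simp
  qed
qed

text \<open>The contribution of the complement of \<open>X\<close> does not depend on
  \<open>c\<close>, so it cancels in the difference between c = 1 and c = - 1 that forms the real
  part of the spectral integral.\<close>

lemma cutoff_integral:
  assumes X: "X \<in> sets borel" "X \<subseteq> {-R..R}"
  shows "(LINT t|sm (\<lambda>\<zeta>. f \<zeta> + c * E X k \<zeta>). t) =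
    (LINT t:X|S c. t) + (LINT t:- X|sm f. t)"
proof -
  let ?N = "sm (\<lambda>\<zeta>. f \<zeta> + c * E X k \<zeta>)"
  have gD: "E X k \<in> Domain (toeplitz \<omega>)" by (rule cutoff_Domain[OF k X])
  then have ND: "(\<lambda>\<zeta>. f \<zeta> + c * E X k \<zeta>) \<in> Domain (toeplitz \<omega>)" using toeplitz_lincomb[OF fh] by blast
  then have NH: "(\<lambda>\<zeta>. f \<zeta> + c * E X k \<zeta>) \<in> H2" unfolding Domain_iff by blast
  have Ni: "integrable ?N (\<lambda>t. t)" using integrable_id_sm[OF NH] ND unfolding Domain_iff by blast
  have Ns: "set_integrable ?N Y (\<lambda>t. t)" if "Y \<in> sets borel" for Y
    unfolding set_integrable_def using Ni that by (intro integrable_mult_indicator) auto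
  have em: "emeasure (sm a) Y = ennreal (measure (sm a) Y)" if "a \<in> H2" for a Y
    by (rule finite_measure.emeasure_eq_measure[OF finite_measure_sm[OF that]])
  have m: "(\<lambda>t. t) \<in> borel_measurable ?N" by (simp add: measurable_cong_sets[OF sets_sm refl])
  have "(LINT t|?N. t) = (LINT t:X \<union> - X|?N. t)" by (simp add: set_lebesgue_integral_def)
  also have "\<dots> = (LINT t:X|?N. t) + (LINT t:- X|?N. t)"
    using X by (intro set_integral_Un Ns) auto
  also have "(LINT t:X|?N. t) = (LINT t:X|S c. t)"
  proof (rule set_integral_cong_measure[OF _ _ m])
    show "emeasure ?N Y = emeasure (S c) Y" if "Y \<in> sets ?N" "Y \<subseteq> X" for Y
      using that measure_sm_cutoff(1)[OF f_H2 k X(1), of Y c] by (simp add: em[OF NH] em[OF fk_H2])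
  qed (use X in auto)
  also have "(LINT t:- X|?N. t) = (LINT t:- X|sm f. t)"
  proof (rule set_integral_cong_measure[OF _ _ m])
    show "emeasure ?N Y = emeasure (sm f) Y" if "Y \<in> sets ?N" "Y \<subseteq> - X" for Y
      using that measure_sm_cutoff(2)[OF f_H2 k X(1), of Y c] by (simp add: em[OF NH] em[OF f_H2])
  qed (use X in auto)
  finally show ?thesis .
qed

text \<open>The equation \<open>T f - l f = k\<close> tested against \<open>E X k\<close>, which lies in the domain of \<open>T\<close> for bounded \<open>X\<close>.\<close>

lemma measure_cutoff_identity:
  assumes X: "X \<in> sets borel" "X \<subseteq> {-R..R}"
  shows "measure (sm k) X = ((LINT t:X|P. t - l) - (LINT t:X|Q. t - l)) / 4"
proof -
  have gD: "E X k \<in> Domain (toeplitz \<omega>)" by (rule cutoff_Domain[OF k X])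
  have g: "E X k \<in> H2" by (rule E_H2[OF X(1) k])
  have "Re (ip h (E X k)) = ((LINT t:X|P. t) - (LINT t:X|Q. t)) / 4"
    unfolding ip_spectral_integral[OF fh gD] Re_spectral_integral cutoff_integral[OF X] by simp
  moreover have "ip h (E X k) = ip k (E X k) + complex_of_real l * ip f (E X k)"
    unfolding h_eq using ip_add_left[OF H2_L2[OF k] L2_cmult[OF H2_L2[OF f_H2]] H2_L2[OF g]] by (simp add: ip_cmult_left)
  moreover have "Re (ip k (E X k)) = measure (sm k) X" using measure_sm[OF k X(1)] E_sym[OF X(1) k k] by simp
  moreover have "Re (ip f (E X k)) = (measure P X - measure Q X) / 4"
    using polarization[OF X(1)] E_sym[OF X(1) f_H2 k] by simp
  moreover have d: "(LINT t:X|S c. t - l) = (LINT t:X|S c. t) - l * measure (S c) X" for c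
  proof -
    interpret finite_measure "S c" by (rule finite_sm_fk)
    have "set_integrable (S c) X (\<lambda>t. l)"
      unfolding set_integrable_def using X by (intro integrable_mult_indicator) auto
    from set_integral_diff(2)[OF set_integrable_bounded_fk[OF X] this]
    show ?thesis using X by (simp add: set_lebesgue_integral_def mult.commute)
  qed
  ultimately have "((LINT t:X|P. t) - (LINT t:X|Q. t)) / 4 =
      measure (sm k) X + l * ((measure P X - measure Q X) / 4)"
    by simp
  then show ?thesis unfolding d[of 1] d[of "- 1"] by (simp add: field_simps)
qed

text \<open>\<open>measure_cutoff_identity\<close>, applied to all Borel subsets of
  \<open>X\<close>, says that on \<open>X\<close> the measure \<open>sm k\<close> is (t - l) (P - Q)
  / 4. Integrating 1 / (t - l) cancels the density and leaves (P - Q) / 4 of \<open>X\<close>, which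
  is the real part of (E X f, k). All measures are kept nonnegative by moving \<open>Q\<close> to
  the side of \<open>sm k\<close>.\<close>

lemma cutoff_resolvent_integral:
  assumes l: "l < \<gamma>" and X: "X \<in> sets borel" "X \<subseteq> {-R..R}" "X \<subseteq> {\<gamma>..}"
  shows "(LINT t:X|sm k. 1 / (t - l)) = Re (ip (E X f) k)"
proof -
  interpret K: finite_measure "sm k" by (rule finite_measure_sm[OF k])
  interpret P: finite_measure P by (rule finite_sm_fk)
  interpret Q: finite_measure Q by (rule finite_sm_fk)
  have pos: "0 < t - l" if "t \<in> X" for t using that X(3) l by auto
  \<comment> \<open>The density (t - l) / 4 restricted to \<open>X\<close>, where t \<ge> \<gamma> >
    l makes it positive; with it the identity reads \<open>sm k\<close> + w Q = w P on
    \<open>X\<close>.\<close>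
  define w where "w t = ennreal (indicator X t * ((t - l) / 4))" for t
  have wm[measurable]: "w \<in> borel_measurable borel" unfolding w_def using X by measurable
  have mb: "g \<in> borel_measurable (sm a)" if "g \<in> borel_measurable borel" for g :: "real \<Rightarrow> 'b::topological_space" and a
    using that by (simp add: measurable_cong_sets[OF sets_sm refl])
  have dw: "emeasure (density (S c) w) Y =
      ennreal ((LINT t:X \<inter> Y|S c. t - l) / 4)"
    and dwn: "0 \<le> (LINT t:X \<inter> Y|S c. t - l)" if Y: "Y \<in> sets borel" for Y c
  proof -
    interpret finite_measure "S c" by (rule finite_sm_fk)
    let ?g = "\<lambda>t. indicator (X \<inter> Y) t * (t - l)"
    have nn: "0 \<le> ?g t" for t using pos by (auto split: split_indicator intro: less_imp_le)
    have "X \<inter> Y \<subseteq> {-R..R}" "X \<inter> Y \<in> sets borel" using X Y by auto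
    then have 1: "set_integrable (S c) (X \<inter> Y) (\<lambda>t. t)"
      by (intro set_integrable_bounded_fk)
    have 2: "set_integrable (S c) (X \<inter> Y) (\<lambda>t. l)"
      unfolding set_integrable_def using X Y by (intro integrable_mult_indicator) auto
    have gi: "integrable (S c) ?g"
      using set_integral_diff(1)[OF 1 2] unfolding set_integrable_def by simp
    have eq: "(LINT t:X \<inter> Y|S c. t - l) = integral\<^sup>L (S c) ?g"
      by (simp add: set_lebesgue_integral_def)
    show "0 \<le> (LINT t:X \<inter> Y|S c. t - l)"
      unfolding eq using nn by (intro integral_nonneg_AE) auto
    have "emeasure (density (S c) w) Y = (\<integral>\<^sup>+t. w t * indicator Y t \<partial>S c)"
      using Y by (intro emeasure_density mb wm) simp
    also have "\<dots> = (\<integral>\<^sup>+t. ennreal (?g t / 4) \<partial>S c)"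
      by (intro nn_integral_cong) (auto simp: w_def split: split_indicator)
    also have "\<dots> = ennreal (integral\<^sup>L (S c) (\<lambda>t. ?g t / 4))"
      using gi nn by (intro nn_integral_eq_integral) auto
    also have "integral\<^sup>L (S c) (\<lambda>t. ?g t / 4) = (LINT t:X \<inter> Y|S c. t - l) / 4"
      unfolding eq by (rule integral_divide_zero)
    finally show "emeasure (density (S c) w) Y =
      ennreal ((LINT t:X \<inter> Y|S c. t - l) / 4)" .
  qed
  have dk: "emeasure (density (sm k) (indicator X)) Y = ennreal (measure (sm k) (X \<inter> Y))" if Y: "Y \<in> sets borel" for Y
  proof -
    have "emeasure (density (sm k) (indicator X)) Y = (\<integral>\<^sup>+t. indicator X t * indicator Y t \<partial>sm k)"
      using X Y by (intro emeasure_density mb) auto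
    also have "\<dots> = (\<integral>\<^sup>+t. indicator (X \<inter> Y) t \<partial>sm k)" by (intro nn_integral_cong) (auto split: split_indicator)
    finally show ?thesis using X Y by (simp add: K.emeasure_eq_measure)
  qed
  have A: "(\<integral>\<^sup>+t. ennreal (1 / (t - l)) \<partial>density (sm k) (indicator X)) + (\<integral>\<^sup>+t. ennreal (1 / (t - l)) \<partial>density Q w) =
      (\<integral>\<^sup>+t. ennreal (1 / (t - l)) \<partial>density P w)"
  proof (rule nn_integral_add_measure)
    show "(\<lambda>t. ennreal (1 / (t - l))) \<in> borel_measurable (density P w)"
      using mb[of "\<lambda>t. ennreal (1 / (t - l))"] by simp
    fix Y assume "Y \<in> sets (density P w)"
    then have Y: "Y \<in> sets borel" by simp
    have "X \<inter> Y \<subseteq> {-R..R}" "X \<inter> Y \<in> sets borel" using X Y by auto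
    then have eq: "measure (sm k) (X \<inter> Y) + (LINT t:X \<inter> Y|Q. t - l) / 4 = (LINT t:X \<inter> Y|P. t - l) / 4"
      using measure_cutoff_identity[of "X \<inter> Y" R] by (simp add: field_simps)
    have "ennreal (measure (sm k) (X \<inter> Y)) + ennreal ((LINT t:X \<inter> Y|Q. t - l) / 4) =
        ennreal (measure (sm k) (X \<inter> Y) + (LINT t:X \<inter> Y|Q. t - l) / 4)"
      using dwn[OF Y, of "- 1"] by (intro ennreal_plus[symmetric]) (rule measure_nonneg, simp)
    then show "emeasure (density (sm k) (indicator X)) Y + emeasure (density Q w) Y = emeasure (density P w) Y"
      unfolding dk[OF Y] dw[OF Y] eq .
  qed simp_all
  have W: "(\<integral>\<^sup>+t. ennreal (1 / (t - l)) \<partial>density (S c) w) =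
      ennreal (measure (S c) X / 4)" for c
  proof -
    interpret finite_measure "S c" by (rule finite_sm_fk)
    have "(\<integral>\<^sup>+t. ennreal (1 / (t - l)) \<partial>density (S c) w) =
      (\<integral>\<^sup>+t. w t * ennreal (1 / (t - l)) \<partial>S c)"
      by (intro nn_integral_density mb) measurable
    also have "\<dots> = (\<integral>\<^sup>+t. ennreal (1 / 4) * indicator X t \<partial>S c)"
    proof (rule nn_integral_cong)
      fix t
      show "w t * ennreal (1 / (t - l)) = ennreal (1 / 4) * indicator X t"
      proof (cases "t \<in> X")
        case True
        then have "w t * ennreal (1 / (t - l)) = ennreal ((t - l) / 4 * (1 / (t - l)))"
          unfolding w_def using pos[OF True] by (subst ennreal_mult) auto
        also have "(t - l) / 4 * (1 / (t - l)) = 1 / 4" using pos[OF True] by simp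
        finally show ?thesis using True by simp
      qed (simp add: w_def)
    qed
    also have "\<dots> = ennreal (1 / 4) * emeasure (S c) X"
      using X by (simp add: nn_integral_cmult_indicator)
    also have "\<dots> = ennreal (measure (S c) X / 4)"
      by (simp add: emeasure_eq_measure ennreal_mult[symmetric])
    finally show ?thesis .
  qed
  have K: "(\<integral>\<^sup>+t. ennreal (1 / (t - l)) \<partial>density (sm k) (indicator X)) = ennreal (LINT t:X|sm k. 1 / (t - l))"
  proof -
    have "(\<integral>\<^sup>+t. ennreal (1 / (t - l)) \<partial>density (sm k) (indicator X)) = (\<integral>\<^sup>+t. indicator X t * ennreal (1 / (t - l)) \<partial>sm k)"
      using X by (intro nn_integral_density mb) auto
    also have "\<dots> = (\<integral>\<^sup>+t. ennreal (indicator X t *\<^sub>R (1 / (t - l))) \<partial>sm k)"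
      by (intro nn_integral_cong) (auto split: split_indicator)
    also have "\<dots> = ennreal (LINT t|sm k. indicator X t *\<^sub>R (1 / (t - l)))"
    proof (rule nn_integral_eq_integral)
      show "AE t in sm k. 0 \<le> indicat_real X t *\<^sub>R (1 / (t - l))"
        using pos by (intro AE_I2) (auto split: split_indicator intro: less_imp_le)
      show "integrable (sm k) (\<lambda>t. indicat_real X t *\<^sub>R (1 / (t - l)))"
      proof (rule K.integrable_const_bound[where B = "1 / (\<gamma> - l)"])
        show "AE t in sm k. norm (indicat_real X t *\<^sub>R (1 / (t - l))) \<le> 1 / (\<gamma> - l)"
        proof (intro AE_I2)
          fix t
          show "norm (indicat_real X t *\<^sub>R (1 / (t - l))) \<le> 1 / (\<gamma> - l)"
          proof (cases "t \<in> X")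
            case True
            then have "\<gamma> - l \<le> t - l" using X(3) by auto
            then show ?thesis using True l pos[OF True] by (simp add: frac_le)
          qed (use l in simp)
        qed
      qed (use X in \<open>auto intro!: mb\<close>)
    qed
    finally show ?thesis unfolding set_lebesgue_integral_def .
  qed
  have I: "0 \<le> (LINT t:X|sm k. 1 / (t - l))"
    unfolding set_lebesgue_integral_def using pos
    by (intro integral_nonneg_AE AE_I2) (auto split: split_indicator intro: less_imp_le)
  have "ennreal ((LINT t:X|sm k. 1 / (t - l)) + measure Q X / 4) =
      ennreal (LINT t:X|sm k. 1 / (t - l)) + ennreal (measure Q X / 4)"
    using I by (intro ennreal_plus) simp_all
  also have "\<dots> = ennreal (measure P X / 4)" using A unfolding K W .
  finally have "(LINT t:X|sm k. 1 / (t - l)) + measure Q X / 4 = measure P X / 4"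
    using I by (subst (asm) ennreal_inj) simp_all
  then show ?thesis using polarization[OF X(1)] by simp
qed

text \<open>The bounded sets [\<gamma>, \<gamma> + n] exhaust the half-line carrying all measures
  involved. On one side measures of increasing sets converge; on the other the integrand is
  dominated by 1 / (\<gamma> - l).\<close>

theorem resolvent_integral:
  assumes l: "l < \<gamma>"
  shows "(LINT t|sm k. 1 / (t - l)) = Re (ip f k)"
proof (rule LIMSEQ_unique)
  interpret K: finite_measure "sm k" by (rule finite_measure_sm[OF k])
  define X where "X n = {\<gamma>..\<gamma> + real n}" for n
  have X: "X n \<in> sets borel" "X n \<subseteq> {- (\<bar>\<gamma>\<bar> + real n)..\<bar>\<gamma>\<bar> + real n}" "X n \<subseteq> {\<gamma>..}" for n
    unfolding X_def by auto
  have UX: "(\<Union>n. X n) = {\<gamma>..}"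
  proof
    show "{\<gamma>..} \<subseteq> (\<Union>n. X n)"
    proof
      fix t assume t: "t \<in> {\<gamma>..}"
      obtain n :: nat where "t - \<gamma> < real n" using reals_Archimedean2 by blast
      then show "t \<in> (\<Union>n. X n)" using t by (intro UN_I[of n]) (auto simp: X_def)
    qed
  qed (auto simp: X_def)
  have lim: "(\<lambda>n. measure (S c) (X n)) \<longlonglongrightarrow> measure (S c) UNIV" for c
  proof -
    interpret finite_measure "S c" by (rule finite_sm_fk)
    have "(\<lambda>n. measure (S c) (X n)) \<longlonglongrightarrow> measure (S c) (\<Union>n. X n)"
      by (intro finite_Lim_measure_incseq) (use X in \<open>auto simp: incseq_def X_def\<close>)
    moreover have "measure (S c) {\<gamma>..} = measure (S c) UNIV"
      using AE_sm_ge[OF fk_H2] by (intro measure_eq_AE) auto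
    ultimately show ?thesis unfolding UX by simp
  qed
  have "(\<lambda>n. (measure P (X n) - measure Q (X n)) / 4) \<longlonglongrightarrow> (measure P UNIV - measure Q UNIV) / 4"
    by (intro tendsto_intros lim) simp
  then show "(\<lambda>n. LINT t:X n|sm k. 1 / (t - l)) \<longlonglongrightarrow> Re (ip f k)"
    using polarization X(1) polarization[of UNIV] ip_E_UNIV[OF f_H2 k]
    unfolding cutoff_resolvent_integral[OF l X] by simp
  show "(\<lambda>n. LINT t:X n|sm k. 1 / (t - l)) \<longlonglongrightarrow> (LINT t|sm k. 1 / (t - l))"
    unfolding set_lebesgue_integral_def
  proof (rule integral_dominated_convergence[where w = "\<lambda>_. 1 / (\<gamma> - l)"])
    show "(\<lambda>t. 1 / (t - l)) \<in> borel_measurable (sm k)" by (simp add: measurable_cong_sets[OF sets_sm refl])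
    show "(\<lambda>t. indicat_real (X n) t *\<^sub>R (1 / (t - l))) \<in> borel_measurable (sm k)" for n
      using X(1)[of n] by (subst measurable_cong_sets[OF sets_sm refl]) simp
    show "AE t in sm k. (\<lambda>n. indicat_real (X n) t *\<^sub>R (1 / (t - l))) \<longlonglongrightarrow> 1 / (t - l)"
      using AE_sm_ge[OF k]
    proof eventually_elim
      case (elim t)
      obtain N :: nat where N: "t - \<gamma> < real N" using reals_Archimedean2 by blast
      have "\<forall>\<^sub>F n in sequentially. 1 / (t - l) = indicat_real (X n) t *\<^sub>R (1 / (t - l))"
        using eventually_ge_at_top[of N] by eventually_elim (use N elim in \<open>auto simp: X_def\<close>)
      then show ?case by (rule Lim_transform_eventually[OF tendsto_const])
    qed
    show "AE t in sm k. norm (indicat_real (X n) t *\<^sub>R (1 / (t - l))) \<le> 1 / (\<gamma> - l)" for n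
      using AE_sm_ge[OF k]
    proof eventually_elim
      case (elim t)
      then show ?case using l by (auto split: split_indicator intro!: frac_le)
    qed
  qed simp
qed

end

end

section \<open>Boundary behaviour of Stieltjes transforms\<close>

lemma cauchy_kernel_mass:
  assumes \<delta>: "0 < \<delta>"
  shows "((\<lambda>\<epsilon>. LINT s:{-\<delta><..<\<delta>}|lborel. \<epsilon> / (s\<^sup>2 + \<epsilon>\<^sup>2) / pi) \<longlongrightarrow> 1) (at_right 0)"
proof -
  have eq: "(LINT s:{-\<delta><..<\<delta>}|lborel. \<epsilon> / (s\<^sup>2 + \<epsilon>\<^sup>2) / pi) = 2 * arctan (\<delta> / \<epsilon>) / pi" if \<epsilon>: "0 < \<epsilon>" for \<epsilon>
  proof -
    let ?F = "\<lambda>s. arctan (s / \<epsilon>) / pi"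
    have nz: "s\<^sup>2 + \<epsilon>\<^sup>2 \<noteq> 0" for s using \<epsilon> by (simp add: add_nonneg_eq_0_iff)
    have "(LBINT s=ereal (-\<delta>)..ereal \<delta>. \<epsilon> / (s\<^sup>2 + \<epsilon>\<^sup>2) / pi) = ?F \<delta> - ?F (- \<delta>)"
    proof (rule interval_integral_FTC_finite)
      show "continuous_on {min (- \<delta>) \<delta>..max (- \<delta>) \<delta>} (\<lambda>s. \<epsilon> / (s\<^sup>2 + \<epsilon>\<^sup>2) / pi)"
        using nz by (intro continuous_intros) auto
      fix s :: real
      have "(?F has_real_derivative (inverse (1 + (s / \<epsilon>)\<^sup>2) * (1 / \<epsilon>)) / pi) (at s)"
        using \<epsilon> by (auto intro!: derivative_eq_intros)
      moreover have "(inverse (1 + (s / \<epsilon>)\<^sup>2) * (1 / \<epsilon>)) / pi = \<epsilon> / (s\<^sup>2 + \<epsilon>\<^sup>2) / pi"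
      proof -
        have "1 + (s / \<epsilon>)\<^sup>2 = (s\<^sup>2 + \<epsilon>\<^sup>2) / \<epsilon>\<^sup>2" using \<epsilon> by (simp add: field_simps)
        then show ?thesis using \<epsilon> by (simp add: power2_eq_square)
      qed
      ultimately show "(?F has_vector_derivative \<epsilon> / (s\<^sup>2 + \<epsilon>\<^sup>2) / pi) (at s within {min (- \<delta>) \<delta>..max (- \<delta>) \<delta>})"
        by (metis has_field_derivative_at_within has_real_derivative_iff_has_vector_derivative)
    qed
    moreover have "?F (- \<delta>) = - ?F \<delta>" by (simp add: arctan_minus)
    moreover have "(LBINT s=ereal (-\<delta>)..ereal \<delta>. \<epsilon> / (s\<^sup>2 + \<epsilon>\<^sup>2) / pi) = (LINT s:{-\<delta><..<\<delta>}|lborel. \<epsilon> / (s\<^sup>2 + \<epsilon>\<^sup>2) / pi)"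
      using \<delta> by (subst interval_lebesgue_integral_le_eq) (auto simp only: einterval_eq ereal_less_eq)
    ultimately show ?thesis by simp
  qed
  have "filterlim (\<lambda>\<epsilon>. \<delta> / \<epsilon>) at_top (at_right (0::real))" using \<delta> by real_asymp
  then have "((\<lambda>\<epsilon>. 2 * arctan (\<delta> / \<epsilon>) / pi) \<longlongrightarrow> 2 * (pi / 2) / pi) (at_right 0)"
    by (intro tendsto_intros filterlim_compose[OF tendsto_arctan_at_top]) auto
  then have "((\<lambda>\<epsilon>. 2 * arctan (\<delta> / \<epsilon>) / pi) \<longlongrightarrow> 1) (at_right 0)" by simp
  then show ?thesis
    by (rule Lim_transform_eventually) (use eq in \<open>auto simp: eventually_at_right_less intro: eventually_mono[OF eventually_at_right_less]\<close>)
qed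

text \<open>The kernel is 1/\<pi> times the imaginary part of 1 / (t - l - \<i> \<epsilon>). It is
  even and decreasing on the whole half-line, so the radius 1 handed to \<open>Fatou_kernel\<close>
  is an arbitrary choice.\<close>

lemma Stieltjes_transform_boundary:
  fixes \<nu> :: "real measure"
  assumes fm: "finite_measure \<nu>" and sets: "sets \<nu> = sets borel"
    and der: "((\<lambda>t. measure \<nu> {..<t}) has_real_derivative d) (at l)"
  shows "((\<lambda>\<epsilon>. LINT t|\<nu>. \<epsilon> / ((t - l)\<^sup>2 + \<epsilon>\<^sup>2) / pi) \<longlongrightarrow> d) (at_right 0)"
proof (rule Fatou_kernel[OF fm sets der, of 1])
  have pos: "0 < s\<^sup>2 + \<epsilon>\<^sup>2" if "0 < \<epsilon>" for s \<epsilon> :: real using that by (simp add: add_nonneg_pos)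
  have mono: "\<epsilon> / (t\<^sup>2 + \<epsilon>\<^sup>2) / pi \<le> \<epsilon> / (s\<^sup>2 + \<epsilon>\<^sup>2) / pi" if "0 < \<epsilon>" "\<bar>s\<bar> \<le> \<bar>t\<bar>" for s t \<epsilon> :: real
  proof -
    have "s\<^sup>2 \<le> t\<^sup>2" using that(2) by (simp add: abs_le_square_iff)
    then show ?thesis using that(1) pos[OF that(1)] by (intro divide_right_mono divide_left_mono mult_pos_pos) auto
  qed
  show "\<forall>\<^sub>F \<epsilon> in at_right 0. continuous_on UNIV (\<lambda>s. \<epsilon> / (s\<^sup>2 + \<epsilon>\<^sup>2) / pi) \<and>
      (\<forall>s. 0 \<le> \<epsilon> / (s\<^sup>2 + \<epsilon>\<^sup>2) / pi \<and> \<epsilon> / ((- s)\<^sup>2 + \<epsilon>\<^sup>2) / pi = \<epsilon> / (s\<^sup>2 + \<epsilon>\<^sup>2) / pi) \<and>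
      (\<forall>s t. 0 \<le> s \<and> s \<le> t \<and> t < 1 \<longrightarrow> \<epsilon> / (t\<^sup>2 + \<epsilon>\<^sup>2) / pi \<le> \<epsilon> / (s\<^sup>2 + \<epsilon>\<^sup>2) / pi)"
    using eventually_at_right_less[of "0::real"]
  proof (eventually_elim, intro conjI allI impI)
    fix \<epsilon> :: real assume \<epsilon>: "0 < \<epsilon>"
    show "continuous_on UNIV (\<lambda>s. \<epsilon> / (s\<^sup>2 + \<epsilon>\<^sup>2) / pi)"
      using pos[OF \<epsilon>] by (intro continuous_intros) (auto simp: less_imp_neq[symmetric])
  qed (use pos mono in \<open>auto intro!: divide_nonneg_nonneg\<close>)
  fix \<delta> :: real assume \<delta>: "0 < \<delta>" "\<delta> < 1"
  show "((\<lambda>\<epsilon>. LINT s:{-\<delta><..<\<delta>}|lborel. \<epsilon> / (s\<^sup>2 + \<epsilon>\<^sup>2) / pi) \<longlongrightarrow> 1) (at_right 0)"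
    by (rule cauchy_kernel_mass[OF \<delta>(1)])
  fix e :: real assume e: "0 < e"
  have "((\<lambda>\<epsilon>. \<epsilon> / (\<delta>\<^sup>2 + \<epsilon>\<^sup>2) / pi) \<longlongrightarrow> 0 / (\<delta>\<^sup>2 + 0\<^sup>2) / pi) (at_right 0)"
    using \<delta> by (intro tendsto_intros) auto
  then have "\<forall>\<^sub>F \<epsilon> in at_right 0. \<epsilon> / (\<delta>\<^sup>2 + \<epsilon>\<^sup>2) / pi < e" using e by (intro order_tendstoD(2)) auto
  with eventually_at_right_less[of "0::real"]
  show "\<forall>\<^sub>F \<epsilon> in at_right 0. AE t in \<nu>. \<delta> \<le> \<bar>t - l\<bar> \<longrightarrow> \<epsilon> / ((t - l)\<^sup>2 + \<epsilon>\<^sup>2) / pi \<le> e"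
  proof eventually_elim
    case (elim \<epsilon>)
    show ?case
    proof (intro AE_I2 impI)
      fix t assume "\<delta> \<le> \<bar>t - l\<bar>"
      then have "\<epsilon> / ((t - l)\<^sup>2 + \<epsilon>\<^sup>2) / pi \<le> \<epsilon> / (\<delta>\<^sup>2 + \<epsilon>\<^sup>2) / pi" using \<delta> by (intro mono elim) auto
      then show "\<epsilon> / ((t - l)\<^sup>2 + \<epsilon>\<^sup>2) / pi \<le> e" using elim by linarith
    qed
  qed
qed simp


section \<open>Integrability of \<open>ln \<bar>\<omega> - l\<bar>\<close> for almost every \<open>l\<close>\<close>

text \<open>The value \<open>\<infinity>\<close> at \<open>0\<close> (in place of the junk value \<open>ln 0 = 0\<close>) makes finiteness of the integral
  also say that \<open>\<omega> \<noteq> l\<close> almost everywhere.\<close>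

definition abs_log :: "real \<Rightarrow> ennreal" where
  "abs_log s = (if s = 0 then \<infinity> else ennreal \<bar>ln \<bar>s\<bar>\<bar>)"

lemma abs_log_measurable [measurable]: "abs_log \<in> borel_measurable borel"
  unfolding abs_log_def by measurable

lemma nn_integral_inverse_sqrt:
  "(\<integral>\<^sup>+s. ennreal (indicator {0..1} \<bar>s\<bar> * (2 / sqrt \<bar>s\<bar>)) \<partial>lborel) < \<infinity>"
proof -
  let ?f = "\<lambda>s::real. indicat_real {0..1} s * (2 / sqrt s)"
  have "((\<lambda>s. 2 / sqrt s) has_integral (4 * sqrt 1 - 4 * sqrt 0)) {0..1}"
  proof (rule fundamental_theorem_of_calculus_interior)
    show "continuous_on {0..1} (\<lambda>s. 4 * sqrt s)" by (intro continuous_intros)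
    fix s :: real assume "s \<in> {0<..<1}"
    then have "((\<lambda>s. 4 * sqrt s) has_real_derivative 2 / sqrt s) (at s)"
      by (auto intro!: derivative_eq_intros simp: field_simps)
    then show "((\<lambda>s. 4 * sqrt s) has_vector_derivative 2 / sqrt s) (at s)"
      by (simp add: has_real_derivative_iff_has_vector_derivative)
  qed simp
  then have "((\<lambda>s. if s \<in> {0..1} then 2 / sqrt s else 0) has_integral 4) UNIV"
    by (subst has_integral_restrict_UNIV) simp
  also have "(\<lambda>s. if s \<in> {0..1} then 2 / sqrt s else 0) = ?f" by (auto simp: fun_eq_iff indicator_def)
  finally have "(\<integral>\<^sup>+s. ennreal (?f s) \<partial>lborel) = ennreal 4"
    by (intro nn_integral_has_integral_lborel) (auto split: split_indicator)
  moreover have "(\<integral>\<^sup>+s. ennreal (?f (- s)) \<partial>lborel) = (\<integral>\<^sup>+s. ennreal (?f s) \<partial>lborel)"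
    using nn_integral_real_affine[of "\<lambda>s. ennreal (?f s)" "-1" 0] by simp
  moreover have "(\<integral>\<^sup>+s. ennreal (indicator {0..1} \<bar>s\<bar> * (2 / sqrt \<bar>s\<bar>)) \<partial>lborel) \<le>
      (\<integral>\<^sup>+s. ennreal (?f s) + ennreal (?f (- s)) \<partial>lborel)"
    by (intro nn_integral_mono) (auto simp: abs_if split: split_indicator)
  moreover have "(\<integral>\<^sup>+s. ennreal (?f s) + ennreal (?f (- s)) \<partial>lborel) =
      (\<integral>\<^sup>+s. ennreal (?f s) \<partial>lborel) + (\<integral>\<^sup>+s. ennreal (?f (- s)) \<partial>lborel)"
    by (intro nn_integral_add) auto
  ultimately show ?thesis by (auto simp: less_top[symmetric] top_unique)
qed

text \<open>Near 0 the inequality ln x \<le> x - 1 is taken at x = 1 / sqrt \<bar>s\<bar>, which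
  trades the logarithm for an integrable power. Away from 0 the linear term suffices.\<close>

lemma abs_ln_le_sqrt:
  assumes "s \<noteq> (0::real)"
  shows "\<bar>ln \<bar>s\<bar>\<bar> \<le> \<bar>s\<bar> + indicator {0..1} \<bar>s\<bar> * (2 / sqrt \<bar>s\<bar>)"
proof (cases "\<bar>s\<bar> \<le> 1")
  case True
  have p: "0 < \<bar>s\<bar>" using assms by simp
  have "ln (1 / sqrt \<bar>s\<bar>) \<le> 1 / sqrt \<bar>s\<bar> - 1" using p by (intro ln_le_minus_one) simp
  moreover have "ln (1 / sqrt \<bar>s\<bar>) = - ln \<bar>s\<bar> / 2" using p by (simp add: ln_div ln_sqrt)
  ultimately have "- ln \<bar>s\<bar> \<le> 2 / sqrt \<bar>s\<bar>" by simp
  moreover have "ln \<bar>s\<bar> \<le> 0" using True p by simp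
  ultimately show ?thesis using True by simp
next
  case False
  then have "0 < \<bar>s\<bar>" by linarith
  then have "ln \<bar>s\<bar> \<le> \<bar>s\<bar>" using ln_le_minus_one[of "\<bar>s\<bar>"] by linarith
  then show ?thesis using False by simp
qed

text \<open>Tonelli on the product of the circle with {- n..n}. For fixed x the integral of \<bar>ln
  \<bar>x - l\<bar>\<bar> over these l is at most linear in \<bar>x\<bar>, so with x = \<omega>
  \<zeta> it is integrable over the circle. Hence the integral over the circle is finite for almost
  every l.\<close>

lemma AE_integrable_log:
  fixes \<omega> :: "complex \<Rightarrow> real"
  assumes \<omega>: "integrable circle \<omega>"
  shows "AE l in lborel. integrable circle (\<lambda>\<zeta>. ln \<bar>\<omega> \<zeta> - l\<bar>) \<and> (AE \<zeta> in circle. \<omega> \<zeta> \<noteq> l)"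
proof -
  have \<omega>m[measurable]: "\<omega> \<in> borel_measurable circle" using \<omega> by auto
  interpret pair_sigma_finite circle lborel ..
  define c where "c = (\<integral>\<^sup>+s. ennreal (indicator {0..1} \<bar>s\<bar> * (2 / sqrt \<bar>s\<bar>)) \<partial>lborel)"
  have c: "c < \<infinity>" unfolding c_def by (rule nn_integral_inverse_sqrt)
  have inner: "(\<integral>\<^sup>+l. indicator {- real n..real n} l * abs_log (x - l) \<partial>lborel) \<le>
      ennreal (2 * real n * (\<bar>x\<bar> + real n)) + c" for x n
  proof -
    have "(\<integral>\<^sup>+l. indicator {- real n..real n} l * abs_log (x - l) \<partial>lborel) \<le>
      (\<integral>\<^sup>+l. ennreal (\<bar>x\<bar> + real n) * indicator {- real n..real n} l + ennreal (indicator {0..1} \<bar>x - l\<bar> * (2 / sqrt \<bar>x - l\<bar>)) \<partial>lborel)"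
    proof (rule nn_integral_mono_AE)
      show "AE l in lborel. indicator {- real n..real n} l * abs_log (x - l) \<le>
        ennreal (\<bar>x\<bar> + real n) * indicator {- real n..real n} l + ennreal (indicator {0..1} \<bar>x - l\<bar> * (2 / sqrt \<bar>x - l\<bar>))"
        using AE_lborel_singleton[of x]
      proof eventually_elim
        case (elim l)
        show ?case
        proof (cases "l \<in> {- real n..real n}")
          case True
          have "\<bar>ln \<bar>x - l\<bar>\<bar> \<le> (\<bar>x\<bar> + real n) + indicator {0..1} \<bar>x - l\<bar> * (2 / sqrt \<bar>x - l\<bar>)"
          proof -
            have "\<bar>l\<bar> \<le> real n" using True by auto
            moreover have "x - l \<noteq> 0" using elim by simp
            ultimately show ?thesis using abs_ln_le_sqrt[of "x - l"] by linarith
          qed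
          then have "ennreal \<bar>ln \<bar>x - l\<bar>\<bar> \<le> ennreal ((\<bar>x\<bar> + real n) + indicator {0..1} \<bar>x - l\<bar> * (2 / sqrt \<bar>x - l\<bar>))"
            by (rule ennreal_leI)
          also have "\<dots> = ennreal (\<bar>x\<bar> + real n) + ennreal (indicator {0..1} \<bar>x - l\<bar> * (2 / sqrt \<bar>x - l\<bar>))"
            by (intro ennreal_plus) auto
          finally show ?thesis using True elim by (simp add: abs_log_def)
        qed simp
      qed
    qed
    also have "\<dots> = (\<integral>\<^sup>+l. ennreal (\<bar>x\<bar> + real n) * indicator {- real n..real n} l \<partial>lborel) +
        (\<integral>\<^sup>+l. ennreal (indicator {0..1} \<bar>x - l\<bar> * (2 / sqrt \<bar>x - l\<bar>)) \<partial>lborel)"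
      by (intro nn_integral_add) auto
    also have "(\<integral>\<^sup>+l. ennreal (\<bar>x\<bar> + real n) * indicator {- real n..real n} l \<partial>lborel) = ennreal (2 * real n * (\<bar>x\<bar> + real n))"
    proof -
      have "(\<integral>\<^sup>+l. ennreal (\<bar>x\<bar> + real n) * indicator {- real n..real n} l \<partial>lborel) = ennreal (\<bar>x\<bar> + real n) * ennreal (2 * real n)"
        by (subst nn_integral_cmult_indicator) simp_all
      also have "\<dots> = ennreal ((\<bar>x\<bar> + real n) * (2 * real n))" by (intro ennreal_mult[symmetric]) auto
      finally show ?thesis by (simp only: mult.commute)
    qed
    also have "(\<integral>\<^sup>+l. ennreal (indicator {0..1} \<bar>x - l\<bar> * (2 / sqrt \<bar>x - l\<bar>)) \<partial>lborel) = c"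
      unfolding c_def
      using nn_integral_real_affine[of "\<lambda>s. ennreal (indicator {0..1} \<bar>s\<bar> * (2 / sqrt \<bar>s\<bar>))" "-1" x] by simp
    finally show ?thesis .
  qed
  have fin: "AE l in lborel. l \<in> {- real n..real n} \<longrightarrow> (\<integral>\<^sup>+\<zeta>. abs_log (\<omega> \<zeta> - l) \<partial>circle) \<noteq> \<infinity>" for n
  proof -
    have "(\<integral>\<^sup>+l. indicator {- real n..real n} l * (\<integral>\<^sup>+\<zeta>. abs_log (\<omega> \<zeta> - l) \<partial>circle) \<partial>lborel) =
      (\<integral>\<^sup>+l. (\<integral>\<^sup>+\<zeta>. indicator {- real n..real n} l * abs_log (\<omega> \<zeta> - l) \<partial>circle) \<partial>lborel)"
      by (intro nn_integral_cong nn_integral_cmult[symmetric]) measurable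
    also have "\<dots> = (\<integral>\<^sup>+\<zeta>. (\<integral>\<^sup>+l. indicator {- real n..real n} l * abs_log (\<omega> \<zeta> - l) \<partial>lborel) \<partial>circle)"
      by (rule Fubini') measurable
    also have "\<dots> \<le> (\<integral>\<^sup>+\<zeta>. ennreal (2 * real n * (\<bar>\<omega> \<zeta>\<bar> + real n)) + c \<partial>circle)"
      by (intro nn_integral_mono inner)
    also have "\<dots> = (\<integral>\<^sup>+\<zeta>. ennreal (2 * real n * (\<bar>\<omega> \<zeta>\<bar> + real n)) \<partial>circle) + c"
      by (subst nn_integral_add) (auto simp: circle.emeasure_space_1[simplified])
    also have "(\<integral>\<^sup>+\<zeta>. ennreal (2 * real n * (\<bar>\<omega> \<zeta>\<bar> + real n)) \<partial>circle) = ennreal (LINT \<zeta>|circle. 2 * real n * (\<bar>\<omega> \<zeta>\<bar> + real n))"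
      using \<omega> by (intro nn_integral_eq_integral) auto
    also have "\<dots> + c < \<infinity>" using c by simp
    finally have "AE l in lborel. indicator {- real n..real n} l * (\<integral>\<^sup>+\<zeta>. abs_log (\<omega> \<zeta> - l) \<partial>circle) \<noteq> \<infinity>"
      by (intro nn_integral_PInf_AE) (auto simp: less_top)
    then show ?thesis by eventually_elim auto
  qed
  then have "AE l in lborel. \<forall>n. l \<in> {- real n..real n} \<longrightarrow> (\<integral>\<^sup>+\<zeta>. abs_log (\<omega> \<zeta> - l) \<partial>circle) \<noteq> \<infinity>"
    unfolding AE_all_countable by blast
  then show ?thesis
  proof eventually_elim
    case (elim l)
    obtain n :: nat where "\<bar>l\<bar> \<le> real n" using real_arch_simple by blast
    then have "l \<in> {- real n..real n}" by auto
    then have f: "(\<integral>\<^sup>+\<zeta>. abs_log (\<omega> \<zeta> - l) \<partial>circle) \<noteq> \<infinity>" using elim by blast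
    then have "AE \<zeta> in circle. abs_log (\<omega> \<zeta> - l) \<noteq> \<infinity>" by (intro nn_integral_PInf_AE) auto
    then have ne: "AE \<zeta> in circle. \<omega> \<zeta> \<noteq> l" by eventually_elim (auto simp: abs_log_def)
    have "(\<integral>\<^sup>+\<zeta>. ennreal (norm (ln \<bar>\<omega> \<zeta> - l\<bar>)) \<partial>circle) = (\<integral>\<^sup>+\<zeta>. abs_log (\<omega> \<zeta> - l) \<partial>circle)"
      using ne by (intro nn_integral_cong_AE, eventually_elim) (simp add: abs_log_def)
    then have "integrable circle (\<lambda>\<zeta>. ln \<bar>\<omega> \<zeta> - l\<bar>)"
      using f by (intro integrableI_bounded) (auto simp: less_top)
    then show ?case using ne by blast
  qed
qed

section \<open>Analytic continuation of the resolvent\<close>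

lemma continuous_on_Hker_sum:
  assumes "norm u < 1" "norm v < 1"
  shows "continuous_on (sphere 0 1) (\<lambda>\<zeta>. cnj (Hker (u * cnj \<zeta>)) + Hker (v * cnj \<zeta>))"
  by (intro continuous_intros continuous_on_Hker_circle assms)

lemma integral_mult_Hker_sum:
  assumes u: "norm u < 1" and v: "norm v < 1" and g: "integrable circle (g :: complex \<Rightarrow> real)"
  shows "integrable circle (\<lambda>\<zeta>. complex_of_real (g \<zeta>) * (cnj (Hker (u * cnj \<zeta>)) + Hker (v * cnj \<zeta>)))"
    and "(LINT \<zeta>|circle. complex_of_real (g \<zeta>) * (cnj (Hker (u * cnj \<zeta>)) + Hker (v * cnj \<zeta>))) =
      cnj (LINT \<zeta>|circle. complex_of_real (g \<zeta>) * Hker (u * cnj \<zeta>)) + (LINT \<zeta>|circle. complex_of_real (g \<zeta>) * Hker (v * cnj \<zeta>))"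
proof -
  have i: "integrable circle (\<lambda>\<zeta>. complex_of_real (g \<zeta>) * Hker (z * cnj \<zeta>))" if "norm z < 1" for z
    using g that by (intro circle_integrable_mult_Hker) simp
  have i': "integrable circle (\<lambda>\<zeta>. complex_of_real (g \<zeta>) * cnj (Hker (u * cnj \<zeta>)))"
  proof -
    have "integrable circle (\<lambda>\<zeta>. cnj (complex_of_real (g \<zeta>) * Hker (u * cnj \<zeta>)))"
      unfolding complex_integrable_cnj by (rule i[OF u])
    then show ?thesis by simp
  qed
  show "integrable circle (\<lambda>\<zeta>. complex_of_real (g \<zeta>) * (cnj (Hker (u * cnj \<zeta>)) + Hker (v * cnj \<zeta>)))"
    unfolding distrib_left by (intro Bochner_Integration.integrable_add i i' v)
  have "(LINT \<zeta>|circle. complex_of_real (g \<zeta>) * cnj (Hker (u * cnj \<zeta>))) =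
      (LINT \<zeta>|circle. cnj (complex_of_real (g \<zeta>) * Hker (u * cnj \<zeta>)))" by simp
  also have "\<dots> = cnj (LINT \<zeta>|circle. complex_of_real (g \<zeta>) * Hker (u * cnj \<zeta>))"
    by (rule Bochner_Integration.integral_cnj)
  finally show "(LINT \<zeta>|circle. complex_of_real (g \<zeta>) * (cnj (Hker (u * cnj \<zeta>)) + Hker (v * cnj \<zeta>))) =
      cnj (LINT \<zeta>|circle. complex_of_real (g \<zeta>) * Hker (u * cnj \<zeta>)) + (LINT \<zeta>|circle. complex_of_real (g \<zeta>) * Hker (v * cnj \<zeta>))"
    unfolding distrib_left Bochner_Integration.integral_add[OF i' i[OF v]] by simp
qed

text \<open>For z = l + \<i> \<epsilon> the argument of the logarithm is \<omega> - l - \<i>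
  \<epsilon>, so the negative axis is approached from below and the limiting argument is -
  \<pi>.\<close>

lemma Ln_boundary_below:
  fixes x :: real
  assumes "x \<noteq> 0"
  shows "((\<lambda>\<epsilon>. Ln (complex_of_real x - \<i> * complex_of_real \<epsilon>)) \<longlongrightarrow>
    complex_of_real (ln \<bar>x\<bar>) - (if x < 0 then \<i> * pi else 0)) (at_right 0)"
proof (cases "0 < x")
  case True
  have "((\<lambda>\<epsilon>. Ln (complex_of_real x - \<i> * complex_of_real \<epsilon>)) \<longlongrightarrow> Ln (complex_of_real x - \<i> * complex_of_real 0)) (at_right 0)"
    using True by (intro tendsto_intros) (auto simp: complex_nonpos_Reals_iff)
  then show ?thesis using True by (simp add: Ln_of_real)
next
  case False
  then have x: "x < 0" using assms by simp
  \<comment> \<open>For negative x the negated argument lies near the positive axis, where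
    \<open>Ln\<close> is continuous; negation costs \<i> \<pi>.\<close>
  have "((\<lambda>\<epsilon>. Ln (complex_of_real (- x) + \<i> * complex_of_real \<epsilon>) - \<i> * pi) \<longlongrightarrow>
      Ln (complex_of_real (- x) + \<i> * complex_of_real 0) - \<i> * pi) (at_right 0)"
    using x by (intro tendsto_intros) (auto simp: complex_nonpos_Reals_iff)
  then have lim: "((\<lambda>\<epsilon>. Ln (complex_of_real (- x) + \<i> * complex_of_real \<epsilon>) - \<i> * pi) \<longlongrightarrow>
      complex_of_real (ln \<bar>x\<bar>) - (if x < 0 then \<i> * pi else 0)) (at_right 0)"
    using x Ln_of_real[of "- x"] by simp
  show ?thesis
  proof (rule Lim_transform_eventually[OF lim], rule eventually_mono[OF eventually_at_right_less])
    fix \<epsilon> :: real assume \<epsilon>: "0 < \<epsilon>"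
    let ?z = "complex_of_real (- x) + \<i> * complex_of_real \<epsilon>"
    have "Im ?z = \<epsilon>" by simp
    then have "?z \<noteq> 0" using \<epsilon> by (metis less_irrefl zero_complex.sel(2))
    from Ln_minus[OF this] have "Ln (- ?z) = Ln ?z - \<i> * pi" using \<epsilon> by simp
    then show "Ln ?z - \<i> * pi = Ln (complex_of_real x - \<i> * complex_of_real \<epsilon>)" by simp
  qed
qed

lemma norm_Ln_le: "z \<noteq> 0 \<Longrightarrow> norm (Ln z) \<le> \<bar>ln (norm z)\<bar> + pi"
  using cmod_le[of "Ln z"] mpi_less_Im_Ln[of z] Im_Ln_le_pi[of z] by (auto simp: abs_le_iff)

lemma norm_Ln_shift_le:
  fixes x \<epsilon> :: real
  assumes x: "x \<noteq> 0" and \<epsilon>: "0 < \<epsilon>"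
  shows "norm (Ln (complex_of_real x - \<i> * complex_of_real \<epsilon>)) \<le> \<bar>ln \<bar>x\<bar>\<bar> + \<bar>x\<bar> + \<epsilon> + pi"
proof -
  define y where "y = norm (complex_of_real x - \<i> * complex_of_real \<epsilon>)"
  have y1: "\<bar>x\<bar> \<le> y" unfolding y_def using abs_Re_le_cmod[of "complex_of_real x - \<i> * complex_of_real \<epsilon>"] by simp
  have y2: "y \<le> \<bar>x\<bar> + \<epsilon>" unfolding y_def
    using norm_triangle_ineq4[of "complex_of_real x" "\<i> * complex_of_real \<epsilon>"] \<epsilon> by (simp add: norm_mult)
  have "\<bar>ln y\<bar> \<le> \<bar>ln \<bar>x\<bar>\<bar> + y"
    by (rule abs_ln_le) (use x y1 in auto)
  moreover have "complex_of_real x - \<i> * complex_of_real \<epsilon> \<noteq> 0" using x y1 unfolding y_def by auto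
  ultimately show ?thesis using norm_Ln_le[of "complex_of_real x - \<i> * complex_of_real \<epsilon>"] y2 unfolding y_def by linarith
qed

section \<open>The logarithmic integral on the slit plane and its boundary values\<close>

context semibounded_symbol
begin

definition slit :: "complex set" where "slit = - (complex_of_real ` {\<gamma>..})"

lemma open_slit: "open slit"
  unfolding slit_def using closed_slot_right open_Compl by blast

lemma connected_slit: "connected slit"
  unfolding slit_def using starlike_slotted_complex_plane_right starlike_imp_connected by blast

lemma slit_not_nonpos:
  assumes z: "z \<in> slit" and x: "\<gamma> \<le> x" shows "complex_of_real x - z \<notin> \<real>\<^sub>\<le>\<^sub>0"
proof
  assume "complex_of_real x - z \<in> \<real>\<^sub>\<le>\<^sub>0"
  then obtain y where "y \<le> 0" "complex_of_real x - z = complex_of_real y" by (auto elim: nonpos_Reals_cases)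
  then have "z = complex_of_real (x - y)" "\<gamma> \<le> x - y" using x by (auto simp: algebra_simps)
  then have "z \<in> complex_of_real ` {\<gamma>..}" by (intro image_eqI[of _ _ "x - y"]) auto
  then show False using z unfolding slit_def by simp
qed

text \<open>Half the distance allowed by openness leaves a uniform gap between the small disc and
  the ray. This gap yields the majorants for differentiation under the integral, both on the circle
  and for the spectral measures.\<close>

lemma slit_ball:
  assumes "z0 \<in> slit"
  obtains r where "r > 0" "cball z0 r \<subseteq> slit"
    "\<forall>z\<in>cball z0 r. \<forall>x\<ge>\<gamma>. r \<le> norm (complex_of_real x - z)"
proof -
  obtain e where e: "e > 0" "cball z0 e \<subseteq> slit" using open_slit assms open_contains_cball by blast
  show ?thesis
  proof (rule that[of "e / 2"])
    show "cball z0 (e / 2) \<subseteq> slit" using e by (intro subset_trans[OF _ e(2)] subset_cball) simp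
    have "e / 2 \<le> norm (complex_of_real x - z)" if "z \<in> cball z0 (e / 2)" "\<gamma> \<le> x" for z x
    proof -
      have "complex_of_real x \<notin> slit" using that(2) unfolding slit_def by auto
      then have "complex_of_real x \<notin> cball z0 e" using e by blast
      then have "e < dist z0 (complex_of_real x)" by simp
      also have "\<dots> \<le> dist z0 z + dist z (complex_of_real x)" by (rule dist_triangle)
      finally show ?thesis using that(1) by (simp add: dist_norm norm_minus_commute)
    qed
    then show "\<forall>z\<in>cball z0 (e / 2). \<forall>x\<ge>\<gamma>. e / 2 \<le> norm (complex_of_real x - z)" by blast
  qed (use e in simp)
qed

text \<open>The truncation \<open>max (\<omega> \<zeta>) \<gamma>\<close> equals \<open>\<omega>\<close> almost everywhere and keeps the argument of the logarithm
  away from its branch cut everywhere.\<close>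

abbreviation trunc :: "complex \<Rightarrow> complex" where "trunc \<zeta> \<equiv> complex_of_real (max (\<omega> \<zeta>) \<gamma>)"

text \<open>The conjugation that belongs to u acts on the kernel and not on the logarithm. For real
  z below \<gamma> the logarithm is real almost everywhere and the two readings agree, while this
  one is holomorphic in z.\<close>

definition log_integral :: "complex \<Rightarrow> complex \<Rightarrow> complex \<Rightarrow> complex" where
  "log_integral z u v = (LINT \<zeta>|circle. Ln (trunc \<zeta> - z) * (cnj (Hker (u * cnj \<zeta>)) + Hker (v * cnj \<zeta>)))"

definition resolvent_kernel :: "complex \<Rightarrow> complex \<Rightarrow> complex \<Rightarrow> complex" where
  "resolvent_kernel z u v = inverse (1 - cnj u * v) * exp (- (1 / 2) * log_integral z u v)"

lemma Ln_symbol_measurable: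
  assumes "z \<in> slit" shows "(\<lambda>\<zeta>. Ln (trunc \<zeta> - z)) \<in> borel_measurable circle"
proof -
  have "continuous_on UNIV (\<lambda>x. Ln (complex_of_real (max x \<gamma>) - z))"
    using slit_not_nonpos[OF assms] by (intro continuous_intros) auto
  then show ?thesis by (intro measurable_compose[OF symbol_measurable] borel_measurable_continuous_onI)
qed

lemma integrable_Ln_symbol:
  assumes z: "z \<in> slit" shows "integrable circle (\<lambda>\<zeta>. Ln (trunc \<zeta> - z))"
proof -
  obtain r where r: "r > 0" "cball z r \<subseteq> slit" "\<forall>y\<in>cball z r. \<forall>x\<ge>\<gamma>. r \<le> norm (complex_of_real x - y)"
    by (rule slit_ball[OF z])
  show ?thesis
  proof (rule Bochner_Integration.integrable_bound)
    show "integrable circle (\<lambda>\<zeta>. \<bar>ln r\<bar> + (\<bar>\<omega> \<zeta>\<bar> + \<bar>\<gamma>\<bar> + norm z) + pi)" using integrable_symbol by simp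
    show "(\<lambda>\<zeta>. Ln (trunc \<zeta> - z)) \<in> borel_measurable circle" by (rule Ln_symbol_measurable[OF z])
    show "AE \<zeta> in circle. norm (Ln (trunc \<zeta> - z)) \<le> norm (\<bar>ln r\<bar> + (\<bar>\<omega> \<zeta>\<bar> + \<bar>\<gamma>\<bar> + norm z) + pi)"
    proof (rule AE_I2)
      fix \<zeta>
      let ?w = "trunc \<zeta> - z"
      have w: "r \<le> norm ?w" using r(1) by (intro r(3)[rule_format]) auto
      then have "?w \<noteq> 0" using r(1) by auto
      from norm_Ln_le[OF this] have "norm (Ln ?w) \<le> \<bar>ln (norm ?w)\<bar> + pi" .
      also have "\<bar>ln (norm ?w)\<bar> \<le> \<bar>ln r\<bar> + norm ?w" by (rule abs_ln_le[OF r(1) w])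
      also have "norm ?w \<le> \<bar>max (\<omega> \<zeta>) \<gamma>\<bar> + norm z" using norm_triangle_ineq4[of "trunc \<zeta>" z] by simp
      also have "\<bar>max (\<omega> \<zeta>) \<gamma>\<bar> \<le> \<bar>\<omega> \<zeta>\<bar> + \<bar>\<gamma>\<bar>" by (auto simp: max_def)
      finally show "norm (Ln ?w) \<le> norm (\<bar>ln r\<bar> + (\<bar>\<omega> \<zeta>\<bar> + \<bar>\<gamma>\<bar> + norm z) + pi)" by simp
    qed
  qed
qed

lemma integrable_mult_Hker_sum:
  assumes "norm u < 1" "norm v < 1" "integrable circle f"
  shows "integrable circle (\<lambda>\<zeta>. f \<zeta> * (cnj (Hker (u * cnj \<zeta>)) + Hker (v * cnj \<zeta>)))"
proof -
  have "bounded ((\<lambda>\<zeta>. cnj (Hker (u * cnj \<zeta>)) + Hker (v * cnj \<zeta>)) ` sphere 0 1)"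
    by (intro compact_imp_bounded compact_continuous_image continuous_on_Hker_sum assms) simp
  then obtain B where "\<forall>y\<in>(\<lambda>\<zeta>. cnj (Hker (u * cnj \<zeta>)) + Hker (v * cnj \<zeta>)) ` sphere 0 1. norm y \<le> B"
    unfolding bounded_iff by blast
  then show ?thesis
    by (intro circle_integrable_mult_bounded[OF assms(3), of _ B] continuous_measurable_circle
        continuous_on_Hker_sum assms AE_I2) auto
qed

lemma resolvent_kernel_holomorphic:
  assumes u: "norm u < 1" and v: "norm v < 1"
  shows "(\<lambda>z. resolvent_kernel z u v) holomorphic_on slit"
proof -
  let ?q = "\<lambda>\<zeta>. cnj (Hker (u * cnj \<zeta>)) + Hker (v * cnj \<zeta>)"
  have qi: "integrable circle ?q" by (intro integrable_circle_continuous continuous_on_Hker_sum u v)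
  have "(\<lambda>z. log_integral z u v) holomorphic_on slit"
    unfolding log_integral_def
  proof (rule holomorphic_on_integral[where f' = "\<lambda>z \<zeta>. - (1 / (trunc \<zeta> - z)) * ?q \<zeta>"])
    show "integrable circle (\<lambda>\<zeta>. Ln (trunc \<zeta> - z) * ?q \<zeta>)" if "z \<in> slit" for z
      by (intro integrable_mult_Hker_sum u v integrable_Ln_symbol that)
    show "(\<lambda>\<zeta>. - (1 / (trunc \<zeta> - z)) * ?q \<zeta>) \<in> borel_measurable circle" if "z \<in> slit" for z
    proof (rule borel_measurable_times[OF _ borel_measurable_integrable[OF qi]])
      have nz: "complex_of_real (max x \<gamma>) - z \<noteq> 0" for x
        using slit_not_nonpos[OF that, of "max x \<gamma>"] by auto
      have "continuous_on UNIV (\<lambda>x. - (1 / (complex_of_real (max x \<gamma>) - z)))"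
        using nz by (intro continuous_intros) auto
      then show "(\<lambda>\<zeta>. - (1 / (trunc \<zeta> - z))) \<in> borel_measurable circle"
        by (intro measurable_compose[OF symbol_measurable] borel_measurable_continuous_onI)
    qed
    show "AE \<zeta> in circle. \<forall>z\<in>slit. ((\<lambda>z. Ln (trunc \<zeta> - z) * ?q \<zeta>) has_field_derivative
        - (1 / (trunc \<zeta> - z)) * ?q \<zeta>) (at z)"
    proof (intro AE_I2 ballI)
      fix \<zeta> z assume z: "z \<in> slit"
      have "trunc \<zeta> - z \<notin> \<real>\<^sub>\<le>\<^sub>0" by (rule slit_not_nonpos[OF z]) simp
      then have "((\<lambda>z. Ln (trunc \<zeta> - z)) has_field_derivative
          inverse (trunc \<zeta> - z) * (0 - 1)) (at z)"
        by (intro DERIV_chain2[OF has_field_derivative_Ln] DERIV_diff DERIV_const DERIV_ident)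
      then have "((\<lambda>z. Ln (trunc \<zeta> - z)) has_field_derivative
          - (1 / (trunc \<zeta> - z))) (at z)" by (simp add: inverse_eq_divide)
      then show "((\<lambda>z. Ln (trunc \<zeta> - z) * ?q \<zeta>) has_field_derivative
          - (1 / (trunc \<zeta> - z)) * ?q \<zeta>) (at z)" by (rule DERIV_cmult_right)
    qed
    fix z0 assume z0: "z0 \<in> slit"
    obtain r where r: "r > 0" "cball z0 r \<subseteq> slit"
      "\<forall>z\<in>cball z0 r. \<forall>x\<ge>\<gamma>. r \<le> norm (complex_of_real x - z)" by (rule slit_ball[OF z0])
    show "\<exists>r>0. \<exists>w. cball z0 r \<subseteq> slit \<and> integrable circle w \<and>
      (AE \<zeta> in circle. \<forall>z\<in>cball z0 r. norm (- (1 / (trunc \<zeta> - z)) * ?q \<zeta>) \<le> w \<zeta>)"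
    proof (intro exI[of _ r] conjI r(1,2) exI[of _ "\<lambda>\<zeta>. 1 / r * norm (?q \<zeta>)"] AE_I2 ballI)
      show "integrable circle (\<lambda>\<zeta>. 1 / r * norm (?q \<zeta>))" by (intro integrable_mult_right integrable_norm qi)
      fix \<zeta> z assume z: "z \<in> cball z0 r"
      have "r \<le> norm (trunc \<zeta> - z)" by (rule r(3)[rule_format, OF z]) simp
      then have "1 / norm (trunc \<zeta> - z) \<le> 1 / r" using r(1) by (intro frac_le) auto
      from mult_right_mono[OF this, of "norm (?q \<zeta>)"]
      show "norm (- (1 / (trunc \<zeta> - z)) * ?q \<zeta>) \<le> 1 / r * norm (?q \<zeta>)"
        by (simp add: norm_mult norm_divide)
    qed
  qed
  then show ?thesis unfolding resolvent_kernel_def by (intro holomorphic_intros)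
qed

lemma resolvent_kernel_real:
  assumes l: "l < \<gamma>" and u: "norm u < 1" and v: "norm v < 1"
  shows "resolvent_kernel (complex_of_real l) u v = ip (resolvent_Kker l u) (Kker v)"
proof -
  have "log_integral (complex_of_real l) u v =
    (LINT \<zeta>|circle. complex_of_real (lg l \<zeta>) * (cnj (Hker (u * cnj \<zeta>)) + Hker (v * cnj \<zeta>)))"
    unfolding log_integral_def
  proof (rule integral_cong_AE)
    have s: "complex_of_real l \<in> slit" unfolding slit_def using l by auto
    show "(\<lambda>\<zeta>. Ln (trunc \<zeta> - complex_of_real l) * (cnj (Hker (u * cnj \<zeta>)) + Hker (v * cnj \<zeta>))) \<in> borel_measurable circle"
      by (intro borel_measurable_integrable integrable_mult_Hker_sum u v integrable_Ln_symbol s)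
    show "(\<lambda>\<zeta>. complex_of_real (lg l \<zeta>) * (cnj (Hker (u * cnj \<zeta>)) + Hker (v * cnj \<zeta>))) \<in> borel_measurable circle"
      by (intro borel_measurable_integrable integral_mult_Hker_sum(1) u v integrable_lg l)
    show "AE \<zeta> in circle. Ln (trunc \<zeta> - complex_of_real l) * (cnj (Hker (u * cnj \<zeta>)) + Hker (v * cnj \<zeta>)) =
      complex_of_real (lg l \<zeta>) * (cnj (Hker (u * cnj \<zeta>)) + Hker (v * cnj \<zeta>))"
      using AE_symbol_ge
    proof eventually_elim
      case (elim \<zeta>)
      have "Ln (trunc \<zeta> - complex_of_real l) = Ln (complex_of_real (\<omega> \<zeta> - l))"
        using elim by (simp add: max_def)
      also have "\<dots> = complex_of_real (lg l \<zeta>)" using elim l by (intro Ln_of_real) simp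
      finally show ?case by simp
    qed
  qed
  then have log: "log_integral (complex_of_real l) u v =
      cnj (LINT \<zeta>|circle. complex_of_real (lg l \<zeta>) * Hker (u * cnj \<zeta>)) + (LINT \<zeta>|circle. complex_of_real (lg l \<zeta>) * Hker (v * cnj \<zeta>))"
    using integral_mult_Hker_sum(2)[OF u v integrable_lg[OF l]] by simp
  have inv: "inv_outer l z = exp (- (1 / 2) * (LINT \<zeta>|circle. complex_of_real (lg l \<zeta>) * Hker (z * cnj \<zeta>)))" for z
    unfolding inv_outer_eq outer_def exp_minus[symmetric] by simp
  have "- (1 / 2) * (cnj a + b) = cnj (- (1 / 2) * a) + - (1 / 2) * b" for a b :: complex
    by (simp add: algebra_simps)
  then show ?thesis
    unfolding ip_resolvent_Kker[OF l u v] resolvent_kernel_def log inv exp_cnj by (simp only: exp_add mult.assoc)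
qed

text \<open>The value of \<open>resolvent_kernel\<close> at l + \<i> 0. The last factor comes from -
  1/2 times the jump - \<i> \<pi> of the logarithm on \<Gamma>(l), integrated against the two
  Herglotz kernels; this produces the constant \<pi>/2 of \<open>Afun\<close>.\<close>

definition resolvent_boundary :: "real \<Rightarrow> complex \<Rightarrow> complex \<Rightarrow> complex" where
  "resolvent_boundary l u v = inverse (1 - cnj u * v) * cnj (xi \<omega> u l) * xi \<omega> v l * exp (\<i> * (cnj (Afun \<omega> u l) + Afun \<omega> v l))"

text \<open>Dominated convergence inside the logarithmic integral, along sequences of heights
  tending to 0. Such a sequence is bounded, and \<open>norm_Ln_shift_le\<close> then gives a
  majorant built from \<bar>ln \<bar>\<omega> - l\<bar>\<bar>, \<bar>\<omega> - l\<bar> and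
  constants.\<close>

lemma resolvent_kernel_boundary:
  assumes u: "norm u < 1" and v: "norm v < 1"
    and int: "integrable circle (\<lambda>\<zeta>. ln \<bar>\<omega> \<zeta> - l\<bar>)" and ne: "AE \<zeta> in circle. \<omega> \<zeta> \<noteq> l"
  shows "((\<lambda>\<epsilon>. resolvent_kernel (complex_of_real l + \<i> * complex_of_real \<epsilon>) u v) \<longlongrightarrow> resolvent_boundary l u v) (at_right 0)"
proof -
  let ?q = "\<lambda>\<zeta>. cnj (Hker (u * cnj \<zeta>)) + Hker (v * cnj \<zeta>)"
  \<comment> \<open>The pointwise limit of the logarithm where \<omega> differs from l; on
    \<open>Gam \<omega> l\<close> it has imaginary part - \<pi>.\<close>
  define \<Lambda> where "\<Lambda> \<zeta> = complex_of_real (ln \<bar>\<omega> \<zeta> - l\<bar>) - \<i> * pi * complex_of_real (indicator (Gam \<omega> l) \<zeta>)" for \<zeta>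
  have Gam: "Gam \<omega> l \<in> sets circle"
  proof -
    have "Gam \<omega> l = \<omega> -` {..<l} \<inter> space circle" unfolding Gam_def by auto
    then show ?thesis using measurable_sets[OF symbol_measurable, of "{..<l}"] by (simp only: lessThan_borel)
  qed
  have gi: "integrable circle (indicat_real (Gam \<omega> l))"
    by (intro circle.integrable_const_bound[where B = 1] borel_measurable_indicator Gam AE_I2) (simp add: indicator_def)
  have qi: "integrable circle ?q" by (intro integrable_circle_continuous continuous_on_Hker_sum u v)
  have slit: "complex_of_real l + \<i> * complex_of_real \<epsilon> \<in> slit" if "0 < \<epsilon>" for \<epsilon>
    using that unfolding slit_def by (auto simp: complex_eq_iff)
  have \<Lambda>i: "integrable circle \<Lambda>" unfolding \<Lambda>_def
    by (intro Bochner_Integration.integrable_diff integrable_mult_right) (use int gi in simp_all)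
  have lim: "((\<lambda>\<epsilon>. log_integral (complex_of_real l + \<i> * complex_of_real \<epsilon>) u v) \<longlongrightarrow> (LINT \<zeta>|circle. \<Lambda> \<zeta> * ?q \<zeta>)) (at_right 0)"
    unfolding tendsto_at_iff_sequentially
  proof (intro allI impI)
    fix X :: "nat \<Rightarrow> real" assume X: "\<forall>i. X i \<in> {0<..} - {0}" "X \<longlonglongrightarrow> 0"
    then have Xp: "0 < X i" for i by auto
    obtain B where B: "\<And>i. X i \<le> B"
      using convergent_imp_bounded[OF X(2)] unfolding bounded_iff by (auto simp: abs_le_iff)
    have "(\<lambda>i. LINT \<zeta>|circle. Ln (trunc \<zeta> - (complex_of_real l + \<i> * complex_of_real (X i))) * ?q \<zeta>)
        \<longlonglongrightarrow> (LINT \<zeta>|circle. \<Lambda> \<zeta> * ?q \<zeta>)"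
    proof (rule integral_dominated_convergence[where w = "\<lambda>\<zeta>. norm (complex_of_real (\<bar>ln \<bar>\<omega> \<zeta> - l\<bar>\<bar> + \<bar>\<omega> \<zeta> - l\<bar> + B + pi) * ?q \<zeta>)"])
      show "(\<lambda>\<zeta>. \<Lambda> \<zeta> * ?q \<zeta>) \<in> borel_measurable circle"
        by (intro borel_measurable_integrable integrable_mult_Hker_sum u v \<Lambda>i)
      show "(\<lambda>\<zeta>. Ln (trunc \<zeta> - (complex_of_real l + \<i> * complex_of_real (X i))) * ?q \<zeta>) \<in> borel_measurable circle" for i
        by (intro borel_measurable_integrable integrable_mult_Hker_sum u v integrable_Ln_symbol slit Xp)
      show "integrable circle (\<lambda>\<zeta>. norm (complex_of_real (\<bar>ln \<bar>\<omega> \<zeta> - l\<bar>\<bar> + \<bar>\<omega> \<zeta> - l\<bar> + B + pi) * ?q \<zeta>))"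
        using int integrable_symbol by (intro integrable_norm integral_mult_Hker_sum(1) u v) simp
      have eq: "trunc \<zeta> - (complex_of_real l + \<i> * complex_of_real (X i)) =
          complex_of_real (\<omega> \<zeta> - l) - \<i> * complex_of_real (X i)" if "\<gamma> \<le> \<omega> \<zeta>" for \<zeta> i
        using that by (simp add: max_def)
      show "AE \<zeta> in circle. (\<lambda>i. Ln (trunc \<zeta> - (complex_of_real l + \<i> * complex_of_real (X i))) * ?q \<zeta>)
          \<longlonglongrightarrow> \<Lambda> \<zeta> * ?q \<zeta>"
        using AE_symbol_ge ne AE_space
      proof eventually_elim
        case (elim \<zeta>)
        have "\<omega> \<zeta> - l \<noteq> 0" using elim(2) by simp
        from Ln_boundary_below[OF this] X
        have "((\<lambda>\<epsilon>. Ln (complex_of_real (\<omega> \<zeta> - l) - \<i> * complex_of_real \<epsilon>)) \<circ> X) \<longlonglongrightarrow>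
          complex_of_real (ln \<bar>\<omega> \<zeta> - l\<bar>) - (if \<omega> \<zeta> - l < 0 then \<i> * pi else 0)"
          unfolding tendsto_at_iff_sequentially by blast
        also have "complex_of_real (ln \<bar>\<omega> \<zeta> - l\<bar>) - (if \<omega> \<zeta> - l < 0 then \<i> * pi else 0) = \<Lambda> \<zeta>"
          unfolding \<Lambda>_def Gam_def using elim(3) by simp
        finally show ?case unfolding eq[OF elim(1)] o_def by (intro tendsto_mult tendsto_const)
      qed
      show "AE \<zeta> in circle. norm (Ln (trunc \<zeta> - (complex_of_real l + \<i> * complex_of_real (X i))) * ?q \<zeta>)
          \<le> norm (complex_of_real (\<bar>ln \<bar>\<omega> \<zeta> - l\<bar>\<bar> + \<bar>\<omega> \<zeta> - l\<bar> + B + pi) * ?q \<zeta>)" for i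
        using AE_symbol_ge ne
      proof eventually_elim
        case (elim \<zeta>)
        have "norm (Ln (complex_of_real (\<omega> \<zeta> - l) - \<i> * complex_of_real (X i))) \<le> \<bar>ln \<bar>\<omega> \<zeta> - l\<bar>\<bar> + \<bar>\<omega> \<zeta> - l\<bar> + X i + pi"
          using elim(2) by (intro norm_Ln_shift_le Xp) simp
        also have "\<dots> \<le> norm (complex_of_real (\<bar>ln \<bar>\<omega> \<zeta> - l\<bar>\<bar> + \<bar>\<omega> \<zeta> - l\<bar> + B + pi))"
          unfolding norm_of_real using B[of i] by linarith
        finally show ?case unfolding eq[OF elim(1)] norm_mult by (rule mult_right_mono) simp
      qed
    qed
    then show "((\<lambda>\<epsilon>. log_integral (complex_of_real l + \<i> * complex_of_real \<epsilon>) u v) \<circ> X) \<longlonglongrightarrow> (LINT \<zeta>|circle. \<Lambda> \<zeta> * ?q \<zeta>)"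
      unfolding log_integral_def o_def .
  qed
  have A: "Afun \<omega> z l = complex_of_real (pi / 2) * (LINT \<zeta>|circle. complex_of_real (indicat_real (Gam \<omega> l) \<zeta>) * Hker (z * cnj \<zeta>))" for z
    unfolding Afun_def set_lebesgue_integral_def scaleR_conv_of_real ..
  let ?L = "\<lambda>z. LINT \<zeta>|circle. complex_of_real (ln \<bar>\<omega> \<zeta> - l\<bar>) * Hker (z * cnj \<zeta>)"
  let ?G = "\<lambda>z. LINT \<zeta>|circle. complex_of_real (indicat_real (Gam \<omega> l) \<zeta>) * Hker (z * cnj \<zeta>)"
  have "(LINT \<zeta>|circle. \<Lambda> \<zeta> * ?q \<zeta>) =
    (LINT \<zeta>|circle. complex_of_real (ln \<bar>\<omega> \<zeta> - l\<bar>) * ?q \<zeta>) - (LINT \<zeta>|circle. \<i> * pi * (complex_of_real (indicat_real (Gam \<omega> l) \<zeta>) * ?q \<zeta>))"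
    unfolding \<Lambda>_def left_diff_distrib mult.assoc
    by (intro Bochner_Integration.integral_diff integrable_mult_right integral_mult_Hker_sum(1) u v int gi)
  also have "\<dots> = (cnj (?L u) + ?L v) - \<i> * pi * (cnj (?G u) + ?G v)"
    unfolding integral_mult_right_zero integral_mult_Hker_sum(2)[OF u v int] integral_mult_Hker_sum(2)[OF u v gi] ..
  finally have val: "(LINT \<zeta>|circle. \<Lambda> \<zeta> * ?q \<zeta>) = (cnj (?L u) + ?L v) - \<i> * pi * (cnj (?G u) + ?G v)" .
  have "- (1 / 2) * (LINT \<zeta>|circle. \<Lambda> \<zeta> * ?q \<zeta>) =
      cnj (- (1 / 2) * ?L u) + - (1 / 2) * ?L v + \<i> * (cnj (Afun \<omega> u l) + Afun \<omega> v l)"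
    unfolding val A by (simp add: field_simps)
  then have "inverse (1 - cnj u * v) * exp (- (1 / 2) * (LINT \<zeta>|circle. \<Lambda> \<zeta> * ?q \<zeta>)) = resolvent_boundary l u v"
    unfolding resolvent_boundary_def xi_def by (simp only: exp_add exp_cnj mult.assoc)
  moreover have "((\<lambda>\<epsilon>. resolvent_kernel (complex_of_real l + \<i> * complex_of_real \<epsilon>) u v) \<longlongrightarrow>
      inverse (1 - cnj u * v) * exp (- (1 / 2) * (LINT \<zeta>|circle. \<Lambda> \<zeta> * ?q \<zeta>))) (at_right 0)"
    unfolding resolvent_kernel_def by (intro tendsto_intros lim)
  ultimately show ?thesis by simp
qed

end

section \<open>The spectral density\<close>

context toeplitz_spectral
begin

definition kernel_comb :: "complex \<Rightarrow> complex \<Rightarrow> complex \<Rightarrow> complex \<Rightarrow> complex" where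
  "kernel_comb u v c \<zeta> = Kker u \<zeta> + c * Kker v \<zeta>"

text \<open>The sesquilinear expansion of \<open>B\<close> at the vector K_u + c K_v, linear in the
  first and conjugate linear in the second argument. \<open>B\<close> is not assumed Hermitian: off
  the real axis the resolvent kernel need not be.\<close>

definition quadratic :: "(complex \<Rightarrow> complex \<Rightarrow> complex) \<Rightarrow> complex \<Rightarrow> complex \<Rightarrow> complex \<Rightarrow> complex" where
  "quadratic B u v c = B u u + cnj c * B u v + c * B v u + c * cnj c * B v v"

context
  fixes u v :: complex
  assumes u: "norm u < 1" and v: "norm v < 1"
begin

lemma kernel_comb_H2: "kernel_comb u v c \<in> H2"
  unfolding kernel_comb_def[abs_def] by (intro H2_add H2_cmult Kker_H2 u v)

text \<open>The resolvent vector of a combination of kernels is the same combination of the vectors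
  \<open>resolvent_Kker\<close>, so \<open>resolvent_integral\<close> applies with k = K_u + c
  K_v.\<close>

lemma Stieltjes_transform_real:
  assumes l: "l < \<gamma>"
  shows "complex_of_real (LINT t|sm (kernel_comb u v c). 1 / (t - l)) =
    quadratic (resolvent_kernel (complex_of_real l)) u v c"
proof -
  let ?f = "\<lambda>\<zeta>. resolvent_Kker l u \<zeta> + c * resolvent_Kker l v \<zeta>"
  let ?h = "\<lambda>\<zeta>. (Kker u \<zeta> + complex_of_real l * resolvent_Kker l u \<zeta>) + c * (Kker v \<zeta> + complex_of_real l * resolvent_Kker l v \<zeta>)"
  have fh: "(?f, ?h) \<in> toeplitz \<omega>"
    by (intro toeplitz_lincomb resolvent_Kker_toeplitz l u v)
  have h_eq: "?h = (\<lambda>\<zeta>. kernel_comb u v c \<zeta> + complex_of_real l * ?f \<zeta>)"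
    by (simp add: fun_eq_iff kernel_comb_def algebra_simps)
  have "(LINT t|sm (kernel_comb u v c). 1 / (t - l)) = Re (ip ?f (kernel_comb u v c))"
    by (rule resolvent_integral[OF fh kernel_comb_H2 h_eq l])
  moreover have ip: "ip ?f (kernel_comb u v c) = quadratic (resolvent_kernel (complex_of_real l)) u v c"
  proof -
    have R: "resolvent_Kker l u \<in> L2" "resolvent_Kker l v \<in> L2" by (intro H2_L2 resolvent_Kker_H2 l u v)+
    have K: "Kker u \<in> L2" "Kker v \<in> L2" by (intro H2_L2 Kker_H2 u v)+
    have right: "ip g (kernel_comb u v c) = ip g (Kker u) + cnj c * ip g (Kker v)" if "g \<in> L2" for g
    proof -
      have "ip (kernel_comb u v c) g = ip (Kker u) g + c * ip (Kker v) g"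
        unfolding kernel_comb_def[abs_def] using ip_add_left[OF K(1) L2_cmult[OF K(2)] that] by (simp add: ip_cmult_left)
      then have "cnj (ip (kernel_comb u v c) g) = cnj (ip (Kker u) g) + cnj c * cnj (ip (Kker v) g)" by simp
      then show ?thesis by (simp only: ip_cnj)
    qed
    have "ip ?f (kernel_comb u v c) = ip (resolvent_Kker l u) (kernel_comb u v c) + c * ip (resolvent_Kker l v) (kernel_comb u v c)"
      using ip_add_left[OF R(1) L2_cmult[OF R(2)] H2_L2[OF kernel_comb_H2]] by (simp add: ip_cmult_left)
    then show ?thesis
      unfolding right[OF R(1)] right[OF R(2)] quadratic_def
      using resolvent_kernel_real[OF l u u] resolvent_kernel_real[OF l u v] resolvent_kernel_real[OF l v u] resolvent_kernel_real[OF l v v]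
      by (simp add: algebra_simps)
  qed
  \<comment> \<open>\<open>resolvent_integral\<close> yields only the real part. For real l the
    kernel is Hermitian in its two points, so the quadratic expression is real.\<close>
  moreover have "Im (ip ?f (kernel_comb u v c)) = 0"
  proof -
    have sym: "cnj (resolvent_kernel (complex_of_real l) a b) = resolvent_kernel (complex_of_real l) b a"
      if "norm a < 1" "norm b < 1" for a b
      unfolding resolvent_kernel_real[OF l that] resolvent_kernel_real[OF l that(2,1)]
        ip_resolvent_Kker[OF l that] ip_resolvent_Kker[OF l that(2,1)] by (simp add: mult_ac)
    have "cnj (ip ?f (kernel_comb u v c)) = ip ?f (kernel_comb u v c)"
      unfolding ip quadratic_def by (simp add: sym u v mult_ac)
    then show ?thesis by (metis Reals_cnj_iff complex_is_Real_iff)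
  qed
  ultimately show ?thesis by (simp add: complex_eq_iff)
qed

text \<open>Because the measure is carried by [\<gamma>, \<infinity>), the left side is holomorphic
  on the connected set \<open>slit\<close>, which contains the half-line where the identity is
  known. The point \<gamma> - 1 serves as limit point for the identity theorem.\<close>

lemma Stieltjes_transform:
  assumes z: "z \<in> slit"
  shows "(LINT t|sm (kernel_comb u v c). 1 / (complex_of_real t - z)) = quadratic (resolvent_kernel z) u v c"
proof -
  let ?\<mu> = "sm (kernel_comb u v c)"
  interpret finite_measure ?\<mu> by (rule finite_measure_sm[OF kernel_comb_H2])
  have mb: "g \<in> borel_measurable ?\<mu>" if "g \<in> borel_measurable borel" for g :: "real \<Rightarrow> complex"
    using that by (simp add: measurable_cong_sets[OF sets_sm refl])
  have bound: "norm (1 / (complex_of_real t - y)) \<le> 1 / r" if "r > 0" "r \<le> norm (complex_of_real t - y)" for t y r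
    using that by (simp add: norm_divide frac_le)
  have hol: "(\<lambda>z. LINT t|?\<mu>. 1 / (complex_of_real t - z)) holomorphic_on slit"
  proof (rule holomorphic_on_integral[where f' = "\<lambda>z t. 1 / (complex_of_real t - z)\<^sup>2"])
    show "integrable ?\<mu> (\<lambda>t. 1 / (complex_of_real t - y))" if y: "y \<in> slit" for y
    proof -
      obtain r where r: "r > 0" "cball y r \<subseteq> slit" "\<forall>z\<in>cball y r. \<forall>x\<ge>\<gamma>. r \<le> norm (complex_of_real x - z)"
        by (rule slit_ball[OF y])
      show ?thesis
      proof (rule integrable_const_bound[where B = "1 / r"])
        show "AE t in ?\<mu>. norm (1 / (complex_of_real t - y)) \<le> 1 / r"
          using AE_sm_ge[OF kernel_comb_H2]
        proof eventually_elim
          case (elim t)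
          show ?case by (rule bound[OF r(1)]) (use r elim in auto)
        qed
        show "(\<lambda>t. 1 / (complex_of_real t - y)) \<in> borel_measurable ?\<mu>" by (rule mb) measurable
      qed
    qed
    show "(\<lambda>t. 1 / (complex_of_real t - y)\<^sup>2) \<in> borel_measurable ?\<mu>" if "y \<in> slit" for y
      by (rule mb) measurable
    show "AE t in ?\<mu>. \<forall>z\<in>slit. ((\<lambda>z. 1 / (complex_of_real t - z)) has_field_derivative 1 / (complex_of_real t - z)\<^sup>2) (at z)"
      using AE_sm_ge[OF kernel_comb_H2]
    proof eventually_elim
      case (elim t)
      show ?case
      proof
        fix y assume "y \<in> slit"
        then have "complex_of_real t - y \<noteq> 0" using slit_not_nonpos[OF _ elim, of y] by auto
        then show "((\<lambda>z. 1 / (complex_of_real t - z)) has_field_derivative 1 / (complex_of_real t - y)\<^sup>2) (at y)"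
          by (auto intro!: derivative_eq_intros simp: power2_eq_square)
      qed
    qed
    fix z0 assume z0: "z0 \<in> slit"
    obtain r where r: "r > 0" "cball z0 r \<subseteq> slit" "\<forall>z\<in>cball z0 r. \<forall>x\<ge>\<gamma>. r \<le> norm (complex_of_real x - z)"
      by (rule slit_ball[OF z0])
    show "\<exists>r>0. \<exists>w. cball z0 r \<subseteq> slit \<and> integrable ?\<mu> w \<and>
        (AE t in ?\<mu>. \<forall>z\<in>cball z0 r. norm (1 / (complex_of_real t - z)\<^sup>2) \<le> w t)"
    proof (intro exI[of _ r] conjI r(1,2) exI[of _ "\<lambda>_. 1 / r\<^sup>2"])
      show "AE t in ?\<mu>. \<forall>z\<in>cball z0 r. norm (1 / (complex_of_real t - z)\<^sup>2) \<le> 1 / r\<^sup>2"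
        using AE_sm_ge[OF kernel_comb_H2]
      proof eventually_elim
        case (elim t)
        show ?case
        proof
          fix y assume "y \<in> cball z0 r"
          then have "r \<le> norm (complex_of_real t - y)" using r(3) elim by blast
          then have "r\<^sup>2 \<le> (norm (complex_of_real t - y))\<^sup>2" using r(1) by (intro power_mono) auto
          then show "norm (1 / (complex_of_real t - y)\<^sup>2) \<le> 1 / r\<^sup>2"
            using r(1) by (simp add: norm_divide norm_power frac_le)
        qed
      qed
    qed simp
  qed
  have hol2: "(\<lambda>z. quadratic (resolvent_kernel z) u v c) holomorphic_on slit"
    unfolding quadratic_def by (intro holomorphic_intros resolvent_kernel_holomorphic u v)
  let ?U = "complex_of_real ` {..<\<gamma>}"
  have "(LINT t|?\<mu>. 1 / (complex_of_real t - z)) - quadratic (resolvent_kernel z) u v c = 0"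
  proof (rule analytic_continuation[of "\<lambda>z. (LINT t|?\<mu>. 1 / (complex_of_real t - z)) - quadratic (resolvent_kernel z) u v c" slit ?U "complex_of_real (\<gamma> - 1)"])
    show "?U \<subseteq> slit" unfolding slit_def by auto
    have "complex_of_real (\<gamma> - 1) \<in> ?U" by (intro imageI) simp
    then show "complex_of_real (\<gamma> - 1) \<in> slit" using \<open>?U \<subseteq> slit\<close> by blast
    have "(\<gamma> - 1) islimpt {..<\<gamma>}" by (intro interior_limit_point) (simp add: interior_open)
    then have "\<exists>X. (\<forall>n. X n \<in> {..<\<gamma>} - {\<gamma> - 1}) \<and> X \<longlonglongrightarrow> \<gamma> - 1" unfolding islimpt_sequential by blast
    then obtain X where X: "\<And>n. X n \<in> {..<\<gamma>} - {\<gamma> - 1}" "X \<longlonglongrightarrow> \<gamma> - 1" by blast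
    show "complex_of_real (\<gamma> - 1) islimpt ?U"
      unfolding islimpt_sequential
    proof (intro exI[of _ "\<lambda>n. complex_of_real (X n)"] conjI allI)
      show "complex_of_real (X n) \<in> ?U - {complex_of_real (\<gamma> - 1)}" for n
        using X(1)[of n] by (simp only: Diff_iff image_iff singleton_iff of_real_eq_iff) blast
      show "(\<lambda>n. complex_of_real (X n)) \<longlonglongrightarrow> complex_of_real (\<gamma> - 1)" by (intro tendsto_of_real X)
    qed
    fix y assume "y \<in> ?U"
    then obtain l where l: "l < \<gamma>" "y = complex_of_real l" by auto
    have "(LINT t|?\<mu>. 1 / (complex_of_real t - y)) = (LINT t|?\<mu>. complex_of_real (1 / (t - l)))"
      unfolding l by simp
    also have "\<dots> = complex_of_real (LINT t|?\<mu>. 1 / (t - l))" by (rule integral_complex_of_real)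
    finally show "(LINT t|?\<mu>. 1 / (complex_of_real t - y)) - quadratic (resolvent_kernel y) u v c = 0"
      unfolding Stieltjes_transform_real[OF l(1)] l by simp
  qed (intro holomorphic_intros hol hol2 open_slit connected_slit z)+
  then show ?thesis by simp
qed

text \<open>Two limits of one quantity, 1/\<pi> times the imaginary part of the Stieltjes transform
  at l + \<i> \<epsilon>: Fatou's theorem gives the derivative, the explicit kernel gives its
  boundary value.\<close>

lemma derivative_measure_kernel_comb:
  assumes int: "integrable circle (\<lambda>\<zeta>. ln \<bar>\<omega> \<zeta> - l\<bar>)" and ne: "AE \<zeta> in circle. \<omega> \<zeta> \<noteq> l"
    and der: "((\<lambda>t. measure (sm (kernel_comb u v c)) {..<t}) has_real_derivative d) (at l)"
  shows "d = Im (quadratic (resolvent_boundary l) u v c) / pi"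
proof (rule tendsto_unique[of "at_right 0"])
  let ?\<mu> = "sm (kernel_comb u v c)"
  interpret finite_measure ?\<mu> by (rule finite_measure_sm[OF kernel_comb_H2])
  show "((\<lambda>\<epsilon>. LINT t|?\<mu>. \<epsilon> / ((t - l)\<^sup>2 + \<epsilon>\<^sup>2) / pi) \<longlongrightarrow> d) (at_right 0)"
    by (rule Stieltjes_transform_boundary[OF finite_measure_sm[OF kernel_comb_H2] sets_sm der])
  have lim: "((\<lambda>\<epsilon>. Im (quadratic (resolvent_kernel (complex_of_real l + \<i> * complex_of_real \<epsilon>)) u v c) / pi) \<longlongrightarrow>
      Im (quadratic (resolvent_boundary l) u v c) / pi) (at_right 0)"
    unfolding quadratic_def by (intro tendsto_intros resolvent_kernel_boundary u v int ne) simp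
  show "((\<lambda>\<epsilon>. LINT t|?\<mu>. \<epsilon> / ((t - l)\<^sup>2 + \<epsilon>\<^sup>2) / pi) \<longlongrightarrow> Im (quadratic (resolvent_boundary l) u v c) / pi) (at_right 0)"
  proof (rule Lim_transform_eventually[OF lim], rule eventually_mono[OF eventually_at_right_less])
    fix \<epsilon> :: real assume \<epsilon>: "0 < \<epsilon>"
    let ?z = "complex_of_real l + \<i> * complex_of_real \<epsilon>"
    have z: "?z \<in> slit" using \<epsilon> unfolding slit_def by (auto simp: complex_eq_iff)
    have im: "Im (1 / (complex_of_real t - ?z)) = \<epsilon> / ((t - l)\<^sup>2 + \<epsilon>\<^sup>2)" for t
      by (simp add: Im_divide)
    have "integrable ?\<mu> (\<lambda>t. 1 / (complex_of_real t - ?z))"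
    proof (rule integrable_const_bound[where B = "1 / \<epsilon>"])
      have "norm (1 / (complex_of_real t - ?z)) \<le> 1 / \<epsilon>" for t
      proof -
        have "\<epsilon> \<le> norm (complex_of_real t - ?z)" using abs_Im_le_cmod[of "complex_of_real t - ?z"] \<epsilon> by simp
        then show ?thesis unfolding norm_divide norm_one using \<epsilon> by (intro frac_le) auto
      qed
      then show "AE t in ?\<mu>. norm (1 / (complex_of_real t - ?z)) \<le> 1 / \<epsilon>" by simp
      show "(\<lambda>t. 1 / (complex_of_real t - ?z)) \<in> borel_measurable ?\<mu>"
        by (subst measurable_cong_sets[OF sets_sm refl]) measurable
    qed
    from Bochner_Integration.integral_Im[OF this] Stieltjes_transform[OF z, of c]
    have "Im (quadratic (resolvent_kernel ?z) u v c) = (LINT t|?\<mu>. \<epsilon> / ((t - l)\<^sup>2 + \<epsilon>\<^sup>2))"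
      unfolding im by simp
    then show "Im (quadratic (resolvent_kernel ?z) u v c) / pi = (LINT t|?\<mu>. \<epsilon> / ((t - l)\<^sup>2 + \<epsilon>\<^sup>2) / pi)"
      by (simp only: integral_divide_zero)
  qed
qed simp

lemma ip_E_Kker_polarization:
  assumes X: "X \<in> sets borel"
  shows "ip (E X (Kker u)) (Kker v) =
    (complex_of_real (measure (sm (kernel_comb u v 1)) X) - complex_of_real (measure (sm (kernel_comb u v (- 1))) X)
     + \<i> * complex_of_real (measure (sm (kernel_comb u v \<i>)) X) - \<i> * complex_of_real (measure (sm (kernel_comb u v (- \<i>))) X)) / 4"
proof -
  have m: "measure (sm (kernel_comb u v c)) X =
    measure (sm (Kker u)) X + (norm c)\<^sup>2 * measure (sm (Kker v)) X + 2 * Re (cnj c * ip (E X (Kker u)) (Kker v))" for c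
    unfolding kernel_comb_def[abs_def] by (rule measure_sm_lincomb[OF Kker_H2[OF u] Kker_H2[OF v] X])
  show ?thesis unfolding m by (simp add: complex_eq_iff)
qed

text \<open>Taking the imaginary part of a quadratic form replaces \<open>B\<close> by its
  skew-Hermitian part divided by \<i>; polarization therefore returns the difference of
  \<open>B u v\<close> and the conjugate of \<open>B v u\<close>, and not the imaginary part of
  \<open>B u v\<close>.\<close>

lemma quadratic_polarization:
  "(complex_of_real (Im (quadratic B u v 1)) - complex_of_real (Im (quadratic B u v (- 1)))
     + \<i> * complex_of_real (Im (quadratic B u v \<i>)) - \<i> * complex_of_real (Im (quadratic B u v (- \<i>)))) / 4
   = (B u v - cnj (B v u)) / (2 * \<i>)"
  unfolding quadratic_def by (rule complex_eqI) (simp_all add: Re_divide Im_divide field_simps)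

text \<open>Exchanging u and v and conjugating preserves the factors before the exponential and
  turns exp (\<i> a) into exp (- \<i> a), with a = cnj A(u) + A(v) complex in general. The
  difference over 2 \<i> is the complex sine.\<close>

lemma resolvent_boundary_jump:
  "(resolvent_boundary l u v - cnj (resolvent_boundary l v u)) / (2 * \<i>) =
    inverse (1 - cnj u * v) * cnj (xi \<omega> u l) * xi \<omega> v l * sin (cnj (Afun \<omega> u l) + Afun \<omega> v l)"
proof -
  let ?a = "cnj (Afun \<omega> u l) + Afun \<omega> v l"
  have "cnj (exp (\<i> * (cnj (Afun \<omega> v l) + Afun \<omega> u l))) = exp (- (\<i> * ?a))"
    unfolding exp_cnj by (simp add: algebra_simps)
  moreover have "cnj (inverse (1 - cnj v * u)) = inverse (1 - cnj u * v)" by (simp add: mult.commute)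
  ultimately have "cnj (resolvent_boundary l v u) = inverse (1 - cnj u * v) * cnj (xi \<omega> u l) * xi \<omega> v l * exp (- (\<i> * ?a))"
    unfolding resolvent_boundary_def complex_cnj_mult complex_cnj_cnj by (simp only: mult.assoc mult.left_commute)
  then show ?thesis
    unfolding resolvent_boundary_def sin_exp_eq by (simp only: right_diff_distrib[symmetric] times_divide_eq_right)
qed

text \<open>The excluded null set consists of the l for which the logarithm is not integrable or
  \<omega> takes the value l on a set of positive measure, together with the points where one of the
  four distribution functions used in the polarization is not differentiable. The latter depend on u
  and v.\<close>

theorem AE_spectral_density:
  "AE l in lborel. ((\<lambda>l. ip (E {..<l} (Kker u)) (Kker v)) has_vector_derivative
     complex_of_real (1 / pi) * inverse (1 - cnj u * v) * cnj (xi \<omega> u l) * xi \<omega> v l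
       * sin (cnj (Afun \<omega> u l) + Afun \<omega> v l)) (at l)"
proof -
  have ae: "AE l in lborel. \<exists>d. ((\<lambda>t. measure (sm (kernel_comb u v c)) {..<t}) has_real_derivative d) (at l)" for c
    by (rule AE_derivative_finite_measure[OF finite_measure_sm[OF kernel_comb_H2] sets_sm])
  show ?thesis
    using AE_integrable_log[OF integrable_symbol] ae[of 1] ae[of "- 1"] ae[of \<i>] ae[of "- \<i>"]
  proof eventually_elim
    case (elim l)
    let ?m = "\<lambda>c t. complex_of_real (measure (sm (kernel_comb u v c)) {..<t})"
    let ?d = "\<lambda>c. complex_of_real (Im (quadratic (resolvent_boundary l) u v c) / pi)"
    have d: "(?m c has_vector_derivative ?d c) (at l)"
      if ex: "\<exists>d. ((\<lambda>t. measure (sm (kernel_comb u v c)) {..<t}) has_real_derivative d) (at l)" for c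
    proof -
      obtain d where d: "((\<lambda>t. measure (sm (kernel_comb u v c)) {..<t}) has_real_derivative d) (at l)" using ex by blast
      have "d = Im (quadratic (resolvent_boundary l) u v c) / pi"
        using elim(1) by (intro derivative_measure_kernel_comb d) auto
      with d show ?thesis
        by (simp only: has_vector_derivative_of_real has_real_derivative_iff_has_vector_derivative)
    qed
    have "((\<lambda>t. (?m 1 t - ?m (- 1) t + \<i> * ?m \<i> t - \<i> * ?m (- \<i>) t) / 4) has_vector_derivative
      (?d 1 - ?d (- 1) + \<i> * ?d \<i> - \<i> * ?d (- \<i>)) / 4) (at l)"
      by (intro has_vector_derivative_divide has_vector_derivative_add has_vector_derivative_diff
          has_vector_derivative_mult_right d elim)
    also have "(?d 1 - ?d (- 1) + \<i> * ?d \<i> - \<i> * ?d (- \<i>)) / 4 =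
      (resolvent_boundary l u v - cnj (resolvent_boundary l v u)) / (2 * \<i>) / pi"
      unfolding quadratic_polarization[symmetric] by (simp add: add_divide_distrib diff_divide_distrib mult.commute)
    also have "\<dots> = complex_of_real (1 / pi) * inverse (1 - cnj u * v) * cnj (xi \<omega> u l) * xi \<omega> v l
       * sin (cnj (Afun \<omega> u l) + Afun \<omega> v l)"
      unfolding resolvent_boundary_jump by simp
    finally show ?case by (simp add: ip_E_Kker_polarization)
  qed
qed

end

end

theorem theorem3p9:
  fixes \<omega> :: "complex \<Rightarrow> real"
    and E :: "real set \<Rightarrow> (complex \<Rightarrow> complex) \<Rightarrow> (complex \<Rightarrow> complex)"
  assumes "integrable circle \<omega>"
    and "essinf circle \<omega> > -\<infinity>"
    and "\<not> (\<exists>c. AE \<zeta> in circle. \<omega> \<zeta> = c)"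
    and "spectral_measure_of (toeplitz \<omega>) E"
  shows "\<forall>u\<in>ball 0 1. \<forall>v\<in>ball 0 1. AE l in lborel.
    ((\<lambda>l. ip (E {..<l} (Kker u)) (Kker v)) has_vector_derivative
       complex_of_real (1 / pi) * inverse (1 - cnj u * v) * cnj (xi \<omega> u l) * xi \<omega> v l
         * sin (cnj (Afun \<omega> u l) + Afun \<omega> v l)) (at l)"
proof (intro ballI)
  interpret toeplitz_spectral \<omega> E
    using assms by unfold_locales (auto simp: spectral_measure_of_def)
  fix u v :: complex assume "u \<in> ball 0 1" "v \<in> ball 0 1"
  then show "AE l in lborel.
    ((\<lambda>l. ip (E {..<l} (Kker u)) (Kker v)) has_vector_derivative
       complex_of_real (1 / pi) * inverse (1 - cnj u * v) * cnj (xi \<omega> u l) * xi \<omega> v l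
         * sin (cnj (Afun \<omega> u l) + Afun \<omega> v l)) (at l)"
    by (intro AE_spectral_density) simp_all
qed

end
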